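(* Let $K:\mathcal{X}^2\to\mathbb{R}$ be the kernel of a reproducing kernel Hilbert space $\mathcal{H}$ of functions from $\mathcal{X}$ to $\mathbb{R}$, let $X,Y$ be random variables valued in the separable Hilbert spaces $\mathcal{X},\mathcal{Y}$ with $\mathbb{E}(\Vert Y\Vert_{\mathcal{Y}}^2)<+\infty$, let $\{(X_i,Y_i)\}_{1\le i\le n}$ be an i.i.d. sample of $(X,Y)$, and let $\{w_{i,n}(\gamma)\}_{1\le i\le n}$ be a triangular array of positive real numbers depending on a parameter $\gamma\in\,]0,1[$. Assume: (1) $\Vert K\Vert_\infty:=\sup_{(x,y)\in\mathcal{X}^2}K(x,y)<+\infty$; (2) there exist a real number $\tau>0$ and an integer $n_0$ such that for all $n>n_0$, $n\left|\frac1n\sum_{i=1}^n w_{i,n}(\gamma)-1\right|\le\tau$; (3) there exists $C>0$ such that $\max_{1\le i\le n}w_{i,n}(\gamma)<C$ for all $n\in\mathbb{N}^*$ and all $\gamma\in\,]0,1[$; (4) for any $\gamma\in\,]0,1[$, $\lim_{n\to+\infty}\frac1n\sum_{i=1}^n w_{i,n}^2(\gamma)=w^2(\gamma)>1$. Then, under the hypothesis $\mathscr{H}_0$: $\mathbb{E}(Y|X)=\mathbb{E}(Y)$ almost surely, as $n\to+\infty$, $$\sqrt{n}\,\frac{\widehat{K}_{n,\gamma}}{\widehat{\sigma}_\gamma}\longrightarrow\mathcal{N}(0,1)\quad\text{in distribution}.$$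
   Context: $X$ and $Y$ are random variables on a probability space $(\Omega,\mathscr{A},P)$ valued in separable (real) Hilbert spaces $\mathcal{X}$ and $\mathcal{Y}$, with $\mathbb{E}(\Vert Y\Vert_{\mathcal{Y}}^2)<+\infty$; $\mathbb{E}(Y|X)$ denotes conditional expectation. The kernel $K:\mathcal{X}^2\to\mathbb{R}$ is symmetric, with $K(x,\cdot)\in\mathcal{H}$ and $f(x)=\langle K(x,\cdot),f\rangle_{\mathcal{H}}$ for all $x\in\mathcal{X}$, $f\in\mathcal{H}$. Since $\Vert K\Vert_\infty<+\infty$, the kernel mean embedding $\mathbb{E}(K(X,\cdot))\in\mathcal{H}$ exists. The statistic $\widehat{K}_{n,\gamma}$ is $$\widehat{K}_{n,\gamma}=\frac{1}{n^2}\sum_{i,j=1}^n\langle Y_i,Y_j\rangle_{\mathcal{Y}}K(X_i,X_j)+\frac{1}{n^4}\sum_{i,j,q,r=1}^n\langle Y_q,Y_r\rangle_{\mathcal{Y}}K(X_i,X_j)-\frac{2}{n^3}\sum_{i,j,q=1}^n w_{i,n}(\gamma)\langle Y_i,Y_q\rangle_{\mathcal{Y}}K(X_i,X_j).$$ The normalization $\widehat{\sigma}_\gamma$ is the nonnegative square root of $$\widehat{\sigma}_\gamma^2=4\left(w^2(\gamma)-1\right)\widehat{\alpha}^2,$$ where $$\widehat{\alpha}^2=\frac1n\sum_{i=1}^n\left(\frac1n\sum_{j=1}^n\langle Y_i,Y_j\rangle_{\mathcal{Y}}K(X_i,X_j)-\frac{1}{n^2}\sum_{m=1}^n\sum_{p=1}^n\langle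 Y_m,Y_p\rangle_{\mathcal{Y}}K(X_m,X_p)\right)^2 .$$
   Formalization: Added: K is jointly measurable, and the population counterpart of the normalization, α² = Var⟨Y⊗K(X,·), E[Y⊗K(X,·)]⟩, is positive; without the latter the claim fails (for Y = 0 the ratio is 0/0). *)

theory Defs
  imports "HOL-Probability.Probability"
begin

text \<open>
  A Hilbert space of real functions on \<^typ>\<open>'a\<close>, given by its set \<open>H\<close> of elements and its inner
  product \<open>ip\<close> (of which only the values on \<open>H\<close> matter), with reproducing kernel \<open>K\<close>.
  Symmetry of \<open>K\<close> is a consequence of the reproducing property.
\<close>

locale rkhs =
  fixes H :: "('a \<Rightarrow> real) set"
    and ip :: "('a \<Rightarrow> real) \<Rightarrow> ('a \<Rightarrow> real) \<Rightarrow> real"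
    and K :: "'a \<Rightarrow> 'a \<Rightarrow> real"
  assumes zero_mem: "(\<lambda>_. 0) \<in> H"
    and add_mem: "\<lbrakk>f \<in> H; g \<in> H\<rbrakk> \<Longrightarrow> (\<lambda>x. f x + g x) \<in> H"
    and scale_mem: "f \<in> H \<Longrightarrow> (\<lambda>x. c * f x) \<in> H"
    and ip_commute: "\<lbrakk>f \<in> H; g \<in> H\<rbrakk> \<Longrightarrow> ip f g = ip g f"
    and ip_add_left: "\<lbrakk>f \<in> H; g \<in> H; h \<in> H\<rbrakk> \<Longrightarrow> ip (\<lambda>x. f x + g x) h = ip f h + ip g h"
    and ip_scale_left: "\<lbrakk>f \<in> H; g \<in> H\<rbrakk> \<Longrightarrow> ip (\<lambda>x. c * f x) g = c * ip f g"
    and ip_nonneg: "f \<in> H \<Longrightarrow> 0 \<le> ip f f"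
    and ip_eq_zero: "\<lbrakk>f \<in> H; ip f f = 0\<rbrakk> \<Longrightarrow> f = (\<lambda>_. 0)"
    and complete:
      "\<lbrakk>\<And>n. s n \<in> H;
        \<And>e. 0 < e \<Longrightarrow> \<exists>N. \<forall>m\<ge>N. \<forall>n\<ge>N.
          sqrt (ip (\<lambda>x. s m x - s n x) (\<lambda>x. s m x - s n x)) < e\<rbrakk>
       \<Longrightarrow> \<exists>f\<in>H. (\<lambda>n::nat. sqrt (ip (\<lambda>x. s n x - f x) (\<lambda>x. s n x - f x))) \<longlonglongrightarrow> 0"
    and kernel_mem: "K x \<in> H"
    and reproducing: "f \<in> H \<Longrightarrow> f x = ip (K x) f"

text \<open>
  \<open>g\<close> is a version of the conditional expectation of the Banach-space-valued \<open>f\<close> given the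
  sub-sigma-algebra \<open>F\<close>; \<^const>\<open>real_cond_exp\<close> only covers real-valued \<open>f\<close>.
\<close>

definition is_cond_exp ::
  "'w measure \<Rightarrow> 'w measure \<Rightarrow> ('w \<Rightarrow> 'b::{banach, second_countable_topology}) \<Rightarrow> ('w \<Rightarrow> 'b) \<Rightarrow> bool"
where
  "is_cond_exp M F f g \<longleftrightarrow>
     subalgebra M F \<and> integrable M f \<and> integrable M g \<and> g \<in> borel_measurable F \<and>
     (\<forall>A\<in>sets F. set_lebesgue_integral M A g = set_lebesgue_integral M A f)"

text \<open>
  In the sample quantities, \<open>x\<close>, \<open>y\<close> are the observed values, used at the indices \<open>1, \<dots>, n\<close>;
  \<open>w i\<close> stands for \<open>w\<^bsub>i,n\<^esub>(\<gamma>)\<close> and \<open>w2\<close> for \<open>w\<^sup>2(\<gamma>)\<close>.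
\<close>

definition K_hat ::
  "('a \<Rightarrow> 'a \<Rightarrow> real) \<Rightarrow> (nat \<Rightarrow> real) \<Rightarrow> nat \<Rightarrow> (nat \<Rightarrow> 'a) \<Rightarrow> (nat \<Rightarrow> 'b::real_inner) \<Rightarrow> real"
where
  "K_hat K w n x y =
     1 / real n ^ 2 * (\<Sum>i=1..n. \<Sum>j=1..n. (y i \<bullet> y j) * K (x i) (x j))
   + 1 / real n ^ 4 * (\<Sum>i=1..n. \<Sum>j=1..n. \<Sum>q=1..n. \<Sum>r=1..n. (y q \<bullet> y r) * K (x i) (x j))
   - 2 / real n ^ 3 * (\<Sum>i=1..n. \<Sum>j=1..n. \<Sum>q=1..n. w i * (y i \<bullet> y q) * K (x i) (x j))"

definition alpha_hat_sq ::
  "('a \<Rightarrow> 'a \<Rightarrow> real) \<Rightarrow> nat \<Rightarrow> (nat \<Rightarrow> 'a) \<Rightarrow> (nat \<Rightarrow> 'b::real_inner) \<Rightarrow> real"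
where
  "alpha_hat_sq K n x y =
     1 / real n * (\<Sum>i=1..n.
       (1 / real n * (\<Sum>j=1..n. (y i \<bullet> y j) * K (x i) (x j))
        - 1 / real n ^ 2 * (\<Sum>m=1..n. \<Sum>p=1..n. (y m \<bullet> y p) * K (x m) (x p)))\<^sup>2)"

definition sigma_hat ::
  "('a \<Rightarrow> 'a \<Rightarrow> real) \<Rightarrow> real \<Rightarrow> nat \<Rightarrow> (nat \<Rightarrow> 'a) \<Rightarrow> (nat \<Rightarrow> 'b::real_inner) \<Rightarrow> real"
where
  "sigma_hat K w2 n x y = sqrt (4 * (w2 - 1) * alpha_hat_sq K n x y)"

text \<open>
  The population counterpart of \<^const>\<open>alpha_hat_sq\<close>: the variance of \<open>h (X, Y)\<close> for
  \<open>h (x, y) = E (\<langle>y, Y\<rangle> K (x, X))\<close>, that is, of the inner product of \<open>Y \<otimes> K (X, \<cdot>)\<close> with its mean.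
\<close>

definition alpha_sq ::
  "'w measure \<Rightarrow> ('a \<Rightarrow> 'a \<Rightarrow> real) \<Rightarrow> ('w \<Rightarrow> 'a) \<Rightarrow> ('w \<Rightarrow> 'b::real_inner) \<Rightarrow> real"
where
  "alpha_sq M K X Y =
     (let h = (\<lambda>\<omega>. \<integral>\<omega>'. (Y \<omega> \<bullet> Y \<omega>') * K (X \<omega>) (X \<omega>') \<partial>M)
      in \<integral>\<omega>. (h \<omega> - (\<integral>\<omega>'. h \<omega>' \<partial>M))\<^sup>2 \<partial>M)"

end

theory Submission
  imports Defs
begin

text \<open>
  Write \<open>T\<^sub>i = Y\<^sub>i \<otimes> K (X\<^sub>i, \<cdot>)\<close>, an element of the tensor product of the space of \<open>Y\<close> with the
  reproducing kernel Hilbert space. Let \<open>A\<close> be the mean of the \<open>T\<^sub>i\<close>, \<open>C\<close> their mean with the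
  weights \<open>w\<^sub>i\<close>, \<open>B\<close> the tensor product of the mean of the \<open>Y\<^sub>i\<close> with the mean of the
  \<open>K (X\<^sub>i, \<cdot>)\<close>, and \<open>\<mu> = E Y \<otimes> E K (X, \<cdot>)\<close>. The statistic is \<open>|A|\<^sup>2 + |B|\<^sup>2 - 2 \<langle>C, B\<rangle>\<close>, and around
  \<open>\<mu>\<close> it expands exactly as

    \<open>|A - \<mu>|\<^sup>2 + |B - \<mu>|\<^sup>2 - 2 \<langle>C - \<mu>, B - \<mu>\<rangle> + 2 \<langle>\<mu>, A - C\<rangle>\<close>.

  Under the null hypothesis \<open>E T\<^sub>1 = \<mu>\<close>, so \<open>A\<close>, \<open>B\<close> and \<open>C\<close> all estimate \<open>\<mu>\<close> with mean squared error
  of order \<open>1 / n\<close>. After multiplication by \<open>sqrt n\<close> the three quadratic terms vanish in \<open>L\<^sup>1\<close>, and only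
  \<open>2 \<langle>\<mu>, A - C\<rangle>\<close> is left. It is the weighted sum of the i.i.d. real variables
  \<open>h (X\<^sub>i, Y\<^sub>i) = \<langle>\<mu>, T\<^sub>i\<rangle>\<close> with coefficients \<open>2 (1 - w\<^sub>i) / n\<close> (\<open>K_hat_approximation\<close>). The coefficients sum
  to \<open>O (1 / n)\<close>, so \<open>h\<close> may be centred, and \<open>n\<close> times the sum of their squares tends to
  \<open>4 (w\<^sup>2 - 1)\<close>; a central limit theorem for weighted sums (\<open>weighted_central_limit\<close>) gives the limit
  \<open>N (0, 4 (w\<^sup>2 - 1) Var h)\<close>. The standard deviation of \<open>h\<close> is estimated by
  the empirical standard deviation of the \<open>\<langle>A, T\<^sub>i\<rangle>\<close>; replacing \<open>A\<close> by \<open>\<mu>\<close> costs at most \<open>|A - \<mu>|\<close> times the root mean square of the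
  \<open>|T\<^sub>i|\<close>, and the law of large numbers does the rest (\<open>alpha_hat_consistent\<close>). A Slutsky argument
  (\<open>weak_conv_perturb\<close>) combines the two limits.

  No tensor product is constructed. For a fixed outcome every vector above is a combination of the
  finitely many functions \<open>K (X\<^sub>i, \<cdot>)\<close> and \<open>E K (X, \<cdot>)\<close> with coefficients in the space of \<open>Y\<close>, so that
  inner products are values of a form \<open>\<Sum>\<^sub>i\<^sub>j G\<^sub>i\<^sub>j \<langle>u\<^sub>i, v\<^sub>j\<rangle>\<close> where \<open>G\<close> is a positive semidefinite matrix
  (\<open>gram_form_nonneg\<close>). The index \<open>0\<close> stands for the kernel mean; its row of \<open>G\<close> consists of integrals
  of \<open>K\<close>, and positivity is inherited from sample averages (\<open>ghost_gram_psd\<close>). This avoids any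
  question of separability of the reproducing kernel Hilbert space, in which \<open>K (X, \<cdot>)\<close> need not be
  Bochner integrable. All moment bounds reduce to one formula for the expectation of a centred
  V-statistic (\<open>expectation_centered_V\<close>), applied to the kernels \<open>K (x, x')\<close>, \<open>\<langle>y, y'\<rangle>\<close> and their
  product.
\<close>

section \<open>Bilinear forms of positive semidefinite matrices\<close>

definition psd_on :: "'i set \<Rightarrow> ('i \<Rightarrow> 'i \<Rightarrow> real) \<Rightarrow> bool" where
  "psd_on I G \<longleftrightarrow> (\<forall>i\<in>I. \<forall>j\<in>I. G i j = G j i)
     \<and> (\<forall>c. 0 \<le> (\<Sum>i\<in>I. \<Sum>j\<in>I. c i * c j * G i j))"

text \<open>
  The inner product of \<open>\<Sum>\<^sub>i u\<^sub>i \<otimes> e\<^sub>i\<close> and \<open>\<Sum>\<^sub>j v\<^sub>j \<otimes> e\<^sub>j\<close> when the \<open>e\<^sub>i\<close> have Gram matrix \<open>G\<close>.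
\<close>

definition gram_form ::
  "'i set \<Rightarrow> ('i \<Rightarrow> 'i \<Rightarrow> real) \<Rightarrow> ('i \<Rightarrow> 'b::real_inner) \<Rightarrow> ('i \<Rightarrow> 'b) \<Rightarrow> real" where
  "gram_form I G u v = (\<Sum>i\<in>I. \<Sum>j\<in>I. G i j * (u i \<bullet> v j))"

lemma psd_on_sym: "psd_on I G \<Longrightarrow> i \<in> I \<Longrightarrow> j \<in> I \<Longrightarrow> G i j = G j i"
  unfolding psd_on_def by blast

lemma psd_on_nonneg: "psd_on I G \<Longrightarrow> 0 \<le> (\<Sum>i\<in>I. \<Sum>j\<in>I. c i * c j * G i j)"
  unfolding psd_on_def by blast

lemma double_sum_insert:
  fixes f :: "'i \<Rightarrow> 'i \<Rightarrow> real"
  assumes "finite J" "a \<notin> J"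
  shows "(\<Sum>i\<in>insert a J. \<Sum>j\<in>insert a J. f i j)
    = f a a + (\<Sum>j\<in>J. f a j) + (\<Sum>i\<in>J. f i a) + (\<Sum>i\<in>J. \<Sum>j\<in>J. f i j)"
  using assms by (simp add: sum.distrib)

lemma psd_on_subset:
  assumes "psd_on I G" "J \<subseteq> I" "finite I"
  shows "psd_on J G"
  unfolding psd_on_def
proof (intro conjI allI)
  show "\<forall>i\<in>J. \<forall>j\<in>J. G i j = G j i"
    using assms unfolding psd_on_def by blast
  fix c :: "'a \<Rightarrow> real"
  let ?c = "\<lambda>i. if i \<in> J then c i else 0"
  have "(\<Sum>i\<in>I. \<Sum>j\<in>I. ?c i * ?c j * G i j) = (\<Sum>i\<in>J. \<Sum>j\<in>I. ?c i * ?c j * G i j)"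
    using assms by (intro sum.mono_neutral_right) auto
  also have "\<dots> = (\<Sum>i\<in>J. \<Sum>j\<in>J. ?c i * ?c j * G i j)"
    using assms by (intro sum.cong sum.mono_neutral_right) auto
  also have "\<dots> = (\<Sum>i\<in>J. \<Sum>j\<in>J. c i * c j * G i j)"
    by simp
  finally show "0 \<le> (\<Sum>i\<in>J. \<Sum>j\<in>J. c i * c j * G i j)"
    using psd_on_nonneg[OF assms(1), of ?c] by simp
qed

lemma psd_on_diag_nonneg:
  assumes "psd_on I G" "finite I" "a \<in> I"
  shows "0 \<le> G a a"
proof -
  have "psd_on {a} G"
    using assms by (intro psd_on_subset[OF assms(1)]) auto
  then have "0 \<le> (\<Sum>i\<in>{a}. \<Sum>j\<in>{a}. (\<lambda>_. 1) i * (\<lambda>_. 1) j * G i j)"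
    by (rule psd_on_nonneg)
  then show ?thesis by simp
qed

lemma psd_on_pair:
  assumes "psd_on I G" "finite I" "a \<in> I" "b \<in> I" "a \<noteq> b"
  shows "0 \<le> s\<^sup>2 * G a a + 2 * s * t * G a b + t\<^sup>2 * G b b"
proof -
  have p: "psd_on {a, b} G"
    using assms by (intro psd_on_subset[OF assms(1)]) auto
  let ?c = "\<lambda>i. if i = a then s else t"
  have "0 \<le> (\<Sum>i\<in>{a, b}. \<Sum>j\<in>{a, b}. ?c i * ?c j * G i j)"
    using p by (rule psd_on_nonneg)
  moreover have "G b a = G a b"
    using p by (rule psd_on_sym) auto
  ultimately show ?thesis
    using assms(5) by (simp add: power2_eq_square algebra_simps)
qed

text \<open>
  Otherwise the quadratic form of the indices \<open>a\<close> and \<open>b\<close> would be affine and nonconstant in the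
  coefficient of \<open>a\<close>, hence negative somewhere.
\<close>

lemma psd_on_zero_row:
  assumes "psd_on I G" "finite I" "a \<in> I" "b \<in> I" "G a a = 0"
  shows "G a b = 0"
proof (cases "a = b")
  case False
  have *: "0 \<le> 2 * s * G a b + G b b" for s
    using psd_on_pair[OF assms(1-4) False, of s 1] assms(5) by simp
  show ?thesis
  proof (rule ccontr)
    assume "G a b \<noteq> 0"
    then show False
      using *[of "- (G b b + 1) / (2 * G a b)"] by (simp add: field_simps)
  qed
qed (use assms in simp)

text \<open>
  The Schur complement is the Gram matrix of the projections orthogonal to the vector of index \<open>a\<close>.
  Its quadratic form is the minimum of that of \<open>G\<close> over the coefficient at \<open>a\<close>.
\<close>

lemma psd_on_schur_complement:
  assumes "psd_on (insert a J) G" "finite J" "a \<notin> J" "0 < G a a"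
  shows "psd_on J (\<lambda>i j. G i j - G a i * G a j / G a a)"
  unfolding psd_on_def
proof (intro conjI allI)
  have sym: "G i j = G j i" if "i \<in> insert a J" "j \<in> insert a J" for i j
    using assms(1) that by (rule psd_on_sym)
  show "\<forall>i\<in>J. \<forall>j\<in>J. G i j - G a i * G a j / G a a = G j i - G a j * G a i / G a a"
    using sym by (simp add: mult.commute)
  fix c
  define r where "r = (\<Sum>j\<in>J. c j * G a j)"
  \<comment> \<open>the minimising coefficient at a\<close>
  define d where "d = c(a := - r / G a a)"
  have d: "d i = c i" if "i \<in> J" for i
    using that assms(3) unfolding d_def by auto
  have "0 \<le> (\<Sum>i\<in>insert a J. \<Sum>j\<in>insert a J. d i * d j * G i j)"
    using assms(1) by (rule psd_on_nonneg)
  also have "\<dots> = d a * d a * G a a + (\<Sum>j\<in>J. d a * d j * G a j)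
      + (\<Sum>i\<in>J. d i * d a * G i a) + (\<Sum>i\<in>J. \<Sum>j\<in>J. d i * d j * G i j)"
    by (rule double_sum_insert[OF assms(2,3)])
  also have "(\<Sum>j\<in>J. d a * d j * G a j) = d a * r"
    unfolding r_def sum_distrib_left by (rule sum.cong) (simp_all add: d mult_ac flip: r_def)
  also have "(\<Sum>i\<in>J. d i * d a * G i a) = d a * r"
    unfolding r_def sum_distrib_left
    by (rule sum.cong) (simp_all add: d sym mult_ac flip: r_def)
  also have "(\<Sum>i\<in>J. \<Sum>j\<in>J. d i * d j * G i j) = (\<Sum>i\<in>J. \<Sum>j\<in>J. c i * c j * G i j)"
    by (intro sum.cong) (simp_all add: d)
  also have "d a = - r / G a a"
    by (simp add: d_def)
  also have "- r / G a a * (- r / G a a) * G a a + - r / G a a * r + - r / G a a * r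
      + (\<Sum>i\<in>J. \<Sum>j\<in>J. c i * c j * G i j)
      = (\<Sum>i\<in>J. \<Sum>j\<in>J. c i * c j * G i j) - r * r / G a a"
    using assms(4) by (simp add: field_simps)
  also have "r * r / G a a = (\<Sum>i\<in>J. \<Sum>j\<in>J. c i * c j * (G a i * G a j / G a a))"
    unfolding r_def sum_product sum_divide_distrib by (simp add: mult_ac)
  finally show "0 \<le> (\<Sum>i\<in>J. \<Sum>j\<in>J. c i * c j * (G i j - G a i * G a j / G a a))"
    by (simp add: right_diff_distrib sum_subtractf)
qed

text \<open>
  Vector coefficients are reduced to scalar ones by elimination: completing the square in the
  coefficient \<open>u a\<close> splits off \<open>G a a\<close> times a squared norm and leaves the form of the Schur complement
  on the remaining indices.
\<close>

lemma gram_form_nonneg: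
  fixes u :: "'i \<Rightarrow> 'b::real_inner"
  assumes "finite I" "psd_on I G"
  shows "0 \<le> gram_form I G u u"
  using assms
proof (induction I arbitrary: G rule: finite_induct)
  case empty
  then show ?case by (simp add: gram_form_def)
next
  case (insert a J)
  have sym: "G i j = G j i" if "i \<in> insert a J" "j \<in> insert a J" for i j
    using insert.prems that by (rule psd_on_sym)
  have split: "gram_form (insert a J) G u u = G a a * (u a \<bullet> u a)
      + 2 * (\<Sum>j\<in>J. G a j * (u a \<bullet> u j)) + gram_form J G u u"
  proof -
    have "(\<Sum>i\<in>J. G i a * (u i \<bullet> u a)) = (\<Sum>j\<in>J. G a j * (u a \<bullet> u j))"
      by (intro sum.cong) (auto simp: sym inner_commute)
    then show ?thesis
      unfolding gram_form_def by (subst double_sum_insert) (use insert in auto)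
  qed
  show ?case
  proof (cases "G a a = 0")
    case True
    then have "(\<Sum>j\<in>J. G a j * (u a \<bullet> u j)) = 0"
      by (intro sum.neutral ballI) (use psd_on_zero_row[OF insert.prems] insert.hyps in auto)
    moreover have "0 \<le> gram_form J G u u"
      by (rule insert.IH[OF psd_on_subset[OF insert.prems]]) (use insert.hyps in auto)
    ultimately show ?thesis
      using True split by simp
  next
    case False
    then have pos: "0 < G a a"
      using psd_on_diag_nonneg[OF insert.prems] insert.hyps by fastforce
    define s where "s = (\<Sum>j\<in>J. G a j *\<^sub>R u j)"
    define G' where "G' i j = G i j - G a i * G a j / G a a" for i j
    have "0 \<le> gram_form J G' u u"
      unfolding G'_def
      by (rule insert.IH[OF psd_on_schur_complement]) (use insert pos in auto)
    moreover have "gram_form J G' u u = gram_form J G u u - (s \<bullet> s) / G a a"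
      unfolding s_def gram_form_def G'_def inner_sum_left inner_sum_right sum_divide_distrib
      by (simp add: left_diff_distrib sum_subtractf)
        (simp add: mult_ac inner_commute)
    moreover have "(\<Sum>j\<in>J. G a j * (u a \<bullet> u j)) = u a \<bullet> s"
      by (simp add: s_def inner_sum_right)
    moreover have "0 \<le> G a a * ((u a + s /\<^sub>R G a a) \<bullet> (u a + s /\<^sub>R G a a))"
      using pos by simp
    moreover have "G a a * ((u a + s /\<^sub>R G a a) \<bullet> (u a + s /\<^sub>R G a a))
        = G a a * (u a \<bullet> u a) + 2 * (u a \<bullet> s) + (s \<bullet> s) / G a a"
      using pos by (simp add: inner_add_left inner_add_right inner_commute field_simps)
    ultimately show ?thesis
      using split by linarith
  qed
qed

lemma gram_form_commute:
  assumes "psd_on I G"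
  shows "gram_form I G u v = gram_form I G v u"
proof -
  have "gram_form I G u v = (\<Sum>j\<in>I. \<Sum>i\<in>I. G i j * (u i \<bullet> v j))"
    unfolding gram_form_def by (rule sum.swap)
  also have "\<dots> = gram_form I G v u"
    unfolding gram_form_def
    using assms unfolding psd_on_def by (intro sum.cong) (auto simp: inner_commute)
  finally show ?thesis .
qed

lemma gram_form_add_left: "gram_form I G (\<lambda>i. u i + v i) z = gram_form I G u z + gram_form I G v z"
  and gram_form_diff_left: "gram_form I G (\<lambda>i. u i - v i) z = gram_form I G u z - gram_form I G v z"
  and gram_form_add_right: "gram_form I G z (\<lambda>i. u i + v i) = gram_form I G z u + gram_form I G z v"
  and gram_form_diff_right: "gram_form I G z (\<lambda>i. u i - v i) = gram_form I G z u - gram_form I G z v"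
  and gram_form_scale_left: "gram_form I G (\<lambda>i. c *\<^sub>R u i) z = c * gram_form I G u z"
  and gram_form_scale_right: "gram_form I G z (\<lambda>i. c *\<^sub>R u i) = c * gram_form I G z u"
  by (simp_all add: gram_form_def inner_add_left inner_add_right inner_diff_left inner_diff_right
      distrib_left right_diff_distrib sum.distrib sum_subtractf sum_distrib_left mult_ac)

lemmas gram_form_bilinear = gram_form_add_left gram_form_diff_left gram_form_add_right
  gram_form_diff_right gram_form_scale_left gram_form_scale_right

text \<open>
  The usual discriminant argument; the form may be degenerate, so the case in which the second vector
  has length zero is separate.
\<close>

lemma gram_form_cauchy_schwarz:
  fixes u :: "'i \<Rightarrow> 'b::real_inner"
  assumes "finite I" "psd_on I G"
  shows "(gram_form I G u v)\<^sup>2 \<le> gram_form I G u u * gram_form I G v v"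
proof -
  define a b c where "a = gram_form I G u u" and "b = gram_form I G u v" and "c = gram_form I G v v"
  have *: "0 \<le> s\<^sup>2 * a - 2 * s * t * b + t\<^sup>2 * c" for s t
  proof -
    have "0 \<le> gram_form I G (\<lambda>i. s *\<^sub>R u i - t *\<^sub>R v i) (\<lambda>i. s *\<^sub>R u i - t *\<^sub>R v i)"
      by (rule gram_form_nonneg[OF assms])
    also have "\<dots> = s\<^sup>2 * a - 2 * s * t * b + t\<^sup>2 * c"
      using gram_form_commute[OF assms(2), of v u]
      by (simp add: gram_form_bilinear a_def b_def c_def algebra_simps power2_eq_square)
    finally show ?thesis .
  qed
  have "0 \<le> a" "0 \<le> c"
    unfolding a_def c_def by (auto intro: gram_form_nonneg[OF assms])
  show ?thesis
    unfolding a_def[symmetric] b_def[symmetric] c_def[symmetric]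
  proof (cases "c = 0")
    case True
    show "b\<^sup>2 \<le> a * c"
    proof (cases "b = 0")
      case False
      then show ?thesis
        \<comment> \<open>the form would be linear in t and take the value -1 here\<close>
        using *[of 1 "(a + 1) / (2 * b)"] True by simp
    qed (use True in simp)
  next
    case False
    then have "0 < c" using \<open>0 \<le> c\<close> by simp
    have "0 \<le> c\<^sup>2 * a - 2 * c * b * b + b\<^sup>2 * c"
      by (rule *)
    also have "\<dots> = c * (a * c - b\<^sup>2)"
      by (simp add: algebra_simps power2_eq_square)
    finally show "b\<^sup>2 \<le> a * c"
      using \<open>0 < c\<close> by (simp add: zero_le_mult_iff)
  qed
qed

lemma gram_form_add_square_le:
  fixes u :: "'i \<Rightarrow> 'b::real_inner"
  assumes "finite I" "psd_on I G"
  shows "gram_form I G (\<lambda>i. u i + v i) (\<lambda>i. u i + v i) \<le> 2 * gram_form I G u u + 2 * gram_form I G v v"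
proof -
  have "0 \<le> gram_form I G (\<lambda>i. u i - v i) (\<lambda>i. u i - v i)"
    by (rule gram_form_nonneg[OF assms])
  then show ?thesis
    by (simp add: gram_form_bilinear)
qed

lemma gram_form_abs_le:
  fixes u :: "'i \<Rightarrow> 'b::real_inner"
  assumes "finite I" "psd_on I G"
  shows "2 * \<bar>gram_form I G u v\<bar> \<le> gram_form I G u u + gram_form I G v v"
proof -
  have "0 \<le> gram_form I G (\<lambda>i. u i - v i) (\<lambda>i. u i - v i)"
    "0 \<le> gram_form I G (\<lambda>i. u i + v i) (\<lambda>i. u i + v i)"
    by (rule gram_form_nonneg[OF assms])+
  then show ?thesis
    using gram_form_commute[OF assms(2), of v u] by (simp add: gram_form_bilinear abs_le_iff)
qed

section \<open>Convergence in probability and perturbation of weak limits\<close>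

lemma cmod_iexp_diff_le: "cmod (iexp a - iexp b) \<le> \<bar>a - b\<bar>"
proof -
  have "iexp a - iexp b = iexp b * (iexp (a - b) - 1)"
    by (simp add: algebra_simps flip: exp_add)
  then have "cmod (iexp a - iexp b) = cmod (iexp (a - b) - 1)"
    by (simp add: norm_mult)
  also have "\<dots> \<le> \<bar>a - b\<bar>"
    using iexp_approx1[of "a - b" 0] by simp
  finally show ?thesis .
qed

context prob_space
begin

definition tendsto_prob :: "(nat \<Rightarrow> 'a \<Rightarrow> real) \<Rightarrow> real \<Rightarrow> bool" where
  "tendsto_prob X c \<longleftrightarrow> (\<forall>n. random_variable borel (X n))
     \<and> (\<forall>e>0. (\<lambda>n. prob {\<omega> \<in> space M. e < \<bar>X n \<omega> - c\<bar>}) \<longlonglongrightarrow> 0)"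

lemma tendsto_prob_measurable: "tendsto_prob X c \<Longrightarrow> random_variable borel (X n)"
  unfolding tendsto_prob_def by blast

lemma tendsto_probD:
  "tendsto_prob X c \<Longrightarrow> 0 < e \<Longrightarrow> (\<lambda>n. prob {\<omega> \<in> space M. e < \<bar>X n \<omega> - c\<bar>}) \<longlonglongrightarrow> 0"
  unfolding tendsto_prob_def by blast

lemma prob_gt_le_expectation:
  assumes [measurable]: "random_variable borel Q"
    and "integrable M R" "0 < e" "\<And>\<omega>. \<omega> \<in> space M \<Longrightarrow> \<bar>Q \<omega>\<bar> \<le> R \<omega>"
  shows "prob {\<omega> \<in> space M. e < \<bar>Q \<omega>\<bar>} \<le> expectation R / e"
proof -
  have [measurable]: "random_variable borel R"
    using assms(2) by simp
  have "prob {\<omega> \<in> space M. e < \<bar>Q \<omega>\<bar>} \<le> prob {\<omega> \<in> space M. e \<le> R \<omega>}"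
    using assms(4) by (intro finite_measure_mono) force+
  also have "\<dots> \<le> expectation R / e"
    using assms(2-4) by (intro integral_Markov_inequality_measure[where A = "{}"] AE_I2) force+
  finally show ?thesis .
qed

text \<open>
  Markov's inequality. The domination by \<open>Q\<close> is required for positive \<open>n\<close> only, because the sample
  statistics are meaningless for the empty sample.
\<close>

lemma tendsto_prob_of_expectation:
  assumes [measurable]: "\<And>n. random_variable borel (X n)"
    and Q: "\<And>n. 0 < n \<Longrightarrow> integrable M (Q n)"
    and le: "\<And>n \<omega>. 0 < n \<Longrightarrow> \<omega> \<in> space M \<Longrightarrow> \<bar>X n \<omega> - c\<bar> \<le> Q n \<omega>"
    and bound: "\<And>n. 0 < n \<Longrightarrow> expectation (Q n) \<le> r n" and lim: "r \<longlonglongrightarrow> 0"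
  shows "tendsto_prob X c"
  unfolding tendsto_prob_def
proof (intro conjI allI impI assms(1))
  fix e :: real assume "0 < e"
  show "(\<lambda>n. prob {\<omega> \<in> space M. e < \<bar>X n \<omega> - c\<bar>}) \<longlonglongrightarrow> 0"
  proof (rule tendsto_sandwich[OF _ _ tendsto_const])
    show "\<forall>\<^sub>F n in sequentially. prob {\<omega> \<in> space M. e < \<bar>X n \<omega> - c\<bar>} \<le> r n / e"
      using eventually_gt_at_top[of 0]
    proof eventually_elim
      case (elim n)
      have "prob {\<omega> \<in> space M. e < \<bar>X n \<omega> - c\<bar>} \<le> expectation (Q n) / e"
        using \<open>0 < e\<close> Q le elim by (intro prob_gt_le_expectation) auto
      also have "\<dots> \<le> r n / e"
        using bound[OF elim] \<open>0 < e\<close> by (intro divide_right_mono) auto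
      finally show ?case .
    qed
    show "(\<lambda>n. r n / e) \<longlonglongrightarrow> 0"
      using tendsto_divide[OF lim tendsto_const, of e] \<open>0 < e\<close> by simp
  qed auto
qed

lemma tendsto_prob_squeeze:
  assumes [measurable]: "\<And>n. random_variable borel (X n)"
    and Y: "tendsto_prob Y 0"
    and le: "\<And>n \<omega>. 0 < n \<Longrightarrow> \<omega> \<in> space M \<Longrightarrow> \<bar>X n \<omega> - c\<bar> \<le> \<bar>Y n \<omega>\<bar>"
  shows "tendsto_prob X c"
  unfolding tendsto_prob_def
proof (intro conjI allI impI assms(1))
  fix e :: real assume "0 < e"
  note [measurable] = tendsto_prob_measurable[OF Y]
  show "(\<lambda>n. prob {\<omega> \<in> space M. e < \<bar>X n \<omega> - c\<bar>}) \<longlonglongrightarrow> 0"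
  proof (rule tendsto_sandwich[OF _ _ tendsto_const])
    show "\<forall>\<^sub>F n in sequentially. prob {\<omega> \<in> space M. e < \<bar>X n \<omega> - c\<bar>}
        \<le> prob {\<omega> \<in> space M. e < \<bar>Y n \<omega> - 0\<bar>}"
      using eventually_gt_at_top[of 0]
    proof eventually_elim
      case (elim n)
      have "{\<omega> \<in> space M. e < \<bar>X n \<omega> - c\<bar>} \<subseteq> {\<omega> \<in> space M. e < \<bar>Y n \<omega> - 0\<bar>}"
        using le[OF elim] by fastforce
      then show ?case
        by (rule finite_measure_mono) measurable
    qed
    show "(\<lambda>n. prob {\<omega> \<in> space M. e < \<bar>Y n \<omega> - 0\<bar>}) \<longlonglongrightarrow> 0"
      by (rule tendsto_probD[OF Y \<open>0 < e\<close>])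
  qed auto
qed

lemma tendsto_prob_continuous2:
  fixes g :: "real \<times> real \<Rightarrow> real"
  assumes X: "tendsto_prob X a" and Y: "tendsto_prob Y b"
    and cont: "isCont g (a, b)"
    and [measurable]: "g \<in> borel_measurable borel"
  shows "tendsto_prob (\<lambda>n \<omega>. g (X n \<omega>, Y n \<omega>)) (g (a, b))"
  unfolding tendsto_prob_def
proof (intro conjI allI impI)
  note [measurable] = tendsto_prob_measurable[OF X] tendsto_prob_measurable[OF Y]
  show "random_variable borel (\<lambda>\<omega>. g (X n \<omega>, Y n \<omega>))" for n
    by measurable
  fix e :: real assume "0 < e"
  then obtain d where d: "0 < d" "\<And>p. dist p (a, b) < d \<Longrightarrow> dist (g p) (g (a, b)) < e"
    using cont unfolding continuous_at_eps_delta by blast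
  define d' where "d' = d / 3"
  have d': "0 < d'" using d(1) by (simp add: d'_def)
  have sub: "d' < \<bar>x - a\<bar> \<or> d' < \<bar>y - b\<bar>" if "e < \<bar>g (x, y) - g (a, b)\<bar>" for x y
  proof (rule ccontr)
    assume "\<not> ?thesis"
    then have "dist x a + dist y b < d"
      using d(1) unfolding d'_def dist_real_def by linarith
    moreover have "dist (x, y) (a, b) \<le> dist x a + dist y b"
      unfolding dist_Pair_Pair by (rule sqrt_sum_squares_le_sum) auto
    ultimately have "dist (g (x, y)) (g (a, b)) < e"
      by (intro d(2)) simp
    then show False
      using that by (simp add: dist_real_def)
  qed
  let ?A = "\<lambda>n. {\<omega> \<in> space M. d' < \<bar>X n \<omega> - a\<bar>}" and ?B = "\<lambda>n. {\<omega> \<in> space M. d' < \<bar>Y n \<omega> - b\<bar>}"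
  show "(\<lambda>n. prob {\<omega> \<in> space M. e < \<bar>g (X n \<omega>, Y n \<omega>) - g (a, b)\<bar>}) \<longlonglongrightarrow> 0"
  proof (rule tendsto_sandwich[OF _ _ tendsto_const])
    show "\<forall>\<^sub>F n in sequentially. prob {\<omega> \<in> space M. e < \<bar>g (X n \<omega>, Y n \<omega>) - g (a, b)\<bar>}
        \<le> prob (?A n) + prob (?B n)"
    proof (rule always_eventually, rule allI)
      fix n
      have "prob {\<omega> \<in> space M. e < \<bar>g (X n \<omega>, Y n \<omega>) - g (a, b)\<bar>} \<le> prob (?A n \<union> ?B n)"
        by (intro finite_measure_mono) (use sub in \<open>force, measurable\<close>)
      also have "\<dots> \<le> prob (?A n) + prob (?B n)"
        by (intro measure_subadditive) auto
      finally show "prob {\<omega> \<in> space M. e < \<bar>g (X n \<omega>, Y n \<omega>) - g (a, b)\<bar>}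
        \<le> prob (?A n) + prob (?B n)" .
    qed
    show "(\<lambda>n. prob (?A n) + prob (?B n)) \<longlonglongrightarrow> 0"
      using tendsto_add[OF tendsto_probD[OF X d'] tendsto_probD[OF Y d']] by simp
  qed auto
qed

lemma tendsto_prob_add:
  assumes "tendsto_prob X a" "tendsto_prob Y b"
  shows "tendsto_prob (\<lambda>n \<omega>. X n \<omega> + Y n \<omega>) (a + b)"
proof -
  have "continuous_on UNIV (\<lambda>p::real \<times> real. fst p + snd p)"
    by (intro continuous_intros)
  then show ?thesis
    using tendsto_prob_continuous2[OF assms, of "\<lambda>p. fst p + snd p"]
      borel_measurable_continuous_onI[of "\<lambda>p::real \<times> real. fst p + snd p"]
    by (simp add: continuous_on_eq_continuous_at)
qed

lemma tendsto_prob_diff: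
  assumes "tendsto_prob X a" "tendsto_prob Y b"
  shows "tendsto_prob (\<lambda>n \<omega>. X n \<omega> - Y n \<omega>) (a - b)"
proof -
  have "continuous_on UNIV (\<lambda>p::real \<times> real. fst p - snd p)"
    by (intro continuous_intros)
  then show ?thesis
    using tendsto_prob_continuous2[OF assms, of "\<lambda>p. fst p - snd p"]
      borel_measurable_continuous_onI[of "\<lambda>p::real \<times> real. fst p - snd p"]
    by (simp add: continuous_on_eq_continuous_at)
qed

lemma tendsto_prob_continuous:
  fixes g :: "real \<Rightarrow> real"
  assumes X: "tendsto_prob X a" and cont: "isCont g a" and [measurable]: "g \<in> borel_measurable borel"
  shows "tendsto_prob (\<lambda>n \<omega>. g (X n \<omega>)) (g a)"
proof -
  have "isCont (\<lambda>p. g (fst p)) (a, a)"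
    using cont isCont_o2[of "(a, a)" fst g] isCont_fst[OF continuous_ident] by simp
  moreover have "(\<lambda>p::real \<times> real. g (fst p)) \<in> borel_measurable borel"
    unfolding borel_prod[symmetric] by measurable
  ultimately show ?thesis
    using tendsto_prob_continuous2[OF X X, of "\<lambda>p. g (fst p)"] by simp
qed

text \<open>
  A bound on the expectations makes \<open>B\<close> tight: outside an event of small probability the product is
  at most a constant multiple of \<open>X\<close>.
\<close>

lemma tendsto_prob_mult_bounded:
  assumes X: "tendsto_prob X 0"
    and [measurable]: "\<And>n. random_variable borel (B n)"
    and Q: "\<And>n. 0 < n \<Longrightarrow> integrable M (Q n)"
    and le: "\<And>n \<omega>. 0 < n \<Longrightarrow> \<omega> \<in> space M \<Longrightarrow> \<bar>B n \<omega>\<bar> \<le> Q n \<omega>"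
    and bound: "\<And>n. 0 < n \<Longrightarrow> expectation (Q n) \<le> C"
  shows "tendsto_prob (\<lambda>n \<omega>. X n \<omega> * B n \<omega>) 0"
  unfolding tendsto_prob_def
proof (intro conjI allI impI)
  note [measurable] = tendsto_prob_measurable[OF X]
  show "random_variable borel (\<lambda>\<omega>. X n \<omega> * B n \<omega>)" for n
    by measurable
  fix e :: real assume e: "0 < e"
  have C: "0 \<le> C"
  proof -
    have "0 \<le> expectation (Q 1)"
      using order_trans[OF abs_ge_zero le[of 1]] by (intro integral_nonneg_AE AE_I2) simp
    then show ?thesis using bound[of 1] by simp
  qed
  show "(\<lambda>n. prob {\<omega> \<in> space M. e < \<bar>X n \<omega> * B n \<omega> - 0\<bar>}) \<longlonglongrightarrow> 0"
  proof (rule LIMSEQ_I)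
    fix r :: real assume r: "0 < r"
    \<comment> \<open>by Markov, the absolute value of B exceeds m with probability less than r / 2\<close>
    define m where "m = 2 * (C + 1) / r"
    have m: "0 < m" using C r by (simp add: m_def)
    have "(\<lambda>n. prob {\<omega> \<in> space M. e / m < \<bar>X n \<omega> - 0\<bar>}) \<longlonglongrightarrow> 0"
      by (rule tendsto_probD[OF X]) (use e m in simp)
    then have "\<forall>\<^sub>F n in sequentially. prob {\<omega> \<in> space M. e / m < \<bar>X n \<omega> - 0\<bar>} < r / 2"
      using r by (intro order_tendstoD(2)[where y = 0]) auto
    then have "\<forall>\<^sub>F n in sequentially. 0 < n \<and> prob {\<omega> \<in> space M. e / m < \<bar>X n \<omega> - 0\<bar>} < r / 2"
      using eventually_gt_at_top[of 0] by eventually_elim simp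
    then obtain N where N: "\<And>n. N \<le> n \<Longrightarrow> 0 < n" 
        "\<And>n. N \<le> n \<Longrightarrow> prob {\<omega> \<in> space M. e / m < \<bar>X n \<omega> - 0\<bar>} < r / 2"
      unfolding eventually_sequentially by blast
    show "\<exists>N. \<forall>n\<ge>N. norm (prob {\<omega> \<in> space M. e < \<bar>X n \<omega> * B n \<omega> - 0\<bar>} - 0) < r"
    proof (intro exI allI impI)
      fix n assume n: "N \<le> n"
      let ?A = "{\<omega> \<in> space M. e / m < \<bar>X n \<omega> - 0\<bar>}" and ?B = "{\<omega> \<in> space M. m < \<bar>B n \<omega>\<bar>}"
      have "e / m < \<bar>x\<bar> \<or> m < \<bar>b\<bar>" if "e < \<bar>x * b\<bar>" for x b :: real
      proof (rule ccontr)
        assume "\<not> ?thesis"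
        then have "\<bar>x\<bar> * \<bar>b\<bar> \<le> (e / m) * m"
          using e m by (intro mult_mono) auto
        then show False using that m by (simp add: abs_mult)
      qed
      then have "prob {\<omega> \<in> space M. e < \<bar>X n \<omega> * B n \<omega> - 0\<bar>} \<le> prob (?A \<union> ?B)"
        by (intro finite_measure_mono) auto
      also have "\<dots> \<le> prob ?A + prob ?B"
        by (intro measure_subadditive) auto
      also have "prob ?B \<le> expectation (Q n) / m"
        using N(1)[OF n] Q le m by (intro prob_gt_le_expectation) auto
      also have "\<dots> \<le> C / m"
        using bound[OF N(1)[OF n]] m by (simp add: divide_right_mono)
      also have "\<dots> < r / 2"
        using C r by (simp add: m_def field_simps)
      finally show "norm (prob {\<omega> \<in> space M. e < \<bar>X n \<omega> * B n \<omega> - 0\<bar>} - 0) < r"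
        using N(2)[OF n] by simp
    qed
  qed
qed

lemma char_diff_le:
  assumes [measurable]: "random_variable borel A" "random_variable borel B" and "0 < e"
  shows "cmod (char (distr M borel A) t - char (distr M borel B) t)
    \<le> \<bar>t\<bar> * e + 2 * prob {\<omega> \<in> space M. e < \<bar>A \<omega> - B \<omega>\<bar>}"
proof -
  let ?S = "{\<omega> \<in> space M. e < \<bar>A \<omega> - B \<omega>\<bar>}"
  have [measurable]: "?S \<in> events" by measurable
  have iA: "integrable M (\<lambda>\<omega>. iexp (t * A \<omega>))" "integrable M (\<lambda>\<omega>. iexp (t * B \<omega>))"
    by (rule integrable_iexp, auto)+
  have "char (distr M borel A) t - char (distr M borel B) t
      = (CLINT \<omega>|M. iexp (t * A \<omega>) - iexp (t * B \<omega>))"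
    using iA by (simp add: char_def integral_distr)
  also have "cmod \<dots> \<le> expectation (\<lambda>\<omega>. cmod (iexp (t * A \<omega>) - iexp (t * B \<omega>)))"
    by (rule integral_norm_bound)
  also have "\<dots> \<le> expectation (\<lambda>\<omega>. \<bar>t\<bar> * e + 2 * indicator ?S \<omega>)"
  proof (rule integral_mono)
    show "integrable M (\<lambda>\<omega>. cmod (iexp (t * A \<omega>) - iexp (t * B \<omega>)))"
      using iA by (intro integrable_norm Bochner_Integration.integrable_diff)
    show "integrable M (\<lambda>\<omega>. \<bar>t\<bar> * e + 2 * indicator ?S \<omega>)"
      by (intro Bochner_Integration.integrable_add integrable_mult_right)
        (auto simp: integrable_indicator_iff less_top[symmetric])
    fix \<omega> assume \<omega>: "\<omega> \<in> space M"
    show "cmod (iexp (t * A \<omega>) - iexp (t * B \<omega>)) \<le> \<bar>t\<bar> * e + 2 * indicator ?S \<omega>"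
    proof (cases "\<omega> \<in> ?S")
      case True
      have "cmod (iexp (t * A \<omega>) - iexp (t * B \<omega>)) \<le> cmod (iexp (t * A \<omega>)) + cmod (iexp (t * B \<omega>))"
        by (rule norm_triangle_ineq4)
      also have "\<dots> = 2" by simp
      finally show ?thesis
        using True \<open>0 < e\<close> by (simp add: add_increasing)
    next
      case False
      have "cmod (iexp (t * A \<omega>) - iexp (t * B \<omega>)) \<le> \<bar>t * A \<omega> - t * B \<omega>\<bar>"
        by (rule cmod_iexp_diff_le)
      also have "\<dots> = \<bar>t\<bar> * \<bar>A \<omega> - B \<omega>\<bar>"
        by (simp add: abs_mult flip: right_diff_distrib)
      also have "\<dots> \<le> \<bar>t\<bar> * e"
        using False \<omega> by (intro mult_left_mono) auto
      finally show ?thesis using False by simp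
    qed
  qed
  also have "\<dots> = \<bar>t\<bar> * e + 2 * prob ?S"
    by (subst Bochner_Integration.integral_add)
      (auto simp: prob_space integrable_indicator_iff less_top[symmetric] intro!: integrable_mult_right)
  finally show ?thesis .
qed

text \<open>
  Slutsky's theorem in the form used here: characteristic functions of variables that are close in
  probability are close, since \<open>iexp\<close> is bounded and Lipschitz.
\<close>

lemma weak_conv_perturb:
  assumes conv: "\<And>t. (\<lambda>n. char (distr M borel (A n)) t) \<longlonglongrightarrow> char \<mu> t"
    and \<mu>: "real_distribution \<mu>"
    and [measurable]: "\<And>n. random_variable borel (A n)" "\<And>n. random_variable borel (B n)"
    and diff: "tendsto_prob (\<lambda>n \<omega>. B n \<omega> - A n \<omega>) 0"
  shows "weak_conv_m (\<lambda>n. distr M borel (B n)) \<mu>"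
proof (rule levy_continuity)
  fix t
  have "(\<lambda>n. char (distr M borel (B n)) t - char (distr M borel (A n)) t) \<longlonglongrightarrow> 0"
  proof (rule LIMSEQ_I)
    fix r :: real assume r: "0 < r"
    define e where "e = r / (2 * (\<bar>t\<bar> + 1))"
    have e: "0 < e" "\<bar>t\<bar> * e \<le> r / 2"
      using r by (simp_all add: e_def field_simps add_pos_nonneg)
    have "(\<lambda>n. prob {\<omega> \<in> space M. e < \<bar>B n \<omega> - A n \<omega>\<bar>}) \<longlonglongrightarrow> 0"
      using tendsto_probD[OF diff e(1)] by simp
    then have "\<forall>\<^sub>F n in sequentially. prob {\<omega> \<in> space M. e < \<bar>B n \<omega> - A n \<omega>\<bar>} < r / 4"
      using r by (intro order_tendstoD(2)[where y = 0]) auto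
    then obtain N where N: "\<And>n. N \<le> n \<Longrightarrow> prob {\<omega> \<in> space M. e < \<bar>B n \<omega> - A n \<omega>\<bar>} < r / 4"
      unfolding eventually_sequentially by blast
    show "\<exists>N. \<forall>n\<ge>N. norm (char (distr M borel (B n)) t - char (distr M borel (A n)) t - 0) < r"
    proof (intro exI allI impI)
      fix n assume "N \<le> n"
      then show "norm (char (distr M borel (B n)) t - char (distr M borel (A n)) t - 0) < r"
        using char_diff_le[of "B n" "A n" e t] N[of n] e by simp
    qed
  qed
  then show "(\<lambda>n. char (distr M borel (B n)) t) \<longlonglongrightarrow> char \<mu> t"
    by (rule Lim_transform[OF conv])
qed (simp_all add: \<mu>)

end

section \<open>Moments of V-statistics of an i.i.d. sample\<close>

text \<open>
  The sample starts at index \<open>1\<close>; nothing is known about \<open>Z 0\<close>.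
\<close>

locale iid_sample = prob_space M for M :: "'w measure" +
  fixes \<nu> :: "'z measure" and Z :: "nat \<Rightarrow> 'w \<Rightarrow> 'z"
  assumes indep: "indep_vars (\<lambda>_. \<nu>) Z {1..}"
    and distr_Z: "\<And>i. 1 \<le> i \<Longrightarrow> distr M \<nu> (Z i) = \<nu>"
begin

lemma Z_measurable: "1 \<le> i \<Longrightarrow> Z i \<in> M \<rightarrow>\<^sub>M \<nu>"
  using indep unfolding indep_vars_def by auto

sublocale law: prob_space \<nu>
  using prob_space_distr[OF Z_measurable[of 1]] distr_Z[of 1] by simp

sublocale law2: pair_prob_space \<nu> \<nu> ..

lemma integrable_Z_iff:
  fixes f :: "'z \<Rightarrow> 'c::{banach, second_countable_topology}"
  assumes "f \<in> borel_measurable \<nu>" "1 \<le> i"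
  shows "integrable M (\<lambda>\<omega>. f (Z i \<omega>)) \<longleftrightarrow> integrable \<nu> f"
  using integrable_distr_eq[OF Z_measurable[OF assms(2)], of f] assms distr_Z by simp

lemma integrable_Z:
  fixes f :: "'z \<Rightarrow> 'c::{banach, second_countable_topology}"
  assumes "integrable \<nu> f" "1 \<le> i"
  shows "integrable M (\<lambda>\<omega>. f (Z i \<omega>))"
  using integrable_Z_iff[of f i] assms by simp

lemma expectation_Z:
  fixes f :: "'z \<Rightarrow> 'c::{banach, second_countable_topology}"
  assumes "f \<in> borel_measurable \<nu>" "1 \<le> i"
  shows "expectation (\<lambda>\<omega>. f (Z i \<omega>)) = law.expectation f"
  using integral_distr[OF Z_measurable[OF assms(2)], of f] assms distr_Z by simp

lemma Z_pair_measurable: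
  assumes "1 \<le> i" "1 \<le> j"
  shows "(\<lambda>\<omega>. (Z i \<omega>, Z j \<omega>)) \<in> M \<rightarrow>\<^sub>M \<nu> \<Otimes>\<^sub>M \<nu>"
  using Z_measurable[OF assms(1)] Z_measurable[OF assms(2)] by simp

lemma distr_Z_pair:
  assumes "1 \<le> i" "1 \<le> j" "i \<noteq> j"
  shows "distr M (\<nu> \<Otimes>\<^sub>M \<nu>) (\<lambda>\<omega>. (Z i \<omega>, Z j \<omega>)) = \<nu> \<Otimes>\<^sub>M \<nu>"
proof -
  have "indep_var (Pi\<^sub>M {i} (\<lambda>_. \<nu>)) (\<lambda>\<omega>. restrict (\<lambda>l. Z l \<omega>) {i})
      (Pi\<^sub>M {j} (\<lambda>_. \<nu>)) (\<lambda>\<omega>. restrict (\<lambda>l. Z l \<omega>) {j})"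
    using assms by (intro indep_var_restrict[OF indep]) auto
  then have "indep_var \<nu> ((\<lambda>f. f i) \<circ> (\<lambda>\<omega>. restrict (\<lambda>l. Z l \<omega>) {i}))
      \<nu> ((\<lambda>f. f j) \<circ> (\<lambda>\<omega>. restrict (\<lambda>l. Z l \<omega>) {j}))"
    by (rule indep_var_compose) (auto intro: measurable_component_singleton)
  then have "indep_var \<nu> (Z i) \<nu> (Z j)"
    by (simp add: comp_def)
  then show ?thesis
    using distr_Z assms unfolding indep_var_distribution_eq by metis
qed

lemma integrable_Z_pair_iff:
  fixes f :: "'z \<times> 'z \<Rightarrow> real"
  assumes "f \<in> borel_measurable (\<nu> \<Otimes>\<^sub>M \<nu>)" "1 \<le> i" "1 \<le> j" "i \<noteq> j"
  shows "integrable M (\<lambda>\<omega>. f (Z i \<omega>, Z j \<omega>)) \<longleftrightarrow> integrable (\<nu> \<Otimes>\<^sub>M \<nu>) f"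
  using integrable_distr_eq[OF Z_pair_measurable[OF assms(2,3)], of f] assms distr_Z_pair by simp

lemma expectation_Z_pair:
  fixes f :: "'z \<times> 'z \<Rightarrow> real"
  assumes "f \<in> borel_measurable (\<nu> \<Otimes>\<^sub>M \<nu>)" "1 \<le> i" "1 \<le> j" "i \<noteq> j"
  shows "expectation (\<lambda>\<omega>. f (Z i \<omega>, Z j \<omega>)) = integral\<^sup>L (\<nu> \<Otimes>\<^sub>M \<nu>) f"
  using integral_distr[OF Z_pair_measurable[OF assms(2,3)], of f] assms distr_Z_pair by simp

text \<open>
  Domination by a product of one square integrable function makes both \<open>k (Z\<^sub>i, Z\<^sub>j)\<close> with
  \<open>i \<noteq> j\<close> and the diagonal terms \<open>k (Z\<^sub>i, Z\<^sub>i)\<close> integrable. Kernels given by an inner product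
  \<open>\<langle>\<Phi> z, \<Phi> z'\<rangle>\<close> satisfy it with the norm of \<open>\<Phi>\<close> when \<open>\<Phi>\<close> has a second moment.
\<close>

definition dominated_kernel :: "('z \<Rightarrow> 'z \<Rightarrow> real) \<Rightarrow> ('z \<Rightarrow> real) \<Rightarrow> bool" where
  "dominated_kernel k b \<longleftrightarrow> (\<lambda>(z, z'). k z z') \<in> borel_measurable (\<nu> \<Otimes>\<^sub>M \<nu>)
     \<and> b \<in> borel_measurable \<nu> \<and> integrable \<nu> (\<lambda>z. (b z)\<^sup>2)
     \<and> (\<forall>z z'. \<bar>k z z'\<bar> \<le> b z * b z')"

definition kernel_mean :: "('z \<Rightarrow> 'z \<Rightarrow> real) \<Rightarrow> 'z \<Rightarrow> real" where
  "kernel_mean k z = (\<integral>z'. k z z' \<partial>\<nu>)"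

definition kernel_double_mean :: "('z \<Rightarrow> 'z \<Rightarrow> real) \<Rightarrow> real" where
  "kernel_double_mean k = (\<integral>z. kernel_mean k z \<partial>\<nu>)"

definition kernel_diag :: "('z \<Rightarrow> 'z \<Rightarrow> real) \<Rightarrow> real" where
  "kernel_diag k = (\<integral>z. k z z \<partial>\<nu>)"

text \<open>
  For \<open>k z z' = \<langle>\<Phi> z, \<Phi> z'\<rangle>\<close> this is the squared norm of \<open>\<Sum>\<^sub>i a\<^sub>i \<Phi> (Z\<^sub>i) - E \<Phi> (Z\<^sub>1)\<close>.
\<close>

definition centered_V :: "('z \<Rightarrow> 'z \<Rightarrow> real) \<Rightarrow> (nat \<Rightarrow> real) \<Rightarrow> nat \<Rightarrow> 'w \<Rightarrow> real" where
  "centered_V k a n \<omega> = (\<Sum>i=1..n. \<Sum>j=1..n. a i * a j * k (Z i \<omega>) (Z j \<omega>))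
    - 2 * (\<Sum>i=1..n. a i * kernel_mean k (Z i \<omega>)) + kernel_double_mean k"

context
  fixes k b
  assumes k: "dominated_kernel k b"
begin

lemma dominated_kernel_measurable [measurable]:
  "(\<lambda>(z, z'). k z z') \<in> borel_measurable (\<nu> \<Otimes>\<^sub>M \<nu>)" "b \<in> borel_measurable \<nu>"
  and dominated_kernel_square: "integrable \<nu> (\<lambda>z. (b z)\<^sup>2)"
  and dominated_kernel_bound: "\<bar>k z z'\<bar> \<le> b z * b z'"
  using k unfolding dominated_kernel_def by auto

lemma integrable_kernel:
  assumes "1 \<le> i" "1 \<le> j"
  shows "integrable M (\<lambda>\<omega>. k (Z i \<omega>) (Z j \<omega>))"
proof (rule Bochner_Integration.integrable_bound)
  show "integrable M (\<lambda>\<omega>. (b (Z i \<omega>))\<^sup>2 + (b (Z j \<omega>))\<^sup>2)"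
    using assms dominated_kernel_square
    by (intro Bochner_Integration.integrable_add integrable_Z[of "\<lambda>z. (b z)\<^sup>2"])
  show "(\<lambda>\<omega>. k (Z i \<omega>) (Z j \<omega>)) \<in> borel_measurable M"
    using measurable_compose[OF Z_pair_measurable[OF assms] dominated_kernel_measurable(1)] by simp
  have "\<bar>k z z'\<bar> \<le> (b z)\<^sup>2 + (b z')\<^sup>2" for z z'
  proof -
    have "b z * b z' \<le> (b z)\<^sup>2 + (b z')\<^sup>2"
      using sum_squares_bound[of "b z" "b z'"] zero_le_power2[of "b z"] zero_le_power2[of "b z'"]
      by linarith
    then show ?thesis using dominated_kernel_bound[of z z'] by linarith
  qed
  then show "AE \<omega> in M. norm (k (Z i \<omega>) (Z j \<omega>)) \<le> norm ((b (Z i \<omega>))\<^sup>2 + (b (Z j \<omega>))\<^sup>2)"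
    by (intro AE_I2) (simp add: abs_of_nonneg)
qed

lemma integrable_kernel_pair: "integrable (\<nu> \<Otimes>\<^sub>M \<nu>) (\<lambda>(z, z'). k z z')"
  using integrable_kernel[of 1 2] integrable_Z_pair_iff[of "\<lambda>(z, z'). k z z'" 1 2] by simp

lemma kernel_mean_measurable [measurable]: "kernel_mean k \<in> borel_measurable \<nu>"
  unfolding kernel_mean_def[abs_def]
  by (rule law.borel_measurable_lebesgue_integral) (rule dominated_kernel_measurable)

lemma integrable_kernel_mean: "integrable \<nu> (kernel_mean k)"
  using law2.integrable_fst'[OF integrable_kernel_pair] by (simp add: kernel_mean_def[abs_def])

lemma integrable_bound_function: "integrable \<nu> b"
  by (rule law.square_integrable_imp_integrable[OF _ dominated_kernel_square]) simp

lemma kernel_mean_bound: "z \<in> space \<nu> \<Longrightarrow> \<bar>kernel_mean k z\<bar> \<le> b z * law.expectation b"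
proof -
  assume [measurable]: "z \<in> space \<nu>"
  have "\<bar>kernel_mean k z\<bar> \<le> (\<integral>z'. \<bar>k z z'\<bar> \<partial>\<nu>)"
    unfolding kernel_mean_def by (rule integral_abs_bound)
  also have "\<dots> \<le> (\<integral>z'. b z * b z' \<partial>\<nu>)"
  proof (rule integral_mono)
    have "(\<lambda>z'. k z z') \<in> borel_measurable \<nu>"
      using measurable_compose[OF measurable_Pair1'[OF \<open>z \<in> space \<nu>\<close>] dominated_kernel_measurable(1)]
      by simp
    then show "integrable \<nu> (\<lambda>z'. \<bar>k z z'\<bar>)"
      using order_trans[OF dominated_kernel_bound abs_ge_self] integrable_bound_function
      by (intro Bochner_Integration.integrable_bound[of \<nu> "\<lambda>z'. b z * b z'" "\<lambda>z'. \<bar>k z z'\<bar>"] AE_I2)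
        simp_all
  qed (auto simp: dominated_kernel_bound integrable_bound_function)
  finally show ?thesis by simp
qed

lemma square_integrable_kernel_mean: "integrable \<nu> (\<lambda>z. (kernel_mean k z)\<^sup>2)"
proof (rule Bochner_Integration.integrable_bound)
  show "integrable \<nu> (\<lambda>z. (law.expectation b)\<^sup>2 * (b z)\<^sup>2)"
    using dominated_kernel_square by simp
  show "AE z in \<nu>. norm ((kernel_mean k z)\<^sup>2) \<le> norm ((law.expectation b)\<^sup>2 * (b z)\<^sup>2)"
  proof (rule AE_I2)
    fix z assume "z \<in> space \<nu>"
    then have "\<bar>kernel_mean k z\<bar>\<^sup>2 \<le> (b z * law.expectation b)\<^sup>2"
      by (intro power_mono kernel_mean_bound) auto
    then show "norm ((kernel_mean k z)\<^sup>2) \<le> norm ((law.expectation b)\<^sup>2 * (b z)\<^sup>2)"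
      by (simp add: power_mult_distrib mult.commute)
  qed
qed (use kernel_mean_measurable in simp)

lemma diag_measurable: "(\<lambda>z. k z z) \<in> borel_measurable \<nu>"
  using measurable_compose[OF measurable_Pair[OF measurable_ident measurable_ident]
      dominated_kernel_measurable(1)] by simp

lemma expectation_kernel:
  assumes "1 \<le> i" "1 \<le> j"
  shows "expectation (\<lambda>\<omega>. k (Z i \<omega>) (Z j \<omega>)) = (if i = j then kernel_diag k else kernel_double_mean k)"
proof (cases "i = j")
  case True
  then show ?thesis
    using expectation_Z[of "\<lambda>z. k z z" i] diag_measurable assms by (simp add: kernel_diag_def)
next
  case False
  then show ?thesis
    using expectation_Z_pair[of "\<lambda>(z, z'). k z z'" i j] assms
      law2.integral_fst'[OF integrable_kernel_pair]
    by (simp add: kernel_double_mean_def kernel_mean_def[abs_def])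
qed

lemma integrable_V_statistic:
  "integrable M (\<lambda>\<omega>. \<Sum>i=1..n. \<Sum>j=1..n. a i * a j * k (Z i \<omega>) (Z j \<omega>))"
  by (intro Bochner_Integration.integrable_sum integrable_mult_right integrable_kernel) auto

text \<open>
  Off the diagonal independence gives the double mean, so only the diagonal terms deviate from it.
\<close>

lemma expectation_V_statistic:
  "expectation (\<lambda>\<omega>. \<Sum>i=1..n. \<Sum>j=1..n. a i * a j * k (Z i \<omega>) (Z j \<omega>))
    = (kernel_diag k - kernel_double_mean k) * (\<Sum>i=1..n. (a i)\<^sup>2) + kernel_double_mean k * (\<Sum>i=1..n. a i)\<^sup>2"
proof -
  have "expectation (\<lambda>\<omega>. \<Sum>i=1..n. \<Sum>j=1..n. a i * a j * k (Z i \<omega>) (Z j \<omega>))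
      = (\<Sum>i=1..n. expectation (\<lambda>\<omega>. \<Sum>j=1..n. a i * a j * k (Z i \<omega>) (Z j \<omega>)))"
    by (rule Bochner_Integration.integral_sum)
      (intro Bochner_Integration.integrable_sum integrable_mult_right integrable_kernel, auto)
  also have "\<dots> = (\<Sum>i=1..n. \<Sum>j=1..n. expectation (\<lambda>\<omega>. a i * a j * k (Z i \<omega>) (Z j \<omega>)))"
    by (intro sum.cong refl Bochner_Integration.integral_sum integrable_mult_right integrable_kernel)
      auto
  also have "\<dots> = (\<Sum>i=1..n. \<Sum>j=1..n. a i * a j * (if i = j then kernel_diag k else kernel_double_mean k))"
    by (intro sum.cong refl) (simp add: expectation_kernel)
  also have "\<dots> = (\<Sum>i=1..n. \<Sum>j=1..n. (if i = j then (kernel_diag k - kernel_double_mean k) * (a i)\<^sup>2 else 0)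
      + kernel_double_mean k * (a i * a j))"
    by (intro sum.cong refl) (auto simp: algebra_simps power2_eq_square)
  also have "\<dots> = (\<Sum>i=1..n. (kernel_diag k - kernel_double_mean k) * (a i)\<^sup>2)
      + kernel_double_mean k * (\<Sum>i=1..n. \<Sum>j=1..n. a i * a j)"
    by (simp add: sum.distrib sum_distrib_left)
  also have "(\<Sum>i=1..n. \<Sum>j=1..n. a i * a j) = (\<Sum>i=1..n. a i)\<^sup>2"
    by (simp only: power2_eq_square sum_product)
  finally show ?thesis
    by (simp only: sum_distrib_left)
qed

lemma integrable_centered_V: "integrable M (centered_V k a n)"
  unfolding centered_V_def[abs_def]
  by (intro Bochner_Integration.integrable_add Bochner_Integration.integrable_diff
      integrable_V_statistic integrable_mult_right Bochner_Integration.integrable_sum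
      integrable_Z[OF integrable_kernel_mean]) auto

text \<open>
  Variance plus squared bias of the weighted mean \<open>\<Sum>\<^sub>i a\<^sub>i \<Phi> (Z\<^sub>i)\<close> as an estimator of
  \<open>E \<Phi> (Z\<^sub>1)\<close>. Both are at most of order \<open>1 / n\<close> for weights of order \<open>1 / n\<close> whose sum is
  \<open>1 + O (1 / n)\<close>.
\<close>

lemma expectation_centered_V:
  "expectation (centered_V k a n)
    = (kernel_diag k - kernel_double_mean k) * (\<Sum>i=1..n. (a i)\<^sup>2) + kernel_double_mean k * ((\<Sum>i=1..n. a i) - 1)\<^sup>2"
proof -
  have int: "integrable M (\<lambda>\<omega>. \<Sum>i=1..n. a i * kernel_mean k (Z i \<omega>))"
    by (intro integrable_mult_right Bochner_Integration.integrable_sum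
        integrable_Z[OF integrable_kernel_mean]) auto
  have "expectation (\<lambda>\<omega>. \<Sum>i=1..n. a i * kernel_mean k (Z i \<omega>)) = (\<Sum>i=1..n. a i) * kernel_double_mean k"
    by (subst Bochner_Integration.integral_sum)
      (auto intro!: integrable_mult_right integrable_Z[OF integrable_kernel_mean]
        simp: expectation_Z kernel_double_mean_def sum_distrib_right)
  then show ?thesis
    using int integrable_V_statistic[of a n] expectation_V_statistic[of a n]
    by (simp add: centered_V_def[abs_def] prob_space algebra_simps power2_eq_square)
qed

end

lemma dominated_kernel_product:
  assumes "g \<in> borel_measurable \<nu>" "integrable \<nu> (\<lambda>z. (g z)\<^sup>2)"
  shows "dominated_kernel (\<lambda>z z'. g z * g z') (\<lambda>z. \<bar>g z\<bar>)"
  unfolding dominated_kernel_def using assms by (auto simp: abs_mult)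

lemma
  fixes g :: "'z \<Rightarrow> real"
  assumes g: "g \<in> borel_measurable \<nu>" "integrable \<nu> (\<lambda>z. (g z)\<^sup>2)" "law.expectation g = 0"
  shows integrable_square_weighted_sum: "integrable M (\<lambda>\<omega>. (\<Sum>i=1..n. a i * g (Z i \<omega>))\<^sup>2)"
    and expectation_square_weighted_sum:
      "expectation (\<lambda>\<omega>. (\<Sum>i=1..n. a i * g (Z i \<omega>))\<^sup>2) = (\<integral>z. (g z)\<^sup>2 \<partial>\<nu>) * (\<Sum>i=1..n. (a i)\<^sup>2)"
proof -
  \<comment> \<open>a squared sum is the V-statistic of a product kernel\<close>
  note dk = dominated_kernel_product[OF g(1,2)]
  have eq: "(\<Sum>i=1..n. a i * g (Z i \<omega>))\<^sup>2
      = (\<Sum>i=1..n. \<Sum>j=1..n. a i * a j * (g (Z i \<omega>) * g (Z j \<omega>)))" for \<omega>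
    by (simp add: power2_eq_square sum_product mult_ac)
  show "integrable M (\<lambda>\<omega>. (\<Sum>i=1..n. a i * g (Z i \<omega>))\<^sup>2)"
    unfolding eq by (rule integrable_V_statistic[OF dk])
  have "kernel_double_mean (\<lambda>z z'. g z * g z') = 0"
    using g(3) by (simp add: kernel_double_mean_def kernel_mean_def)
  moreover have "kernel_diag (\<lambda>z z'. g z * g z') = (\<integral>z. (g z)\<^sup>2 \<partial>\<nu>)"
    by (simp add: kernel_diag_def power2_eq_square)
  ultimately show "expectation (\<lambda>\<omega>. (\<Sum>i=1..n. a i * g (Z i \<omega>))\<^sup>2)
      = (\<integral>z. (g z)\<^sup>2 \<partial>\<nu>) * (\<Sum>i=1..n. (a i)\<^sup>2)"
    unfolding eq by (subst expectation_V_statistic[OF dk]) simp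
qed

end

section \<open>Law of large numbers and weighted central limit theorem\<close>

text \<open>
  The upper bound multiplies the quadratic lower bound of \<open>exp x\<close> by \<open>1 - x + x\<^sup>2 / 2\<close>; the product of
  the two polynomials is \<open>1 + x\<^sup>4 / 4\<close>.
\<close>

lemma abs_exp_minus_linear_le:
  fixes x :: real
  assumes "0 \<le> x"
  shows "\<bar>exp (- x) - (1 - x)\<bar> \<le> x\<^sup>2 / 2"
proof -
  have p: "0 \<le> 1 - x + x\<^sup>2 / 2"
    using zero_le_power2[of "x - 1"] by (simp add: power2_diff)
  have "1 \<le> (1 - x + x\<^sup>2 / 2) * (1 + x + x\<^sup>2 / 2)"
  proof -
    have "(1 - x + x\<^sup>2 / 2) * (1 + x + x\<^sup>2 / 2) = 1 + (x\<^sup>2)\<^sup>2 / 4"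
      by (simp add: algebra_simps power2_eq_square)
    then show ?thesis by simp
  qed
  also have "\<dots> \<le> (1 - x + x\<^sup>2 / 2) * exp x"
    using exp_lower_Taylor_quadratic[OF assms] p by (intro mult_left_mono) auto
  finally have "exp (- x) \<le> 1 - x + x\<^sup>2 / 2"
    by (simp add: exp_minus field_simps)
  moreover have "1 - x \<le> exp (- x)"
    using exp_ge_add_one_self[of "- x"] by simp
  moreover have "0 \<le> x\<^sup>2"
    by simp
  ultimately show ?thesis
    unfolding abs_le_iff by simp
qed

lemma abs_le_square_over:
  fixes x e :: real
  assumes "0 < e"
  shows "\<bar>x\<bar> \<le> e + x\<^sup>2 / e"
proof (cases "\<bar>x\<bar> \<le> e")
  case True
  then show ?thesis
    using assms by (simp add: add_increasing2)
next
  case False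
  then have "\<bar>x\<bar> * e \<le> \<bar>x\<bar> * \<bar>x\<bar>"
    by (intro mult_left_mono) auto
  then have "\<bar>x\<bar> \<le> x\<^sup>2 / e"
    using assms by (simp add: field_simps power2_eq_square)
  then show ?thesis
    using assms by simp
qed

context iid_sample
begin

lemma truncation_L1:
  assumes f: "integrable \<nu> (f :: 'z \<Rightarrow> real)" and "0 < e"
  obtains B :: nat where "(\<integral>z. \<bar>f z - (if \<bar>f z\<bar> \<le> B then f z else 0)\<bar> \<partial>\<nu>) < e"
proof -
  have [measurable]: "f \<in> borel_measurable \<nu>"
    using f by simp
  have "(\<lambda>B::nat. \<integral>z. \<bar>f z - (if \<bar>f z\<bar> \<le> B then f z else 0)\<bar> \<partial>\<nu>) \<longlonglongrightarrow> (\<integral>z. 0 \<partial>\<nu>)"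
  proof (rule integral_dominated_convergence)
    show "integrable \<nu> (\<lambda>z. \<bar>f z\<bar>)"
      using f by simp
    show "AE z in \<nu>. (\<lambda>B::nat. \<bar>f z - (if \<bar>f z\<bar> \<le> B then f z else 0)\<bar>) \<longlonglongrightarrow> 0"
    proof (rule AE_I2)
      fix z
      have "\<forall>\<^sub>F B::nat in sequentially. \<bar>f z\<bar> \<le> real B"
        using filterlim_real_sequentially unfolding filterlim_at_top by simp
      then show "(\<lambda>B::nat. \<bar>f z - (if \<bar>f z\<bar> \<le> B then f z else 0)\<bar>) \<longlonglongrightarrow> 0"
        by (intro tendsto_eventually) (erule eventually_mono, simp)
    qed
  qed auto
  then have "\<forall>\<^sub>F B in sequentially. (\<integral>z. \<bar>f z - (if \<bar>f z\<bar> \<le> real B then f z else 0)\<bar> \<partial>\<nu>) < e"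
    using \<open>0 < e\<close> by (intro order_tendstoD(2)) simp_all
  then show thesis
    using that eventually_happens'[OF sequentially_bot] by blast
qed

text \<open>
  Only integrability is available for \<open>f\<close>, because the law of large numbers is later applied to squares
  of functions that have just a second moment. Truncating \<open>f\<close> at a high level changes all means by
  little in \<open>L\<^sup>1\<close>, and the mean of the bounded part has variance \<open>O (1 / n)\<close>.
\<close>

lemma expectation_abs_mean_deviation:
  assumes f: "integrable \<nu> (f :: 'z \<Rightarrow> real)"
  shows "(\<lambda>n. expectation (\<lambda>\<omega>. \<bar>1 / real n * (\<Sum>i=1..n. f (Z i \<omega>)) - law.expectation f\<bar>)) \<longlonglongrightarrow> 0"
proof (rule LIMSEQ_I)
  fix r :: real assume r: "0 < r"
  define e where "e = r / 4"
  have e: "0 < e" using r by (simp add: e_def)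
  have [measurable]: "f \<in> borel_measurable \<nu>"
    using f by simp
  obtain B :: nat where B: "(\<integral>z. \<bar>f z - (if \<bar>f z\<bar> \<le> B then f z else 0)\<bar> \<partial>\<nu>) < e"
    using truncation_L1[OF f e] by blast
  \<comment> \<open>the truncation of f; g is its centred version and d the truncation error\<close>
  define h where "h z = (if \<bar>f z\<bar> \<le> B then f z else 0)" for z
  define d where "d z = \<bar>f z - h z\<bar>" for z
  define m where "m = law.expectation h"
  define g where "g z = h z - m" for z
  have [measurable]: "h \<in> borel_measurable \<nu>" "d \<in> borel_measurable \<nu>" "g \<in> borel_measurable \<nu>"
    unfolding h_def d_def g_def by measurable
  have h_int: "integrable \<nu> h"
    by (rule law.integrable_const_bound[of _ B]) (auto simp: h_def)
  have d_int: "integrable \<nu> d"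
    using f h_int unfolding d_def by simp
  have d_le: "law.expectation d < e"
    using B by (simp add: d_def[abs_def] h_def[abs_def])
  have g_sq: "integrable \<nu> (\<lambda>z. (g z)\<^sup>2)"
  proof (rule law.integrable_const_bound[of _ "(B + \<bar>m\<bar>)\<^sup>2"])
    have "\<bar>g z\<bar> \<le> B + \<bar>m\<bar>" for z
      unfolding g_def h_def by auto
    then have "\<bar>g z\<bar>\<^sup>2 \<le> (B + \<bar>m\<bar>)\<^sup>2" for z
      by (intro power_mono) auto
    then show "AE z in \<nu>. norm ((g z)\<^sup>2) \<le> (B + \<bar>m\<bar>)\<^sup>2"
      by simp
  qed measurable
  have g_mean: "law.expectation g = 0"
    using h_int by (simp add: g_def[abs_def] m_def law.prob_space)
  define D where "D = (\<integral>z. (g z)\<^sup>2 \<partial>\<nu>)"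
  have D: "0 \<le> D" unfolding D_def by simp
  have m_diff: "\<bar>m - law.expectation f\<bar> \<le> e"
  proof -
    have "\<bar>m - law.expectation f\<bar> = \<bar>\<integral>z. f z - h z \<partial>\<nu>\<bar>"
      using f h_int by (simp add: m_def abs_minus_commute)
    also have "\<dots> \<le> law.expectation d"
      unfolding d_def by (rule integral_abs_bound)
    finally show ?thesis using d_le by simp
  qed
  have bound: "expectation (\<lambda>\<omega>. \<bar>1 / real n * (\<Sum>i=1..n. f (Z i \<omega>)) - law.expectation f\<bar>)
      \<le> 3 * e + D / e / real n" if n: "0 < n" for n
  proof -
    let ?S = "\<lambda>\<omega>. (\<Sum>i=1..n. (1 / real n) * g (Z i \<omega>))"
    let ?R = "\<lambda>\<omega>. 1 / real n * (\<Sum>i=1..n. d (Z i \<omega>)) + (e + (?S \<omega>)\<^sup>2 / e) + e"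
    have S2: "integrable M (\<lambda>\<omega>. (?S \<omega>)\<^sup>2)"
      by (rule integrable_square_weighted_sum[OF _ g_sq g_mean]) measurable
    have S2E: "expectation (\<lambda>\<omega>. (?S \<omega>)\<^sup>2) = D / real n"
      using n by (subst expectation_square_weighted_sum[OF _ g_sq g_mean])
        (auto simp: D_def power2_eq_square)
    have dS: "integrable M (\<lambda>\<omega>. \<Sum>i=1..n. d (Z i \<omega>))"
      by (intro Bochner_Integration.integrable_sum integrable_Z[OF d_int]) auto
    have dE: "expectation (\<lambda>\<omega>. \<Sum>i=1..n. d (Z i \<omega>)) = n * law.expectation d"
      by (subst Bochner_Integration.integral_sum) (auto simp: expectation_Z intro!: integrable_Z[OF d_int])
    have int: "integrable M ?R"
      using S2 dS by (intro Bochner_Integration.integrable_add) auto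
    have "expectation (\<lambda>\<omega>. \<bar>1 / real n * (\<Sum>i=1..n. f (Z i \<omega>)) - law.expectation f\<bar>) \<le> expectation ?R"
    proof (rule integral_mono[OF _ int])
      have fS: "integrable M (\<lambda>\<omega>. \<Sum>i=1..n. f (Z i \<omega>))"
        by (intro Bochner_Integration.integrable_sum integrable_Z[OF f]) auto
      then show "integrable M (\<lambda>\<omega>. \<bar>1 / real n * (\<Sum>i=1..n. f (Z i \<omega>)) - law.expectation f\<bar>)"
        by (intro integrable_abs Bochner_Integration.integrable_diff integrable_mult_right) auto
      fix \<omega>
      have S: "?S \<omega> = 1 / real n * (\<Sum>i=1..n. g (Z i \<omega>))"
        by (simp only: sum_distrib_left)
      have "(\<Sum>i=1..n. f (Z i \<omega>)) = (\<Sum>i=1..n. f (Z i \<omega>) - h (Z i \<omega>)) + (\<Sum>i=1..n. g (Z i \<omega>)) + n * m"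
        by (simp add: g_def sum_subtractf)
      then have "1 / real n * (\<Sum>i=1..n. f (Z i \<omega>)) - law.expectation f
          = 1 / real n * (\<Sum>i=1..n. f (Z i \<omega>) - h (Z i \<omega>)) + ?S \<omega> + (m - law.expectation f)"
        unfolding S using n by (simp add: field_simps)
      moreover have "\<bar>1 / real n * (\<Sum>i=1..n. f (Z i \<omega>) - h (Z i \<omega>))\<bar> \<le> 1 / real n * (\<Sum>i=1..n. d (Z i \<omega>))"
        unfolding d_def by (simp add: abs_mult divide_right_mono)
      ultimately show "\<bar>1 / real n * (\<Sum>i=1..n. f (Z i \<omega>)) - law.expectation f\<bar> \<le> ?R \<omega>"
        using m_diff abs_le_square_over[OF e, of "?S \<omega>"] by linarith
    qed
    also have "expectation ?R = law.expectation d + (e + D / real n / e) + e"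
      using S2 dS n S2E dE by (simp add: prob_space)
    finally show ?thesis
      using d_le by (simp add: mult.commute)
  qed
  have "(\<lambda>n. 3 * e + D / e / real n) \<longlonglongrightarrow> 3 * e + 0"
    by (intro tendsto_add tendsto_const tendsto_divide_0[OF tendsto_const]
        filterlim_at_top_imp_at_infinity filterlim_real_sequentially)
  then have "\<forall>\<^sub>F n in sequentially. 3 * e + D / e / real n < r"
    using r by (intro order_tendstoD(2)[where y = "3 * e + 0"]) (auto simp: e_def)
  then have "\<forall>\<^sub>F n in sequentially. 0 < n \<and> 3 * e + D / e / real n < r"
    using eventually_gt_at_top[of 0] by eventually_elim simp
  then obtain N where N: "\<And>n. N \<le> n \<Longrightarrow> 0 < n" "\<And>n. N \<le> n \<Longrightarrow> 3 * e + D / e / real n < r"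
    unfolding eventually_sequentially by blast
  show "\<exists>N. \<forall>n\<ge>N. norm (expectation (\<lambda>\<omega>. \<bar>1 / real n * (\<Sum>i=1..n. f (Z i \<omega>)) - law.expectation f\<bar>) - 0) < r"
  proof (intro exI allI impI)
    fix n assume n: "N \<le> n"
    show "norm (expectation (\<lambda>\<omega>. \<bar>1 / real n * (\<Sum>i=1..n. f (Z i \<omega>)) - law.expectation f\<bar>) - 0) < r"
      using le_less_trans[OF bound[OF N(1)[OF n]] N(2)[OF n]] by simp
  qed
qed

lemma sum_Z_measurable:
  fixes f :: "nat \<Rightarrow> 'z \<Rightarrow> real"
  assumes "\<And>i. f i \<in> borel_measurable \<nu>"
  shows "(\<lambda>\<omega>. \<Sum>i=1..n. f i (Z i \<omega>)) \<in> borel_measurable M"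
  using assms by (intro borel_measurable_sum measurable_compose[OF Z_measurable]) auto

lemma weak_law_of_large_numbers:
  assumes f: "integrable \<nu> (f :: 'z \<Rightarrow> real)"
  shows "tendsto_prob (\<lambda>n \<omega>. 1 / real n * (\<Sum>i=1..n. f (Z i \<omega>))) (law.expectation f)"
proof (rule tendsto_prob_of_expectation)
  have fS: "integrable M (\<lambda>\<omega>. \<Sum>i=1..n. f (Z i \<omega>))" for n
    by (intro Bochner_Integration.integrable_sum integrable_Z[OF f]) auto
  then show "random_variable borel (\<lambda>\<omega>. 1 / real n * (\<Sum>i=1..n. f (Z i \<omega>)))" for n
    by (intro borel_measurable_times borel_measurable_const borel_measurable_integrable) 
  show "integrable M (\<lambda>\<omega>. \<bar>1 / real n * (\<Sum>i=1..n. f (Z i \<omega>)) - law.expectation f\<bar>)" for n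
    using fS by (intro integrable_abs Bochner_Integration.integrable_diff integrable_mult_right) auto
  show "(\<lambda>n. expectation (\<lambda>\<omega>. \<bar>1 / real n * (\<Sum>i=1..n. f (Z i \<omega>)) - law.expectation f\<bar>)) \<longlonglongrightarrow> 0"
    by (rule expectation_abs_mean_deviation[OF f])
qed (rule order_refl)+

lemma char_weighted_sum:
  fixes g :: "'z \<Rightarrow> real"
  assumes [measurable]: "g \<in> borel_measurable \<nu>"
  shows "char (distr M borel (\<lambda>\<omega>. \<Sum>i=1..n. a i * g (Z i \<omega>))) t
    = (\<Prod>i=1..n. char (distr \<nu> borel g) (a i * t))"
proof -
  have "indep_vars (\<lambda>_. borel) (\<lambda>i \<omega>. a i * g (Z i \<omega>)) {1..n}"
    by (rule indep_vars_compose2[OF indep_vars_subset[OF indep]]) auto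
  then have "char (distr M borel (\<lambda>\<omega>. \<Sum>i=1..n. a i * g (Z i \<omega>))) t
      = (\<Prod>i=1..n. char (distr M borel (\<lambda>\<omega>. a i * g (Z i \<omega>))) t)"
    by (rule char_distr_sum)
  also have "\<dots> = (\<Prod>i=1..n. char (distr \<nu> borel g) (a i * t))"
  proof (rule prod.cong[OF refl])
    fix i assume i: "i \<in> {1..n}"
    then have [measurable]: "Z i \<in> M \<rightarrow>\<^sub>M \<nu>"
      by (intro Z_measurable) simp
    have "char (distr M borel (\<lambda>\<omega>. a i * g (Z i \<omega>))) t
        = expectation (\<lambda>\<omega>. (\<lambda>z. iexp (a i * t * g z)) (Z i \<omega>))"
      by (simp add: char_def integral_distr mult_ac)
    also have "\<dots> = law.expectation (\<lambda>z. iexp (a i * t * g z))"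
      using i by (intro expectation_Z) auto
    also have "\<dots> = char (distr \<nu> borel g) (a i * t)"
      by (simp add: char_def integral_distr)
    finally show "char (distr M borel (\<lambda>\<omega>. a i * g (Z i \<omega>))) t = char (distr \<nu> borel g) (a i * t)" .
  qed
  finally show ?thesis .
qed

text \<open>
  Since every coefficient is small, the characteristic function \<open>\<phi>\<close> of \<open>g\<close> enters only through its
  second-order expansion at \<open>0\<close>, where it agrees with that of a Gaussian variable of the same variance up
  to \<open>o (u\<^sup>2)\<close>. A product of numbers in the unit disc is Lipschitz with constant \<open>1\<close> in each
  factor, so the errors add up to \<open>o (1)\<close> times the sum of the squared coefficients, while the product of the Gaussian factors
  depends on that sum alone.
\<close>

theorem weighted_central_limit:
  fixes g :: "'z \<Rightarrow> real" and a :: "nat \<Rightarrow> nat \<Rightarrow> real"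
  assumes g [measurable]: "g \<in> borel_measurable \<nu>"
    and g2: "integrable \<nu> (\<lambda>z. (g z)\<^sup>2)" and g_mean: "law.expectation g = 0"
    and small: "\<And>n i. i \<in> {1..n} \<Longrightarrow> \<bar>a n i\<bar> \<le> \<delta> n" and \<delta>: "\<delta> \<longlonglongrightarrow> 0"
    and variance_lim: "(\<lambda>n. (\<integral>z. (g z)\<^sup>2 \<partial>\<nu>) * (\<Sum>i=1..n. (a n i)\<^sup>2)) \<longlonglongrightarrow> 1"
  shows "(\<lambda>n. char (distr M borel (\<lambda>\<omega>. \<Sum>i=1..n. a n i * g (Z i \<omega>))) t)
    \<longlonglongrightarrow> char std_normal_distribution t"
proof -
  define s where "s = (\<integral>z. (g z)\<^sup>2 \<partial>\<nu>)"
  define \<phi> where "\<phi> = char (distr \<nu> borel g)"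
  define A where "A n = (\<Sum>i=1..n. (a n i)\<^sup>2)" for n
  \<comment> \<open>u^2 / 6 times this bounds the error of the second-order expansion of the characteristic function\<close>
  define E where "E u = (\<integral>z. min (6 * (g z)\<^sup>2) (\<bar>u\<bar> * \<bar>g z\<bar> ^ 3) \<partial>\<nu>)" for u
  define \<eta> where "\<eta> n = t\<^sup>2 * (E (\<delta> n * t) / 6 + s\<^sup>2 / 8 * (\<delta> n * t)\<^sup>2)" for n
  have s: "0 \<le> s" unfolding s_def by simp
  have g_int: "integrable \<nu> g"
    by (rule law.square_integrable_imp_integrable[OF g g2])
  have E_int: "integrable \<nu> (\<lambda>z. min (6 * (g z)\<^sup>2) (\<bar>u\<bar> * \<bar>g z\<bar> ^ 3))" for u
    by (rule Bochner_Integration.integrable_bound[of _ "\<lambda>z. 6 * (g z)\<^sup>2"]) (use g2 in auto)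
  have E_mono: "E u \<le> E v" if "\<bar>u\<bar> \<le> \<bar>v\<bar>" for u v
    unfolding E_def using that
    by (intro integral_mono E_int min.mono mult_right_mono) auto
  have local_approx: "cmod (\<phi> u - complex_of_real (exp (- (u\<^sup>2 * s / 2)))) \<le> u\<^sup>2 / 6 * E u + u ^ 4 * s\<^sup>2 / 8" for u
  proof -
    have "cmod (\<phi> u - complex_of_real (1 - u\<^sup>2 * s / 2)) \<le> u\<^sup>2 / 6 * E u"
      using law.char_approx3'[OF g g_int g2 g_mean _ refl, of s u]
      by (simp add: \<phi>_def E_def s_def g_mean)
    moreover have "cmod (complex_of_real (1 - u\<^sup>2 * s / 2) - complex_of_real (exp (- (u\<^sup>2 * s / 2))))
        \<le> u ^ 4 * s\<^sup>2 / 8"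
    proof -
      have "cmod (complex_of_real (1 - u\<^sup>2 * s / 2) - complex_of_real (exp (- (u\<^sup>2 * s / 2))))
          = \<bar>exp (- (u\<^sup>2 * s / 2)) - (1 - u\<^sup>2 * s / 2)\<bar>"
        unfolding of_real_diff[symmetric] norm_of_real by (rule abs_minus_commute)
      also have "\<dots> \<le> (u\<^sup>2 * s / 2)\<^sup>2 / 2"
        using s by (intro abs_exp_minus_linear_le) simp
      also have "\<dots> = u ^ 4 * s\<^sup>2 / 8"
        by (simp add: power_mult_distrib power_divide)
      finally show ?thesis .
    qed
    ultimately show ?thesis
      using norm_triangle_ineq[of "\<phi> u - complex_of_real (1 - u\<^sup>2 * s / 2)"
          "complex_of_real (1 - u\<^sup>2 * s / 2) - complex_of_real (exp (- (u\<^sup>2 * s / 2)))"]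
      by (simp only: diff_add_cancel add_diff_eq)
  qed
  have "cmod ((\<Prod>i=1..n. \<phi> (a n i * t)) - (\<Prod>i=1..n. complex_of_real (exp (- ((a n i * t)\<^sup>2 * s / 2))))) \<le> \<eta> n * A n" for n
  proof -
    have "cmod ((\<Prod>i=1..n. \<phi> (a n i * t)) - (\<Prod>i=1..n. complex_of_real (exp (- ((a n i * t)\<^sup>2 * s / 2)))))
        \<le> (\<Sum>i=1..n. cmod (\<phi> (a n i * t) - complex_of_real (exp (- ((a n i * t)\<^sup>2 * s / 2)))))"
    proof (rule norm_prod_diff)
      show "cmod (\<phi> (a n i * t)) \<le> 1" for i
        unfolding \<phi>_def by (rule real_distribution.cmod_char_le_1) (simp add: law.real_distribution_distr)
      show "cmod (complex_of_real (exp (- ((a n i * t)\<^sup>2 * s / 2)))) \<le> 1" for i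
        using s by simp
    qed
    also have "\<dots> \<le> (\<Sum>i=1..n. \<eta> n * (a n i)\<^sup>2)"
    proof (rule sum_mono)
      fix i assume i: "i \<in> {1..n}"
      let ?u = "a n i * t"
      have u: "\<bar>?u\<bar> \<le> \<bar>\<delta> n * t\<bar>"
        using small[OF i] by (auto simp: abs_mult intro!: mult_right_mono)
      have "cmod (\<phi> ?u - complex_of_real (exp (- (?u\<^sup>2 * s / 2)))) \<le> ?u\<^sup>2 / 6 * E ?u + ?u ^ 4 * s\<^sup>2 / 8"
        by (rule local_approx)
      also have "\<dots> = ?u\<^sup>2 * (E ?u / 6 + s\<^sup>2 / 8 * ?u\<^sup>2)"
        by (simp add: algebra_simps power2_eq_square power4_eq_xxxx)
      also have "\<dots> \<le> ?u\<^sup>2 * (E (\<delta> n * t) / 6 + s\<^sup>2 / 8 * (\<delta> n * t)\<^sup>2)"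
        using E_mono[OF u] u
        by (intro mult_left_mono add_mono) (auto simp: abs_le_square_iff)
      also have "\<dots> = \<eta> n * (a n i)\<^sup>2"
        by (simp add: \<eta>_def power_mult_distrib mult_ac)
      finally show "cmod (\<phi> ?u - complex_of_real (exp (- (?u\<^sup>2 * s / 2)))) \<le> \<eta> n * (a n i)\<^sup>2" .
    qed
    finally show ?thesis
      by (simp add: A_def sum_distrib_left)
  qed
  moreover have "(\<Prod>i=1..n. complex_of_real (exp (- ((a n i * t)\<^sup>2 * s / 2)))) = complex_of_real (exp (- (t\<^sup>2 / 2 * (s * A n))))" for n
    unfolding of_real_prod[symmetric] exp_sum[OF finite_atLeastAtMost, symmetric] A_def sum_distrib_left sum_negf[symmetric]
    by (simp add: power_mult_distrib mult_ac)
  ultimately have close: "cmod ((\<Prod>i=1..n. \<phi> (a n i * t)) - complex_of_real (exp (- (t\<^sup>2 / 2 * (s * A n))))) \<le> \<eta> n * A n" for n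
    by metis
  have "\<eta> \<longlonglongrightarrow> t\<^sup>2 * (0 / 6 + s\<^sup>2 / 8 * (0 * t)\<^sup>2)"
  proof -
    have "(\<lambda>n. E (\<delta> n * t)) \<longlonglongrightarrow> (\<integral>z. 0 \<partial>\<nu>)"
      unfolding E_def
    proof (rule integral_dominated_convergence)
      show "integrable \<nu> (\<lambda>z. 6 * (g z)\<^sup>2)"
        using g2 by simp
      have "(\<lambda>n. min (6 * (g z)\<^sup>2) (\<bar>\<delta> n * t\<bar> * \<bar>g z\<bar> ^ 3)) \<longlonglongrightarrow> min (6 * (g z)\<^sup>2) (\<bar>0 * t\<bar> * \<bar>g z\<bar> ^ 3)" for z
        by (intro tendsto_intros \<delta>)
      then show "AE z in \<nu>. (\<lambda>n. min (6 * (g z)\<^sup>2) (\<bar>\<delta> n * t\<bar> * \<bar>g z\<bar> ^ 3)) \<longlonglongrightarrow> 0"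
        by (intro AE_I2) simp
    qed auto
    then show ?thesis
      unfolding \<eta>_def by (intro tendsto_intros \<delta>) simp_all
  qed
  then have \<eta>: "\<eta> \<longlonglongrightarrow> 0" by simp
  have sA: "(\<lambda>n. s * A n) \<longlonglongrightarrow> 1"
    using variance_lim by (simp add: s_def A_def)
  have "s \<noteq> 0"
    using sA by (auto simp: LIMSEQ_const_iff)
  then have A: "A \<longlonglongrightarrow> 1 / s"
    using tendsto_divide[OF sA tendsto_const, of s] by simp
  have diff: "(\<lambda>n. (\<Prod>i=1..n. \<phi> (a n i * t)) - complex_of_real (exp (- (t\<^sup>2 / 2 * (s * A n))))) \<longlonglongrightarrow> 0"
    by (rule Lim_null_comparison[of _ "\<lambda>n. \<eta> n * A n"])
      (use close tendsto_mult[OF \<eta> A] in auto)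
  have lim: "(\<lambda>n. complex_of_real (exp (- (t\<^sup>2 / 2 * (s * A n))))) \<longlonglongrightarrow> complex_of_real (exp (- (t\<^sup>2 / 2 * 1)))"
    by (intro tendsto_intros sA)
  have "(\<lambda>n. \<Prod>i=1..n. \<phi> (a n i * t)) \<longlonglongrightarrow> complex_of_real (exp (- (t\<^sup>2 / 2 * 1)))"
    by (rule Lim_transform[OF lim diff])
  moreover have "complex_of_real (exp (- (t\<^sup>2 / 2 * 1))) = char std_normal_distribution t"
    by (simp add: char_std_normal_distribution)
  ultimately show ?thesis
    unfolding char_weighted_sum[OF g] \<phi>_def by simp
qed

end

section \<open>A positive semidefinite kernel with a ghost point for its mean\<close>

context rkhs
begin

lemma kernel_sym: "K x y = K y x"
  using reproducing[OF kernel_mem, of x y] reproducing[OF kernel_mem, of y x]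
    ip_commute[OF kernel_mem kernel_mem, of x y] by simp

lemma
  assumes "finite I"
  shows kernel_combination_mem: "(\<lambda>x. \<Sum>i\<in>I. c i * K (p i) x) \<in> H"
    and ip_kernel_combination: "g \<in> H \<Longrightarrow> ip (\<lambda>x. \<Sum>i\<in>I. c i * K (p i) x) g = (\<Sum>i\<in>I. c i * g (p i))"
  using assms
proof (induction I rule: finite_induct)
  case empty
  { case 1 show ?case by (simp add: zero_mem) }
  { case 2 then show ?case using ip_scale_left[OF zero_mem, of g 0] by simp }
next
  case (insert a I)
  have scaled: "(\<lambda>x. c a * K (p a) x) \<in> H"
    by (rule scale_mem[OF kernel_mem])
  { case 1 show ?case
      using add_mem[OF scaled insert.IH(1)] insert.hyps by simp }
  { case 2 then show ?case
      using ip_add_left[OF scaled insert.IH(1), of g] ip_scale_left[OF kernel_mem, of g "c a" "p a"]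
        reproducing[of g "p a"] insert by simp }
qed

text \<open>
  The quadratic form is the squared norm of \<open>\<Sum>\<^sub>i c\<^sub>i K (p\<^sub>i, \<cdot>)\<close>.
\<close>

lemma kernel_psd:
  assumes "finite I"
  shows "psd_on I (\<lambda>i j. K (p i) (p j))"
  unfolding psd_on_def
proof (intro conjI ballI allI)
  show "K (p i) (p j) = K (p j) (p i)" for i j
    by (rule kernel_sym)
  fix c :: "'b \<Rightarrow> real"
  let ?f = "\<lambda>x. \<Sum>i\<in>I. c i * K (p i) x"
  have "0 \<le> ip ?f ?f"
    by (rule ip_nonneg[OF kernel_combination_mem[OF assms]])
  also have "\<dots> = (\<Sum>i\<in>I. c i * (\<Sum>j\<in>I. c j * K (p j) (p i)))"
    by (rule ip_kernel_combination[OF assms kernel_combination_mem[OF assms]])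
  also have "\<dots> = (\<Sum>i\<in>I. \<Sum>j\<in>I. c i * c j * K (p i) (p j))"
    by (intro sum.cong refl) (simp add: sum_distrib_left mult.assoc kernel_sym)
  finally show "0 \<le> (\<Sum>i\<in>I. \<Sum>j\<in>I. c i * c j * K (p i) (p j))" .
qed

lemma kernel_diag_nonneg: "0 \<le> K x x"
  using psd_on_diag_nonneg[OF kernel_psd[of "{()}" "\<lambda>_. x"], of "()"] by simp

lemma kernel_abs_le:
  assumes "\<And>x y. K x y \<le> \<kappa>"
  shows "\<bar>K x y\<bar> \<le> \<kappa>"
proof -
  have "0 \<le> s\<^sup>2 * K x x + 2 * s * t * K x y + t\<^sup>2 * K y y" for s t
    using psd_on_pair[OF kernel_psd[of "{True, False}" "\<lambda>b. if b then x else y"], of True False s t]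
    by simp
  from this[of 1 1] this[of 1 "- 1"] have "- (K x x + K y y) \<le> 2 * K x y" "2 * K x y \<le> K x x + K y y"
    by simp_all
  then show ?thesis
    using assms[of x x] assms[of y y] unfolding abs_le_iff by linarith
qed

end

text \<open>
  A sample of pairs \<open>Z\<^sub>i = (X\<^sub>i, Y\<^sub>i)\<close> with law \<open>\<nu>\<close>. The condition \<open>mean_independent\<close> is the null
  hypothesis \<open>E (Y | X) = mY\<close>, tested against bounded functions of \<open>X\<close> and in every direction \<open>y\<close>.
\<close>

locale kernel_sample =
  rkhs H ip K + iid_sample M \<nu> Z
  for H :: "('x::{real_inner, banach, second_countable_topology} \<Rightarrow> real) set"
    and ip :: "('x \<Rightarrow> real) \<Rightarrow> ('x \<Rightarrow> real) \<Rightarrow> real"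
    and K :: "'x \<Rightarrow> 'x \<Rightarrow> real"
    and M :: "'w measure"
    and \<nu> :: "('x \<times> 'y::{real_inner, banach, second_countable_topology}) measure"
    and Z :: "nat \<Rightarrow> 'w \<Rightarrow> 'x \<times> 'y" +
  fixes \<kappa> :: real and mY :: 'y
  assumes sets_law: "sets \<nu> = sets (borel \<Otimes>\<^sub>M borel)"
    and K_measurable: "(\<lambda>(x, x'). K x x') \<in> borel_measurable (borel \<Otimes>\<^sub>M borel)"
    and K_le: "\<And>x x'. K x x' \<le> \<kappa>"
    and Y_square: "integrable \<nu> (\<lambda>z. (norm (snd z))\<^sup>2)"
    and mean_independent: "\<And>f y. f \<in> borel_measurable borel \<Longrightarrow> bounded (range f) \<Longrightarrow>
      (\<integral>z. f (fst z) * (y \<bullet> snd z) \<partial>\<nu>) = (\<integral>z. f (fst z) \<partial>\<nu>) * (y \<bullet> mY)"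
begin

lemma measurable_fst_snd [measurable]: "fst \<in> \<nu> \<rightarrow>\<^sub>M borel" "snd \<in> \<nu> \<rightarrow>\<^sub>M borel"
  using measurable_fst[of borel borel] measurable_snd[of borel borel]
  by (simp_all add: measurable_cong_sets[OF sets_law refl])

lemma K_compose_measurable [measurable (raw)]:
  assumes "f \<in> N \<rightarrow>\<^sub>M borel" "g \<in> N \<rightarrow>\<^sub>M borel"
  shows "(\<lambda>w. K (f w) (g w)) \<in> borel_measurable N"
  using measurable_compose[OF measurable_Pair[OF assms] K_measurable] by simp

lemma abs_K_le: "\<bar>K x x'\<bar> \<le> \<kappa>"
  by (rule kernel_abs_le[OF K_le])

lemma \<kappa>_nonneg: "0 \<le> \<kappa>"
  using abs_K_le[of 0 0] by simp

definition kx :: "'x \<times> 'y \<Rightarrow> 'x \<times> 'y \<Rightarrow> real" where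
  "kx z z' = K (fst z) (fst z')"

definition ky :: "'x \<times> 'y \<Rightarrow> 'x \<times> 'y \<Rightarrow> real" where
  "ky z z' = snd z \<bullet> snd z'"

definition kxy :: "'x \<times> 'y \<Rightarrow> 'x \<times> 'y \<Rightarrow> real" where
  "kxy z z' = (snd z \<bullet> snd z') * K (fst z) (fst z')"

text \<open>
  The kernel mean \<open>E K (X, \<cdot>)\<close> as a function, and its squared norm in the reproducing kernel Hilbert
  space.
\<close>

definition mK :: "'x \<Rightarrow> real" where
  "mK x = (\<integral>z. K x (fst z) \<partial>\<nu>)"

definition \<theta>K :: real where
  "\<theta>K = (\<integral>z. mK (fst z) \<partial>\<nu>)"

lemma dominated_kx: "dominated_kernel kx (\<lambda>_. sqrt \<kappa>)"
proof -
  have "(\<lambda>p. K (fst (fst p)) (fst (snd p))) \<in> borel_measurable (\<nu> \<Otimes>\<^sub>M \<nu>)"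
    by measurable
  then show ?thesis
    unfolding dominated_kernel_def kx_def case_prod_beta
    using abs_K_le \<kappa>_nonneg by simp
qed

lemma dominated_ky: "dominated_kernel ky (\<lambda>z. norm (snd z))"
proof -
  have "(\<lambda>p. snd (fst p) \<bullet> snd (snd p)) \<in> borel_measurable (\<nu> \<Otimes>\<^sub>M \<nu>)"
    by measurable
  then show ?thesis
    unfolding dominated_kernel_def ky_def case_prod_beta
    using Y_square Cauchy_Schwarz_ineq2 by auto
qed

lemma dominated_kxy: "dominated_kernel kxy (\<lambda>z. sqrt \<kappa> * norm (snd z))"
proof -
  have "(\<lambda>p. (snd (fst p) \<bullet> snd (snd p)) * K (fst (fst p)) (fst (snd p))) \<in> borel_measurable (\<nu> \<Otimes>\<^sub>M \<nu>)"
    by measurable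
  moreover have "\<bar>kxy z z'\<bar> \<le> sqrt \<kappa> * norm (snd z) * (sqrt \<kappa> * norm (snd z'))" for z z'
  proof -
    have "\<bar>kxy z z'\<bar> \<le> (norm (snd z) * norm (snd z')) * \<kappa>"
      unfolding kxy_def abs_mult using abs_K_le Cauchy_Schwarz_ineq2 \<kappa>_nonneg
      by (intro mult_mono) auto
    also have "\<dots> = (norm (snd z) * norm (snd z')) * (sqrt \<kappa> * sqrt \<kappa>)"
      using \<kappa>_nonneg by simp
    finally show ?thesis by (simp only: mult_ac)
  qed
  ultimately show ?thesis
    unfolding dominated_kernel_def case_prod_beta
    using Y_square \<kappa>_nonneg by (auto simp: power_mult_distrib kxy_def)
qed

lemma K_section_measurable: "K x \<in> borel_measurable borel"
  by (rule K_compose_measurable[OF measurable_const measurable_ident_sets[OF refl]]) simp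

lemma mK_measurable [measurable]: "mK \<in> borel_measurable borel"
proof -
  have "(\<lambda>p. K (fst p) (fst (snd p))) \<in> borel_measurable (borel \<Otimes>\<^sub>M \<nu>)"
    by measurable
  then show ?thesis
    unfolding mK_def[abs_def] by (intro law.borel_measurable_lebesgue_integral) (simp add: case_prod_beta)
qed

lemma integrable_K: "integrable \<nu> (\<lambda>z. K x (fst z))"
  by (rule law.integrable_const_bound[of _ \<kappa>]) (auto simp: abs_K_le)

lemma abs_mK_le: "\<bar>mK x\<bar> \<le> \<kappa>"
proof -
  have "\<bar>mK x\<bar> \<le> (\<integral>z. \<bar>K x (fst z)\<bar> \<partial>\<nu>)"
    unfolding mK_def by (rule integral_abs_bound)
  also have "\<dots> \<le> (\<integral>z. \<kappa> \<partial>\<nu>)"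
    using integrable_K by (intro integral_mono) (auto simp: abs_K_le)
  finally show ?thesis by (simp add: law.prob_space)
qed

lemma kernel_mean_kx: "kernel_mean kx z = mK (fst z)"
  by (simp add: kernel_mean_def kx_def mK_def)

lemma kernel_double_mean_kx: "kernel_double_mean kx = \<theta>K"
  by (simp add: kernel_double_mean_def kernel_mean_kx \<theta>K_def)

lemma kernel_mean_ky: "kernel_mean ky z = snd z \<bullet> mY"
  using mean_independent[of "\<lambda>_. 1" "snd z"] by (simp add: kernel_mean_def ky_def law.prob_space)

lemma kernel_double_mean_ky: "kernel_double_mean ky = mY \<bullet> mY"
  using mean_independent[of "\<lambda>_. 1" mY]
  by (simp add: kernel_double_mean_def kernel_mean_ky law.prob_space inner_commute)

text \<open>
  Here mean independence enters: the mean of \<open>Y \<otimes> K (X, \<cdot>)\<close> is the tensor product of the means.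
\<close>

lemma kernel_mean_kxy: "kernel_mean kxy z = (snd z \<bullet> mY) * mK (fst z)"
proof -
  have "bounded (range (K (fst z)))"
    using abs_K_le by (auto simp: bounded_iff)
  then show ?thesis
    using mean_independent[OF K_section_measurable, of "fst z" "snd z"]
    by (simp add: kernel_mean_def kxy_def mK_def mult.commute)
qed

lemma kernel_double_mean_kxy: "kernel_double_mean kxy = (mY \<bullet> mY) * \<theta>K"
proof -
  have "bounded (range mK)"
    using abs_mK_le by (auto simp: bounded_iff)
  then show ?thesis
    using mean_independent[OF mK_measurable, of mY]
    by (simp add: kernel_double_mean_def kernel_mean_kxy \<theta>K_def mult.commute inner_commute)
qed

text \<open>
  The Gram matrix of the functions \<open>K (x\<^sub>i, \<cdot>)\<close> at positive indices and of the kernel mean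
  \<open>E K (X, \<cdot>)\<close> at index \<open>0\<close>.
\<close>

definition ghost_gram :: "(nat \<Rightarrow> 'x) \<Rightarrow> nat \<Rightarrow> nat \<Rightarrow> real" where
  "ghost_gram x i j =
    (if i = 0 then if j = 0 then \<theta>K else mK (x j) else if j = 0 then mK (x i) else K (x i) (x j))"

lemma atLeast0_eq_insert: "{0..n} = insert (0::nat) {1..n}"
  by auto

lemma ghost_gram_double_sum:
  "(\<Sum>i\<in>{0..n}. \<Sum>j\<in>{0..n}. ghost_gram x i j * f i j)
    = \<theta>K * f 0 0 + (\<Sum>i=1..n. mK (x i) * f 0 i) + (\<Sum>i=1..n. mK (x i) * f i 0)
      + (\<Sum>i=1..n. \<Sum>j=1..n. K (x i) (x j) * f i j)"
  unfolding atLeast0_eq_insert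
  by (subst double_sum_insert) (auto simp: ghost_gram_def intro!: sum.cong)

text \<open>
  Positivity with the kernel mean replaced by the average of \<open>K (X\<^sub>k, \<cdot>)\<close> over \<open>N\<close> sample points is
  positivity of \<open>K\<close> itself. In expectation the average differs from the kernel mean only by a
  diagonal term of order \<open>1 / N\<close>, which disappears as \<open>N\<close> grows.
\<close>

lemma ghost_gram_psd: "psd_on {0..n} (ghost_gram x)"
  unfolding psd_on_def
proof (intro conjI ballI allI)
  show "ghost_gram x i j = ghost_gram x j i" for i j
    by (simp add: ghost_gram_def kernel_sym)
  fix c :: "nat \<Rightarrow> real"
  define S where "S = (\<Sum>i=1..n. \<Sum>j=1..n. K (x i) (x j) * (c i * c j))"
  define L where "L = (\<Sum>i=1..n. c i * mK (x i))"
  define V where "V = (kernel_diag kx - \<theta>K) * (c 0)\<^sup>2"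
  have key: "0 \<le> S + 2 * c 0 * L + \<theta>K * (c 0)\<^sup>2 + V / real N" if N: "0 < N" for N
  proof -
    let ?a = "c 0 / real N"
    let ?cross = "\<lambda>\<omega>. \<Sum>i=1..n. \<Sum>k=1..N. c i * ?a * K (x i) (fst (Z k \<omega>))"
    let ?Vs = "\<lambda>\<omega>. \<Sum>k=1..N. \<Sum>l=1..N. ?a * ?a * kx (Z k \<omega>) (Z l \<omega>)"
    have nonneg: "0 \<le> S + 2 * ?cross \<omega> + ?Vs \<omega>" for \<omega>
    proof -
      \<comment> \<open>the given points on the left and the random points on the right\<close>
      let ?I = "{1..n} <+> {1..N}"
      let ?p = "case_sum x (\<lambda>k. fst (Z k \<omega>))" and ?d = "case_sum c (\<lambda>k. ?a)"
      have "0 \<le> (\<Sum>i\<in>?I. \<Sum>j\<in>?I. ?d i * ?d j * K (?p i) (?p j))"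
        by (rule psd_on_nonneg[OF kernel_psd]) simp
      also have "\<dots> = (\<Sum>i=1..n. \<Sum>j=1..n. c i * c j * K (x i) (x j))
          + (\<Sum>i=1..n. \<Sum>k=1..N. c i * ?a * K (x i) (fst (Z k \<omega>)))
          + ((\<Sum>k=1..N. \<Sum>i=1..n. ?a * c i * K (fst (Z k \<omega>)) (x i))
          + (\<Sum>k=1..N. \<Sum>l=1..N. ?a * ?a * K (fst (Z k \<omega>)) (fst (Z l \<omega>))))"
        by (simp only: sum.Plus[OF finite_atLeastAtMost finite_atLeastAtMost] o_def sum.case
            sum.distrib)
      also have "(\<Sum>k=1..N. \<Sum>i=1..n. ?a * c i * K (fst (Z k \<omega>)) (x i)) = ?cross \<omega>"
        by (subst sum.swap) (simp only: kernel_sym mult_ac)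
      finally show ?thesis
        by (simp only: S_def kx_def mult_ac)
    qed
    have int_cross: "integrable M ?cross"
      using integrable_Z[OF integrable_K] by (intro Bochner_Integration.integrable_sum) auto
    have int_V: "integrable M ?Vs"
      by (rule integrable_V_statistic[OF dominated_kx])
    have E_cross: "expectation ?cross = c 0 * L"
    proof -
      have "expectation ?cross = (\<Sum>i=1..n. expectation (\<lambda>\<omega>. \<Sum>k=1..N. c i * ?a * K (x i) (fst (Z k \<omega>))))"
        using integrable_Z[OF integrable_K]
        by (intro Bochner_Integration.integral_sum Bochner_Integration.integrable_sum) auto
      also have "\<dots> = (\<Sum>i=1..n. \<Sum>k=1..N. expectation (\<lambda>\<omega>. c i * ?a * K (x i) (fst (Z k \<omega>))))"
        using integrable_Z[OF integrable_K]
        by (intro sum.cong refl Bochner_Integration.integral_sum) auto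
      also have "\<dots> = (\<Sum>i=1..n. \<Sum>k=1..N. c i * ?a * mK (x i))"
        using expectation_Z[OF borel_measurable_integrable[OF integrable_K]]
        by (intro sum.cong refl) (auto simp: mK_def)
      also have "\<dots> = c 0 * L"
        using N unfolding L_def sum_distrib_left by (intro sum.cong refl) simp
      finally show ?thesis .
    qed
    have E_V: "expectation ?Vs = V / real N + \<theta>K * (c 0)\<^sup>2"
      using N by (subst expectation_V_statistic[OF dominated_kx])
        (simp add: kernel_double_mean_kx V_def power2_eq_square)
    have "0 \<le> expectation (\<lambda>\<omega>. S + 2 * ?cross \<omega> + ?Vs \<omega>)"
      by (intro integral_nonneg_AE AE_I2 nonneg)
    also have "\<dots> = S + 2 * expectation ?cross + expectation ?Vs"
      using int_cross int_V
      by (simp only: Bochner_Integration.integral_add Bochner_Integration.integrable_add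
          integrable_mult_right integral_mult_right_zero integrable_const lebesgue_integral_const
          prob_space scaleR_one)
    finally show ?thesis
      unfolding E_cross E_V by simp
  qed
  have "(\<lambda>N. S + 2 * c 0 * L + \<theta>K * (c 0)\<^sup>2 + V / real N) \<longlonglongrightarrow> S + 2 * c 0 * L + \<theta>K * (c 0)\<^sup>2 + 0"
    by (intro tendsto_add tendsto_const tendsto_divide_0[OF tendsto_const]
        filterlim_at_top_imp_at_infinity filterlim_real_sequentially)
  then have "0 \<le> S + 2 * c 0 * L + \<theta>K * (c 0)\<^sup>2 + 0"
    by (rule LIMSEQ_le_const) (use key in \<open>auto intro!: exI[of _ 1]\<close>)
  also have "\<dots> = (\<Sum>i\<in>{0..n}. \<Sum>j\<in>{0..n}. ghost_gram x i j * (c i * c j))"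
    unfolding ghost_gram_double_sum S_def L_def
    by (simp add: sum_distrib_left power2_eq_square mult_ac)
  finally show "0 \<le> (\<Sum>i\<in>{0..n}. \<Sum>j\<in>{0..n}. c i * c j * ghost_gram x i j)"
    by (simp only: mult_ac)
qed

end

section \<open>Expansion of the statistic around the population mean\<close>

text \<open>
  The algebra behind the linearisation: the terms in \<open>b\<close> that are linear cancel, and those in \<open>a\<close> and
  \<open>c\<close> combine to \<open>2 \<langle>m, a - c\<rangle>\<close>.
\<close>

lemma gram_form_expand_at_mean:
  assumes "psd_on I G"
  shows "gram_form I G a a + gram_form I G b b - 2 * gram_form I G c b
    = gram_form I G (\<lambda>i. a i - m i) (\<lambda>i. a i - m i) + gram_form I G (\<lambda>i. b i - m i) (\<lambda>i. b i - m i)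
      - 2 * gram_form I G (\<lambda>i. c i - m i) (\<lambda>i. b i - m i) + 2 * gram_form I G m (\<lambda>i. a i - c i)"
  using gram_form_commute[OF assms, of a m] gram_form_commute[OF assms, of b m]
    gram_form_commute[OF assms, of c m]
  by (simp add: gram_form_bilinear)

definition empirical_sd :: "nat \<Rightarrow> (nat \<Rightarrow> real) \<Rightarrow> real" where
  "empirical_sd n f = sqrt (1 / real n * (\<Sum>i=1..n. (f i - 1 / real n * (\<Sum>j=1..n. f j))\<^sup>2))"

lemma sum_square_deviation:
  assumes "0 < n"
  shows "1 / real n * (\<Sum>i=1..n. (f i - 1 / real n * (\<Sum>j=1..n. f j))\<^sup>2)
    = 1 / real n * (\<Sum>i=1..n. (f i)\<^sup>2) - (1 / real n * (\<Sum>i=1..n. f i))\<^sup>2"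
proof -
  define m where "m = 1 / real n * (\<Sum>i=1..n. f i)"
  have m: "(\<Sum>i=1..n. f i) = real n * m"
    using assms by (simp add: m_def)
  have "(\<Sum>i=1..n. (f i - m)\<^sup>2) = (\<Sum>i=1..n. (f i)\<^sup>2) - 2 * m * (\<Sum>i=1..n. f i) + real n * m\<^sup>2"
    by (simp add: power2_diff sum.distrib sum_subtractf sum_distrib_left mult_ac)
  also have "\<dots> = (\<Sum>i=1..n. (f i)\<^sup>2) - real n * m\<^sup>2"
    unfolding m by (simp add: power2_eq_square)
  finally show ?thesis
    unfolding m_def[symmetric] using assms by (simp add: right_diff_distrib)
qed

lemma empirical_sd_L2_set:
  "empirical_sd n f = sqrt (1 / real n) * L2_set (\<lambda>i. f i - 1 / real n * (\<Sum>j=1..n. f j)) {1..n}"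
  unfolding empirical_sd_def L2_set_def by (simp only: real_sqrt_mult)

lemma empirical_sd_triangle: "empirical_sd n (\<lambda>i. f i + g i) \<le> empirical_sd n f + empirical_sd n g"
proof -
  have "L2_set (\<lambda>i. f i + g i - 1 / real n * (\<Sum>j=1..n. f j + g j)) {1..n}
      = L2_set (\<lambda>i. (f i - 1 / real n * (\<Sum>j=1..n. f j)) + (g i - 1 / real n * (\<Sum>j=1..n. g j))) {1..n}"
    by (simp add: sum.distrib algebra_simps)
  also have "\<dots> \<le> L2_set (\<lambda>i. f i - 1 / real n * (\<Sum>j=1..n. f j)) {1..n}
      + L2_set (\<lambda>i. g i - 1 / real n * (\<Sum>j=1..n. g j)) {1..n}"
    by (rule L2_set_triangle_ineq)
  finally show ?thesis
    unfolding empirical_sd_L2_set distrib_left[symmetric] by (rule mult_left_mono) simp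
qed

lemma empirical_sd_le:
  assumes "0 < n"
  shows "empirical_sd n f \<le> sqrt (1 / real n * (\<Sum>i=1..n. (f i)\<^sup>2))"
  unfolding empirical_sd_def sum_square_deviation[OF assms] by simp

lemma empirical_sd_uminus: "empirical_sd n (\<lambda>i. - f i) = empirical_sd n f"
proof -
  have "(- f i - 1 / real n * (\<Sum>j=1..n. - f j))\<^sup>2 = (f i - 1 / real n * (\<Sum>j=1..n. f j))\<^sup>2" for i
  proof -
    have "- f i - 1 / real n * (\<Sum>j=1..n. - f j) = - (f i - 1 / real n * (\<Sum>j=1..n. f j))"
      by (simp add: sum_negf)
    then show ?thesis by (simp only: power2_minus)
  qed
  then show ?thesis
    unfolding empirical_sd_def by simp
qed

text \<open>
  The empirical standard deviation is a seminorm, bounded by the root mean square.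
\<close>

lemma empirical_sd_diff:
  assumes "0 < n"
  shows "\<bar>empirical_sd n f - empirical_sd n g\<bar> \<le> sqrt (1 / real n * (\<Sum>i=1..n. (f i - g i)\<^sup>2))"
proof -
  have "empirical_sd n f \<le> empirical_sd n g + empirical_sd n (\<lambda>i. f i - g i)"
    using empirical_sd_triangle[of n g "\<lambda>i. f i - g i"] by simp
  moreover have "empirical_sd n g \<le> empirical_sd n f + empirical_sd n (\<lambda>i. f i - g i)"
    using empirical_sd_triangle[of n f "\<lambda>i. - (f i - g i)"]
    unfolding empirical_sd_uminus by simp
  ultimately show ?thesis
    using empirical_sd_le[OF assms, of "\<lambda>i. f i - g i"] by linarith
qed

context kernel_sample
begin

definition sample_form :: "nat \<Rightarrow> 'w \<Rightarrow> (nat \<Rightarrow> 'y) \<Rightarrow> (nat \<Rightarrow> 'y) \<Rightarrow> real" where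
  "sample_form n \<omega> = gram_form {0..n} (ghost_gram (\<lambda>i. fst (Z i \<omega>)))"

text \<open>
  The coefficients of a vector: \<open>y0\<close> at the kernel mean and \<open>y i\<close> at the \<open>i\<close>-th sample point.
\<close>

definition with_ghost :: "'y \<Rightarrow> (nat \<Rightarrow> 'y) \<Rightarrow> nat \<Rightarrow> 'y" where
  "with_ghost y0 y i = (if i = 0 then y0 else y i)"

lemma sample_form_with_ghost:
  "sample_form n \<omega> (with_ghost u0 u) (with_ghost v0 v)
    = \<theta>K * (u0 \<bullet> v0) + (\<Sum>i=1..n. mK (fst (Z i \<omega>)) * (u0 \<bullet> v i))
      + (\<Sum>i=1..n. mK (fst (Z i \<omega>)) * (u i \<bullet> v0))
      + (\<Sum>i=1..n. \<Sum>j=1..n. K (fst (Z i \<omega>)) (fst (Z j \<omega>)) * (u i \<bullet> v j))"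
  unfolding sample_form_def gram_form_def ghost_gram_double_sum
  by (simp add: with_ghost_def)

lemma sample_form_sample:
  "sample_form n \<omega> (with_ghost 0 u) (with_ghost 0 v)
    = (\<Sum>i=1..n. \<Sum>j=1..n. K (fst (Z i \<omega>)) (fst (Z j \<omega>)) * (u i \<bullet> v j))"
  by (simp add: sample_form_with_ghost)

lemma sample_form_square_with_ghost:
  "sample_form n \<omega> (with_ghost (- u0) u) (with_ghost (- u0) u)
    = (\<Sum>i=1..n. \<Sum>j=1..n. K (fst (Z i \<omega>)) (fst (Z j \<omega>)) * (u i \<bullet> u j))
      - 2 * (\<Sum>i=1..n. mK (fst (Z i \<omega>)) * (u i \<bullet> u0)) + \<theta>K * (u0 \<bullet> u0)"
  by (simp add: sample_form_with_ghost inner_commute sum_negf)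

text \<open>
  The vector is \<open>\<Sum>\<^sub>i a\<^sub>i T\<^sub>i - \<mu>\<close> with \<open>T\<^sub>i = Y\<^sub>i \<otimes> K (X\<^sub>i, \<cdot>)\<close>.
\<close>

lemma sample_form_centered_kxy:
  "sample_form n \<omega> (with_ghost (- mY) (\<lambda>i. a i *\<^sub>R snd (Z i \<omega>))) (with_ghost (- mY) (\<lambda>i. a i *\<^sub>R snd (Z i \<omega>)))
    = centered_V kxy a n \<omega>"
  unfolding sample_form_square_with_ghost centered_V_def kernel_mean_kxy kernel_double_mean_kxy kxy_def
  by (simp add: mult_ac)

text \<open>
  The vector is \<open>mY \<otimes> (\<Sum>\<^sub>i a\<^sub>i K (X\<^sub>i, \<cdot>) - E K (X, \<cdot>))\<close>.
\<close>

lemma sample_form_centered_kx: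
  "sample_form n \<omega> (with_ghost (- mY) (\<lambda>i. a i *\<^sub>R mY)) (with_ghost (- mY) (\<lambda>i. a i *\<^sub>R mY))
    = (mY \<bullet> mY) * centered_V kx a n \<omega>"
  unfolding sample_form_square_with_ghost centered_V_def kernel_mean_kx kernel_double_mean_kx kx_def
  by (simp add: sum_distrib_left right_diff_distrib distrib_left mult_ac)

definition Y_mean :: "nat \<Rightarrow> 'w \<Rightarrow> 'y" where
  "Y_mean n \<omega> = (1 / real n) *\<^sub>R (\<Sum>i=1..n. snd (Z i \<omega>))"

lemma norm_square_Y_mean_deviation:
  "(Y_mean n \<omega> - mY) \<bullet> (Y_mean n \<omega> - mY) = centered_V ky (\<lambda>_. 1 / real n) n \<omega>"
proof -
  let ?a = "1 / real n"
  have e: "Y_mean n \<omega> = (\<Sum>i=1..n. ?a *\<^sub>R snd (Z i \<omega>))"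
    by (simp only: Y_mean_def scaleR_sum_right)
  have "Y_mean n \<omega> \<bullet> Y_mean n \<omega> = (\<Sum>i=1..n. \<Sum>j=1..n. ?a * ?a * ky (Z i \<omega>) (Z j \<omega>))"
    unfolding e inner_sum_left unfolding inner_sum_right ky_def by simp
  moreover have "Y_mean n \<omega> \<bullet> mY = (\<Sum>i=1..n. ?a * kernel_mean ky (Z i \<omega>))"
    unfolding e inner_sum_left kernel_mean_ky by simp
  ultimately show ?thesis
    unfolding centered_V_def kernel_double_mean_ky
    by (simp only: inner_diff_left inner_diff_right inner_commute[of mY "Y_mean n \<omega>"])
qed

text \<open>
  An upper bound of \<open>|A - \<mu>|\<^sup>2 + 2 |B - \<mu>|\<^sup>2 + |C - \<mu>|\<^sup>2\<close> by centred V-statistics.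
\<close>

definition remainder_bound :: "(nat \<Rightarrow> real) \<Rightarrow> nat \<Rightarrow> 'w \<Rightarrow> real" where
  "remainder_bound w n \<omega> = centered_V kxy (\<lambda>_. 1 / real n) n \<omega>
    + 4 * \<kappa> * centered_V ky (\<lambda>_. 1 / real n) n \<omega>
    + 4 * (mY \<bullet> mY) * centered_V kx (\<lambda>_. 1 / real n) n \<omega>
    + centered_V kxy (\<lambda>i. w i / real n) n \<omega>"

text \<open>
  Bounds \<open>|B - \<mu>|\<^sup>2\<close> by splitting \<open>B - \<mu>\<close> into the error of the mean of the \<open>Y\<^sub>i\<close>, tensored with a
  bounded vector, and \<open>mY\<close> tensored with the error of the mean of the \<open>K (X\<^sub>i, \<cdot>)\<close>.
\<close>

lemma product_mean_deviation:
  assumes n: "0 < n"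
  shows "sample_form n \<omega> (with_ghost (- mY) (\<lambda>_. (1 / real n) *\<^sub>R Y_mean n \<omega>))
      (with_ghost (- mY) (\<lambda>_. (1 / real n) *\<^sub>R Y_mean n \<omega>))
    \<le> 2 * \<kappa> * centered_V ky (\<lambda>_. 1 / real n) n \<omega>
      + 2 * (mY \<bullet> mY) * centered_V kx (\<lambda>_. 1 / real n) n \<omega>"
proof -
  let ?d = "Y_mean n \<omega> - mY"
  let ?v1 = "with_ghost 0 (\<lambda>_. (1 / real n) *\<^sub>R ?d)"
  let ?v2 = "with_ghost (- mY) (\<lambda>_. (1 / real n) *\<^sub>R mY)"
  have split: "with_ghost (- mY) (\<lambda>_. (1 / real n) *\<^sub>R Y_mean n \<omega>) = (\<lambda>i. ?v1 i + ?v2 i)"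
    by (simp add: with_ghost_def fun_eq_iff scaleR_diff_right)
  have "sample_form n \<omega> ?v1 ?v1 \<le> \<kappa> * centered_V ky (\<lambda>_. 1 / real n) n \<omega>"
  proof -
    have "sample_form n \<omega> ?v1 ?v1
        = (\<Sum>i=1..n. \<Sum>j=1..n. K (fst (Z i \<omega>)) (fst (Z j \<omega>)) * ((?d \<bullet> ?d) / (real n * real n)))"
      unfolding sample_form_sample by simp
    also have "\<dots> \<le> (\<Sum>i=1..n. \<Sum>j=1..n. \<kappa> * ((?d \<bullet> ?d) / (real n * real n)))"
      by (intro sum_mono mult_right_mono K_le divide_nonneg_nonneg) auto
    also have "\<dots> = \<kappa> * (?d \<bullet> ?d)"
      using n by simp
    finally show ?thesis
      by (simp only: norm_square_Y_mean_deviation)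
  qed
  moreover have "sample_form n \<omega> ?v2 ?v2 = (mY \<bullet> mY) * centered_V kx (\<lambda>_. 1 / real n) n \<omega>"
    by (rule sample_form_centered_kx)
  ultimately show ?thesis
    unfolding split
    using gram_form_add_square_le[OF _ ghost_gram_psd, of n "\<lambda>i. fst (Z i \<omega>)" ?v1 ?v2]
    by (simp only: sample_form_def) simp
qed

text \<open>
  In the expansion around \<open>\<mu>\<close> the inner product \<open>\<langle>\<mu>, T\<^sub>i\<rangle>\<close> is \<open>kernel_mean kxy (Z i \<omega>)\<close>, so the linear
  term is the sum on the left; the cross term is absorbed in the squares.
\<close>

lemma K_hat_approximation:
  assumes n: "0 < n"
  shows "\<bar>K_hat K w n (\<lambda>i. fst (Z i \<omega>)) (\<lambda>i. snd (Z i \<omega>))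
      - 2 / real n * (\<Sum>i=1..n. (1 - w i) * kernel_mean kxy (Z i \<omega>))\<bar> \<le> remainder_bound w n \<omega>"
proof -
  let ?x = "\<lambda>i. fst (Z i \<omega>)" and ?y = "\<lambda>i. snd (Z i \<omega>)"
  let ?f = "sample_form n \<omega>"
  let ?A = "with_ghost 0 (\<lambda>i. (1 / real n) *\<^sub>R ?y i)"
  let ?B = "with_ghost 0 (\<lambda>i. (1 / real n) *\<^sub>R Y_mean n \<omega>)"
  let ?C = "with_ghost 0 (\<lambda>i. (w i / real n) *\<^sub>R ?y i)"
  let ?m = "with_ghost mY (\<lambda>_. 0)"
  let ?U = "\<lambda>i. ?A i - ?m i" and ?V = "\<lambda>i. ?B i - ?m i" and ?W = "\<lambda>i. ?C i - ?m i"
  have AA: "1 / real n ^ 2 * (\<Sum>i=1..n. \<Sum>j=1..n. (?y i \<bullet> ?y j) * K (?x i) (?x j)) = ?f ?A ?A"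
    unfolding sample_form_sample by (simp add: sum_distrib_left power2_eq_square mult_ac)
  have BB: "1 / real n ^ 4 * (\<Sum>i=1..n. \<Sum>j=1..n. \<Sum>q=1..n. \<Sum>r=1..n. (?y q \<bullet> ?y r) * K (?x i) (?x j))
      = ?f ?B ?B"
  proof -
    have "Y_mean n \<omega> \<bullet> Y_mean n \<omega> = 1 / (real n * real n) * (\<Sum>q=1..n. \<Sum>r=1..n. ?y q \<bullet> ?y r)"
      unfolding Y_mean_def inner_scaleR_left inner_scaleR_right inner_sum_left
      unfolding inner_sum_right by simp
    then show ?thesis
      unfolding sample_form_sample
      by (simp add: power4_eq_xxxx sum_distrib_left sum_distrib_right mult_ac)
  qed
  have CB: "1 / real n ^ 3 * (\<Sum>i=1..n. \<Sum>j=1..n. \<Sum>q=1..n. w i * (?y i \<bullet> ?y q) * K (?x i) (?x j))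
      = ?f ?C ?B"
  proof -
    have "?y i \<bullet> Y_mean n \<omega> = 1 / real n * (\<Sum>q=1..n. ?y i \<bullet> ?y q)" for i
      by (simp add: Y_mean_def inner_sum_right)
    then show ?thesis
      unfolding sample_form_sample
      by (simp add: power3_eq_cube sum_distrib_left sum_distrib_right mult_ac)
  qed
  have "K_hat K w n ?x ?y = ?f ?A ?A + ?f ?B ?B - 2 * ?f ?C ?B"
    unfolding K_hat_def AA BB CB[symmetric] by simp
  also have "\<dots> = ?f ?U ?U + ?f ?V ?V - 2 * ?f ?W ?V + 2 * ?f ?m (\<lambda>i. ?A i - ?C i)"
    unfolding sample_form_def by (rule gram_form_expand_at_mean[OF ghost_gram_psd])
  finally have expand: "K_hat K w n ?x ?y
      = ?f ?U ?U + ?f ?V ?V - 2 * ?f ?W ?V + 2 * ?f ?m (\<lambda>i. ?A i - ?C i)" .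
  have lin: "?f ?m (\<lambda>i. ?A i - ?C i) = 1 / real n * (\<Sum>i=1..n. (1 - w i) * kernel_mean kxy (Z i \<omega>))"
  proof -
    have "(\<lambda>i. ?A i - ?C i) = with_ghost 0 (\<lambda>i. ((1 - w i) / real n) *\<^sub>R ?y i)"
      by (simp add: with_ghost_def fun_eq_iff scaleR_diff_left diff_divide_distrib)
    then have "?f ?m (\<lambda>i. ?A i - ?C i)
        = (\<Sum>i=1..n. mK (?x i) * (mY \<bullet> (((1 - w i) / real n) *\<^sub>R ?y i)))"
      by (simp only: sample_form_with_ghost) simp
    also have "\<dots> = 1 / real n * (\<Sum>i=1..n. (1 - w i) * kernel_mean kxy (Z i \<omega>))"
      unfolding sum_distrib_left kernel_mean_kxy
      by (intro sum.cong refl) (simp add: inner_commute mult_ac)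
    finally show ?thesis .
  qed
  have U: "?U = with_ghost (- mY) (\<lambda>i. (1 / real n) *\<^sub>R ?y i)"
    and V: "?V = with_ghost (- mY) (\<lambda>_. (1 / real n) *\<^sub>R Y_mean n \<omega>)"
    and W: "?W = with_ghost (- mY) (\<lambda>i. (w i / real n) *\<^sub>R ?y i)"
    by (simp_all add: with_ghost_def fun_eq_iff)
  have UU: "?f ?U ?U = centered_V kxy (\<lambda>_. 1 / real n) n \<omega>"
    unfolding U by (rule sample_form_centered_kxy)
  have WW: "?f ?W ?W = centered_V kxy (\<lambda>i. w i / real n) n \<omega>"
    unfolding W by (rule sample_form_centered_kxy)
  have VV: "?f ?V ?V \<le> 2 * \<kappa> * centered_V ky (\<lambda>_. 1 / real n) n \<omega>
      + 2 * (mY \<bullet> mY) * centered_V kx (\<lambda>_. 1 / real n) n \<omega>"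
    unfolding V by (rule product_mean_deviation[OF n])
  have nonneg: "0 \<le> ?f ?U ?U" "0 \<le> ?f ?V ?V"
    unfolding sample_form_def by (rule gram_form_nonneg[OF _ ghost_gram_psd], simp)+
  have cross: "2 * \<bar>?f ?W ?V\<bar> \<le> ?f ?W ?W + ?f ?V ?V"
    unfolding sample_form_def by (rule gram_form_abs_le[OF _ ghost_gram_psd]) simp
  have "K_hat K w n ?x ?y - 2 / real n * (\<Sum>i=1..n. (1 - w i) * kernel_mean kxy (Z i \<omega>))
      = ?f ?U ?U + ?f ?V ?V - 2 * ?f ?W ?V"
    unfolding expand lin by simp
  then show ?thesis
    using nonneg cross VV unfolding remainder_bound_def UU[symmetric] WW[symmetric] by linarith
qed

text \<open>
  The difference is \<open>\<langle>T\<^sub>i, A - \<mu>\<rangle>\<close>, so this is the inequality of Cauchy and Schwarz.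
\<close>

lemma kernel_row_mean_deviation:
  assumes n: "0 < n" and i: "i \<in> {1..n}"
  shows "(1 / real n * (\<Sum>j=1..n. kxy (Z i \<omega>) (Z j \<omega>)) - kernel_mean kxy (Z i \<omega>))\<^sup>2
    \<le> kxy (Z i \<omega>) (Z i \<omega>) * centered_V kxy (\<lambda>_. 1 / real n) n \<omega>"
proof -
  let ?y = "\<lambda>i. snd (Z i \<omega>)"
  let ?e = "with_ghost 0 (\<lambda>j. if j = i then ?y i else 0)"
  let ?U = "with_ghost (- mY) (\<lambda>j. (1 / real n) *\<^sub>R ?y j)"
  have if_inner: "(if j = i then ?y i else 0) \<bullet> z = (if j = i then ?y i \<bullet> z else 0)" for j z
    by simp
  have row: "sample_form n \<omega> ?e (with_ghost v0 v)
      = mK (fst (Z i \<omega>)) * (?y i \<bullet> v0) + (\<Sum>j=1..n. K (fst (Z i \<omega>)) (fst (Z j \<omega>)) * (?y i \<bullet> v j))" for v0 v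
  proof -
    have "(\<Sum>k=1..n. \<Sum>j=1..n. K (fst (Z k \<omega>)) (fst (Z j \<omega>)) * ((if k = i then ?y i else 0) \<bullet> v j))
        = (\<Sum>k=1..n. if k = i then \<Sum>j=1..n. K (fst (Z i \<omega>)) (fst (Z j \<omega>)) * (?y i \<bullet> v j) else 0)"
      by (intro sum.cong refl) auto
    also have "\<dots> = (\<Sum>j=1..n. K (fst (Z i \<omega>)) (fst (Z j \<omega>)) * (?y i \<bullet> v j))"
      using i by (subst sum.delta) auto
    finally have 1: "(\<Sum>k=1..n. \<Sum>j=1..n. K (fst (Z k \<omega>)) (fst (Z j \<omega>)) * ((if k = i then ?y i else 0) \<bullet> v j))
        = (\<Sum>j=1..n. K (fst (Z i \<omega>)) (fst (Z j \<omega>)) * (?y i \<bullet> v j))" .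
    have "(\<Sum>k=1..n. mK (fst (Z k \<omega>)) * ((if k = i then ?y i else 0) \<bullet> v0))
        = (\<Sum>k=1..n. if k = i then mK (fst (Z i \<omega>)) * (?y i \<bullet> v0) else 0)"
      by (intro sum.cong refl) auto
    also have "\<dots> = mK (fst (Z i \<omega>)) * (?y i \<bullet> v0)"
      using i by (subst sum.delta) auto
    finally show ?thesis
      unfolding sample_form_with_ghost 1 by simp
  qed
  have "sample_form n \<omega> ?e ?U = 1 / real n * (\<Sum>j=1..n. kxy (Z i \<omega>) (Z j \<omega>)) - kernel_mean kxy (Z i \<omega>)"
    unfolding row kernel_mean_kxy kxy_def by (simp add: sum_distrib_left mult_ac)
  moreover have "sample_form n \<omega> ?e ?e = kxy (Z i \<omega>) (Z i \<omega>)"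
  proof -
    have "(\<Sum>j=1..n. K (fst (Z i \<omega>)) (fst (Z j \<omega>)) * (?y i \<bullet> (if j = i then ?y i else 0)))
        = (\<Sum>j=1..n. if j = i then kxy (Z i \<omega>) (Z i \<omega>) else 0)"
      by (intro sum.cong refl) (auto simp: kxy_def)
    also have "\<dots> = kxy (Z i \<omega>) (Z i \<omega>)"
      using i by (subst sum.delta) auto
    finally show ?thesis unfolding row by simp
  qed
  ultimately show ?thesis
    using gram_form_cauchy_schwarz[OF _ ghost_gram_psd, of n "\<lambda>i. fst (Z i \<omega>)" ?e ?U]
    unfolding sample_form_def[symmetric] sample_form_centered_kxy by simp
qed

lemma alpha_hat_empirical_sd:
  "sqrt (alpha_hat_sq K n (\<lambda>i. fst (Z i \<omega>)) (\<lambda>i. snd (Z i \<omega>)))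
    = empirical_sd n (\<lambda>i. 1 / real n * (\<Sum>j=1..n. kxy (Z i \<omega>) (Z j \<omega>)))"
proof -
  have "1 / real n ^ 2 * (\<Sum>m=1..n. \<Sum>p=1..n. kxy (Z m \<omega>) (Z p \<omega>))
      = 1 / real n * (\<Sum>m=1..n. 1 / real n * (\<Sum>p=1..n. kxy (Z m \<omega>) (Z p \<omega>)))"
    unfolding sum_distrib_left[symmetric] by (simp add: power2_eq_square)
  then show ?thesis
    unfolding alpha_hat_sq_def empirical_sd_def kxy_def[symmetric] by simp
qed

lemma alpha_hat_approximation:
  assumes n: "0 < n"
  shows "\<bar>sqrt (alpha_hat_sq K n (\<lambda>i. fst (Z i \<omega>)) (\<lambda>i. snd (Z i \<omega>)))
      - empirical_sd n (\<lambda>i. kernel_mean kxy (Z i \<omega>))\<bar>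
    \<le> sqrt (centered_V kxy (\<lambda>_. 1 / real n) n \<omega> * (1 / real n * (\<Sum>i=1..n. kxy (Z i \<omega>) (Z i \<omega>))))"
proof -
  let ?g = "\<lambda>i. 1 / real n * (\<Sum>j=1..n. kxy (Z i \<omega>) (Z j \<omega>))"
  let ?U = "centered_V kxy (\<lambda>_. 1 / real n) n \<omega>"
  have "(\<Sum>i=1..n. (?g i - kernel_mean kxy (Z i \<omega>))\<^sup>2) \<le> (\<Sum>i=1..n. kxy (Z i \<omega>) (Z i \<omega>) * ?U)"
    by (intro sum_mono kernel_row_mean_deviation[OF n])
  then have "1 / real n * (\<Sum>i=1..n. (?g i - kernel_mean kxy (Z i \<omega>))\<^sup>2)
      \<le> 1 / real n * (\<Sum>i=1..n. kxy (Z i \<omega>) (Z i \<omega>) * ?U)"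
    by (intro mult_left_mono) auto
  also have "\<dots> = ?U * (1 / real n * (\<Sum>i=1..n. kxy (Z i \<omega>) (Z i \<omega>)))"
    by (simp only: sum_distrib_right[symmetric] mult_ac)
  finally show ?thesis
    unfolding alpha_hat_empirical_sd
    by (intro order_trans[OF empirical_sd_diff[OF n]] real_sqrt_le_mono)
qed

end

section \<open>Asymptotic normality of the studentized statistic\<close>

context kernel_sample
begin

lemma fst_Z_measurable: "1 \<le> i \<Longrightarrow> (\<lambda>\<omega>. fst (Z i \<omega>)) \<in> borel_measurable M"
  and snd_Z_measurable: "1 \<le> i \<Longrightarrow> (\<lambda>\<omega>. snd (Z i \<omega>)) \<in> borel_measurable M"
  by (auto intro: measurable_compose[OF Z_measurable measurable_fst_snd(1)]
      measurable_compose[OF Z_measurable measurable_fst_snd(2)])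

lemma K_hat_measurable:
  "(\<lambda>\<omega>. K_hat K w n (\<lambda>i. fst (Z i \<omega>)) (\<lambda>i. snd (Z i \<omega>))) \<in> borel_measurable M"
  unfolding K_hat_def
  by (intro borel_measurable_diff borel_measurable_add borel_measurable_times borel_measurable_const
      borel_measurable_sum borel_measurable_inner K_compose_measurable fst_Z_measurable
      snd_Z_measurable) auto

lemma alpha_hat_measurable:
  "(\<lambda>\<omega>. alpha_hat_sq K n (\<lambda>i. fst (Z i \<omega>)) (\<lambda>i. snd (Z i \<omega>))) \<in> borel_measurable M"
  unfolding alpha_hat_sq_def
  by (intro borel_measurable_diff borel_measurable_power borel_measurable_times borel_measurable_const
      borel_measurable_sum borel_measurable_inner K_compose_measurable fst_Z_measurable
      snd_Z_measurable) auto

lemma expectation_centered_V_le: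
  assumes "dominated_kernel k b"
  shows "expectation (centered_V k a n)
    \<le> \<bar>kernel_diag k - kernel_double_mean k\<bar> * (\<Sum>i=1..n. (a i)\<^sup>2) + \<bar>kernel_double_mean k\<bar> * ((\<Sum>i=1..n. a i) - 1)\<^sup>2"
  unfolding expectation_centered_V[OF assms]
  by (intro add_mono mult_right_mono sum_nonneg) auto

lemma expectation_centered_V_uniform_le:
  assumes "dominated_kernel k b" "0 < n"
  shows "expectation (centered_V k (\<lambda>_. 1 / real n) n) \<le> \<bar>kernel_diag k - kernel_double_mean k\<bar> / real n"
  using expectation_centered_V_le[OF assms(1), of "\<lambda>_. 1 / real n" n] assms(2)
  by (simp add: power2_eq_square)

lemma integrable_remainder_bound: "integrable M (remainder_bound w n)"
  unfolding remainder_bound_def[abs_def]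
  by (intro Bochner_Integration.integrable_add integrable_mult_right
      integrable_centered_V[OF dominated_kxy] integrable_centered_V[OF dominated_kx]
      integrable_centered_V[OF dominated_ky])

text \<open>
  The weights \<open>w i / n\<close> have squares that sum to at most \<open>C\<^sup>2 / n\<close>, and their sum deviates from \<open>1\<close> by
  at most \<open>\<tau> / n\<close>; the other V-statistics have uniform weights.
\<close>

lemma expectation_remainder_bound_le:
  assumes n: "0 < n" and w: "\<And>i. i \<in> {1..n} \<Longrightarrow> \<bar>w i\<bar> \<le> C"
    and sum_w: "\<bar>(\<Sum>i=1..n. w i) - real n\<bar> \<le> \<tau>"
  shows "expectation (remainder_bound w n)
    \<le> ((1 + C\<^sup>2) * \<bar>kernel_diag kxy - kernel_double_mean kxy\<bar> + 4 * \<kappa> * \<bar>kernel_diag ky - kernel_double_mean ky\<bar>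
      + 4 * (mY \<bullet> mY) * \<bar>kernel_diag kx - kernel_double_mean kx\<bar> + \<bar>kernel_double_mean kxy\<bar> * \<tau>\<^sup>2) / real n"
proof -
  let ?u = "\<lambda>_::nat. 1 / real n" and ?w = "\<lambda>i. w i / real n"
  let ?dxy = "\<bar>kernel_diag kxy - kernel_double_mean kxy\<bar>"
  let ?dy = "\<bar>kernel_diag ky - kernel_double_mean ky\<bar>"
  let ?dx = "\<bar>kernel_diag kx - kernel_double_mean kx\<bar>"
  have n1: "1 \<le> real n" using n by simp
  have sq: "(\<Sum>i=1..n. (?w i)\<^sup>2) \<le> C\<^sup>2 / real n"
  proof -
    have "(\<Sum>i=1..n. (?w i)\<^sup>2) \<le> (\<Sum>i=1..n. C\<^sup>2 / (real n)\<^sup>2)"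
    proof (rule sum_mono)
      fix i assume "i \<in> {1..n}"
      then have "\<bar>w i\<bar>\<^sup>2 \<le> C\<^sup>2"
        using w by (intro power_mono) auto
      then show "(?w i)\<^sup>2 \<le> C\<^sup>2 / (real n)\<^sup>2"
        by (simp add: power_divide divide_right_mono)
    qed
    also have "\<dots> = C\<^sup>2 / real n"
      using n by (simp add: power2_eq_square)
    finally show ?thesis .
  qed
  have dev: "((\<Sum>i=1..n. ?w i) - 1)\<^sup>2 \<le> \<tau>\<^sup>2 / real n"
  proof -
    have "(\<Sum>i=1..n. ?w i) - 1 = ((\<Sum>i=1..n. w i) - real n) / real n"
      using n by (simp add: sum_divide_distrib diff_divide_distrib)
    then have "((\<Sum>i=1..n. ?w i) - 1)\<^sup>2 = \<bar>(\<Sum>i=1..n. w i) - real n\<bar>\<^sup>2 / (real n)\<^sup>2"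
      by (simp add: power_divide)
    also have "\<dots> \<le> \<tau>\<^sup>2 / (real n)\<^sup>2"
      using sum_w by (intro divide_right_mono power_mono) auto
    also have "\<dots> \<le> \<tau>\<^sup>2 / real n"
      using n1 by (intro divide_left_mono) (auto simp: power2_eq_square)
    finally show ?thesis .
  qed
  have "expectation (centered_V kxy ?w n)
      \<le> ?dxy * (\<Sum>i=1..n. (?w i)\<^sup>2) + \<bar>kernel_double_mean kxy\<bar> * ((\<Sum>i=1..n. ?w i) - 1)\<^sup>2"
    by (rule expectation_centered_V_le[OF dominated_kxy])
  also have "\<dots> \<le> ?dxy * (C\<^sup>2 / real n) + \<bar>kernel_double_mean kxy\<bar> * (\<tau>\<^sup>2 / real n)"
    using sq dev by (intro add_mono mult_left_mono) auto
  finally have W: "expectation (centered_V kxy ?w n)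
      \<le> ?dxy * (C\<^sup>2 / real n) + \<bar>kernel_double_mean kxy\<bar> * (\<tau>\<^sup>2 / real n)" .
  have "expectation (remainder_bound w n) = expectation (centered_V kxy ?u n)
      + 4 * \<kappa> * expectation (centered_V ky ?u n) + 4 * (mY \<bullet> mY) * expectation (centered_V kx ?u n)
      + expectation (centered_V kxy ?w n)"
    unfolding remainder_bound_def[abs_def]
    using integrable_centered_V[OF dominated_kxy] integrable_centered_V[OF dominated_kx]
      integrable_centered_V[OF dominated_ky] by simp
  also have "\<dots> \<le> ?dxy / real n + 4 * \<kappa> * (?dy / real n) + 4 * (mY \<bullet> mY) * (?dx / real n)
      + (?dxy * (C\<^sup>2 / real n) + \<bar>kernel_double_mean kxy\<bar> * (\<tau>\<^sup>2 / real n))"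
    by (intro add_mono mult_left_mono W expectation_centered_V_uniform_le[OF dominated_kxy n]
        expectation_centered_V_uniform_le[OF dominated_kx n]
        expectation_centered_V_uniform_le[OF dominated_ky n]) (use \<kappa>_nonneg in auto)
  also have "\<dots> = ((1 + C\<^sup>2) * ?dxy + 4 * \<kappa> * ?dy + 4 * (mY \<bullet> mY) * ?dx
      + \<bar>kernel_double_mean kxy\<bar> * \<tau>\<^sup>2) / real n"
    using n by (simp add: field_simps)
  finally show ?thesis .
qed

text \<open>
  The function \<open>h - E h\<close> for \<open>h (x, y) = \<langle>\<mu>, y \<otimes> K (x, \<cdot>)\<rangle>\<close>. Its weighted sample sums are the
  linear part of the statistic.
\<close>

definition projection :: "'x \<times> 'y \<Rightarrow> real" where
  "projection z = kernel_mean kxy z - kernel_double_mean kxy"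

definition projection_var :: real where
  "projection_var = (\<integral>z. (projection z)\<^sup>2 \<partial>\<nu>)"

lemma projection_measurable [measurable]: "projection \<in> borel_measurable \<nu>"
  using kernel_mean_measurable[OF dominated_kxy] unfolding projection_def[abs_def] by simp

lemma projection_mean: "law.expectation projection = 0"
  using integrable_kernel_mean[OF dominated_kxy]
  by (simp add: projection_def[abs_def] kernel_double_mean_def law.prob_space)

lemma projection_square: "integrable \<nu> (\<lambda>z. (projection z)\<^sup>2)"
  and projection_var_eq: "projection_var = (\<integral>z. (kernel_mean kxy z)\<^sup>2 \<partial>\<nu>) - (kernel_double_mean kxy)\<^sup>2"
proof -
  note int = integrable_kernel_mean[OF dominated_kxy] square_integrable_kernel_mean[OF dominated_kxy]
  show "integrable \<nu> (\<lambda>z. (projection z)\<^sup>2)"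
    unfolding projection_def power2_diff using int by simp
  show "projection_var = (\<integral>z. (kernel_mean kxy z)\<^sup>2 \<partial>\<nu>) - (kernel_double_mean kxy)\<^sup>2"
    unfolding projection_var_def projection_def power2_diff using int
    by (simp add: law.prob_space kernel_double_mean_def[symmetric]) (simp add: power2_eq_square)
qed

text \<open>
  The estimator is the empirical standard deviation of the numbers \<open>\<langle>T\<^sub>i, A\<rangle>\<close>. It differs from that of
  \<open>\<langle>T\<^sub>i, \<mu>\<rangle>\<close> by at most \<open>|A - \<mu>|\<close> times a tight factor, and the latter converges by the law of large
  numbers for \<open>h\<close> and \<open>h\<^sup>2\<close>.
\<close>

lemma alpha_hat_consistent:
  "tendsto_prob (\<lambda>n \<omega>. sqrt (alpha_hat_sq K n (\<lambda>i. fst (Z i \<omega>)) (\<lambda>i. snd (Z i \<omega>)))) (sqrt projection_var)"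
proof -
  let ?h = "kernel_mean kxy"
  let ?\<alpha> = "\<lambda>n \<omega>. sqrt (alpha_hat_sq K n (\<lambda>i. fst (Z i \<omega>)) (\<lambda>i. snd (Z i \<omega>)))"
  let ?sd = "\<lambda>n \<omega>. empirical_sd n (\<lambda>i. ?h (Z i \<omega>))"
  let ?U = "\<lambda>n. centered_V kxy (\<lambda>_. 1 / real n) n"
  let ?B = "\<lambda>n \<omega>. 1 / real n * (\<Sum>i=1..n. kxy (Z i \<omega>) (Z i \<omega>))"
  let ?m2 = "\<lambda>n \<omega>. 1 / real n * (\<Sum>i=1..n. (?h (Z i \<omega>))\<^sup>2)"
  let ?m1 = "\<lambda>n \<omega>. 1 / real n * (\<Sum>i=1..n. ?h (Z i \<omega>))"
  have h_meas: "?h \<in> borel_measurable \<nu>"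
    by (rule kernel_mean_measurable[OF dominated_kxy])
  have sqrt_meas: "sqrt \<in> borel_measurable borel"
    by measurable
  have m1: "tendsto_prob ?m1 (kernel_double_mean kxy)"
    using weak_law_of_large_numbers[OF integrable_kernel_mean[OF dominated_kxy]]
    by (simp only: kernel_double_mean_def)
  have m2: "tendsto_prob ?m2 (\<integral>z. (?h z)\<^sup>2 \<partial>\<nu>)"
    using weak_law_of_large_numbers[OF square_integrable_kernel_mean[OF dominated_kxy]] .
  have "tendsto_prob (\<lambda>n \<omega>. (?m1 n \<omega>)\<^sup>2) ((kernel_double_mean kxy)\<^sup>2)"
    by (rule tendsto_prob_continuous[OF m1, of "\<lambda>x. x\<^sup>2"]) simp_all
  then have "tendsto_prob (\<lambda>n \<omega>. ?m2 n \<omega> - (?m1 n \<omega>)\<^sup>2) projection_var"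
    unfolding projection_var_eq by (rule tendsto_prob_diff[OF m2])
  then have s1: "tendsto_prob (\<lambda>n \<omega>. sqrt (?m2 n \<omega> - (?m1 n \<omega>)\<^sup>2)) (sqrt projection_var)"
    by (rule tendsto_prob_continuous[OF _ _ sqrt_meas]) (rule isCont_real_sqrt)
  have B_int: "integrable M (?B n)" for n
    by (intro integrable_mult_right Bochner_Integration.integrable_sum integrable_kernel[OF dominated_kxy])
      auto
  have B_nonneg: "0 \<le> ?B n \<omega>" for n \<omega>
    unfolding kxy_def by (intro mult_nonneg_nonneg sum_nonneg) (auto intro: kernel_diag_nonneg)
  have B_E: "expectation (?B n) \<le> kernel_diag kxy" if "0 < n" for n
  proof -
    have "expectation (\<lambda>\<omega>. \<Sum>i=1..n. kxy (Z i \<omega>) (Z i \<omega>)) = (\<Sum>i=1..n. kernel_diag kxy)"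
      by (subst Bochner_Integration.integral_sum)
        (auto intro!: sum.cong integrable_kernel[OF dominated_kxy]
          simp: expectation_kernel[OF dominated_kxy])
    then show ?thesis using that by simp
  qed
  have U: "tendsto_prob ?U 0"
  proof (rule tendsto_prob_of_expectation)
    show "random_variable borel (?U n)" for n
      by (rule borel_measurable_integrable[OF integrable_centered_V[OF dominated_kxy]])
    show "integrable M (?U n)" for n
      by (rule integrable_centered_V[OF dominated_kxy])
    have "0 \<le> ?U n \<omega>" for n \<omega>
      unfolding sample_form_centered_kxy[symmetric] sample_form_def
      by (rule gram_form_nonneg[OF _ ghost_gram_psd]) simp
    then show "\<bar>?U n \<omega> - 0\<bar> \<le> ?U n \<omega>" for n \<omega>
      by simp
    show "0 < n \<Longrightarrow> expectation (?U n) \<le> \<bar>kernel_diag kxy - kernel_double_mean kxy\<bar> / real n" for n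
      by (rule expectation_centered_V_uniform_le[OF dominated_kxy])
    show "(\<lambda>n. \<bar>kernel_diag kxy - kernel_double_mean kxy\<bar> / real n) \<longlonglongrightarrow> 0"
      by (intro tendsto_divide_0[OF tendsto_const] filterlim_at_top_imp_at_infinity
          filterlim_real_sequentially)
  qed
  have "tendsto_prob (\<lambda>n \<omega>. ?U n \<omega> * ?B n \<omega>) 0"
  proof (rule tendsto_prob_mult_bounded[OF U _ B_int _ B_E])
    show "random_variable borel (?B n)" for n
      by (rule borel_measurable_integrable[OF B_int])
    show "\<bar>?B n \<omega>\<bar> \<le> ?B n \<omega>" for n \<omega>
      by (simp only: abs_of_nonneg[OF B_nonneg] order_refl)
  qed
  then have s2: "tendsto_prob (\<lambda>n \<omega>. sqrt (?U n \<omega> * ?B n \<omega>)) (sqrt 0)"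
    by (rule tendsto_prob_continuous[OF _ _ sqrt_meas]) (rule isCont_real_sqrt)
  have \<alpha>_meas: "random_variable borel (?\<alpha> n)" for n
    by (rule measurable_compose[OF alpha_hat_measurable sqrt_meas])
  have "tendsto_prob (\<lambda>n \<omega>. ?\<alpha> n \<omega> - sqrt (?m2 n \<omega> - (?m1 n \<omega>)\<^sup>2)) 0"
  proof (rule tendsto_prob_squeeze[where Y = "\<lambda>n \<omega>. sqrt (?U n \<omega> * ?B n \<omega>)"])
    show "random_variable borel (\<lambda>\<omega>. ?\<alpha> n \<omega> - sqrt (?m2 n \<omega> - (?m1 n \<omega>)\<^sup>2))" for n
      by (intro borel_measurable_diff \<alpha>_meas tendsto_prob_measurable[OF s1])
    show "tendsto_prob (\<lambda>n \<omega>. sqrt (?U n \<omega> * ?B n \<omega>)) 0"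
      using s2 by (simp only: real_sqrt_zero)
    fix n :: nat and \<omega> assume n: "0 < n"
    have "sqrt (?m2 n \<omega> - (?m1 n \<omega>)\<^sup>2) = ?sd n \<omega>"
      unfolding empirical_sd_def sum_square_deviation[OF n] ..
    then show "\<bar>?\<alpha> n \<omega> - sqrt (?m2 n \<omega> - (?m1 n \<omega>)\<^sup>2) - 0\<bar> \<le> \<bar>sqrt (?U n \<omega> * ?B n \<omega>)\<bar>"
      using alpha_hat_approximation[OF n, of \<omega>] by (simp only: diff_0_right)
  qed
  from tendsto_prob_add[OF this s1] show ?thesis
    by simp
qed

text \<open>
  With \<open>N = sqrt n K_hat\<close>, its linear part \<open>L\<close>, the estimated standard deviation \<open>S\<close> and its limit
  \<open>c\<close>, the claim follows from \<open>N / S - L / c = (1 / S - 1 / c) N + (N - L) / c\<close>: both terms vanish in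
  probability, because \<open>N\<close> is bounded in \<open>L\<^sup>1\<close> and \<open>N - L\<close> tends to \<open>0\<close> in \<open>L\<^sup>1\<close>, while \<open>L / c\<close> is
  asymptotically standard normal.
\<close>

theorem studentized_K_hat_normal:
  fixes w :: "nat \<Rightarrow> nat \<Rightarrow> real" and w2 :: real
  assumes w_bound: "\<And>n i. i \<in> {1..n} \<Longrightarrow> \<bar>w i n\<bar> \<le> C"
    and w_mean: "\<And>n. 0 < n \<Longrightarrow> \<bar>(\<Sum>i=1..n. w i n) - real n\<bar> \<le> \<tau>"
    and w_square: "(\<lambda>n. 1 / real n * (\<Sum>i=1..n. (w i n)\<^sup>2)) \<longlonglongrightarrow> w2" and w2: "1 < w2"
    and nondegenerate: "0 < projection_var"
  shows "weak_conv_m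
      (\<lambda>n. distr M borel (\<lambda>\<omega>.
         sqrt (real n) * (K_hat K (\<lambda>i. w i n) n (\<lambda>i. fst (Z i \<omega>)) (\<lambda>i. snd (Z i \<omega>))
           / sigma_hat K w2 n (\<lambda>i. fst (Z i \<omega>)) (\<lambda>i. snd (Z i \<omega>)))))
      std_normal_distribution"
proof -
  define c where "c = sqrt (4 * (w2 - 1)) * sqrt projection_var"
  have c: "0 < c" using w2 nondegenerate by (simp add: c_def)
  have c2: "c\<^sup>2 = 4 * (w2 - 1) * projection_var"
    using w2 nondegenerate by (simp add: c_def power_mult_distrib)
  define a where "a n i = 2 * (1 - w i n) / sqrt (real n)" for n i
  define N where "N n \<omega> = sqrt (real n) * K_hat K (\<lambda>i. w i n) n (\<lambda>i. fst (Z i \<omega>)) (\<lambda>i. snd (Z i \<omega>))" for n \<omega>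
  define L where "L n \<omega> = (\<Sum>i=1..n. a n i * projection (Z i \<omega>))" for n \<omega>
  define S where "S n \<omega> = sigma_hat K w2 n (\<lambda>i. fst (Z i \<omega>)) (\<lambda>i. snd (Z i \<omega>))" for n \<omega>
  define D where "D = (1 + C\<^sup>2) * \<bar>kernel_diag kxy - kernel_double_mean kxy\<bar> + 4 * \<kappa> * \<bar>kernel_diag ky - kernel_double_mean ky\<bar>
      + 4 * (mY \<bullet> mY) * \<bar>kernel_diag kx - kernel_double_mean kx\<bar> + \<bar>kernel_double_mean kxy\<bar> * \<tau>\<^sup>2 + 2 * \<bar>kernel_double_mean kxy\<bar> * \<tau>"
  \<comment> \<open>dominates N - L; the second summand comes from centring h under weights that do not sum to n\<close>
  define Q where "Q n \<omega> = sqrt (real n) * remainder_bound (\<lambda>i. w i n) n \<omega>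
      + 2 * \<bar>kernel_double_mean kxy\<bar> * \<tau> / sqrt (real n)" for n \<omega>
  have C: "0 \<le> C" using w_bound[of 1 1] by (simp add: order_trans[OF abs_ge_zero])
  have D: "0 \<le> D"
    unfolding D_def using \<kappa>_nonneg w_mean[of 1]
    by (intro add_nonneg_nonneg mult_nonneg_nonneg) auto
  have sqrt_n: "sqrt (real n) * sqrt (real n) = real n" for n
    by simp
  have N_meas: "random_variable borel (N n)" for n
    unfolding N_def[abs_def] by (intro borel_measurable_times borel_measurable_const K_hat_measurable)
  have L_meas: "random_variable borel (L n)" for n
    unfolding L_def[abs_def] by (rule sum_Z_measurable) measurable
  have S_eq: "S n \<omega> = sqrt (4 * (w2 - 1)) * sqrt (alpha_hat_sq K n (\<lambda>i. fst (Z i \<omega>)) (\<lambda>i. snd (Z i \<omega>)))" for n \<omega>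
    unfolding S_def sigma_hat_def by (rule real_sqrt_mult)
  have S_meas: "random_variable borel (S n)" for n
    unfolding S_eq[abs_def] by (intro borel_measurable_times borel_measurable_const
        measurable_compose[OF alpha_hat_measurable borel_measurable_sqrt])
  have Q_int: "integrable M (Q n)" for n
    unfolding Q_def[abs_def]
    by (intro Bochner_Integration.integrable_add integrable_mult_right integrable_remainder_bound) auto
  have Q_E: "expectation (Q n) \<le> D / sqrt (real n)" if n: "0 < n" for n
  proof -
    have "expectation (Q n) = sqrt (real n) * expectation (remainder_bound (\<lambda>i. w i n) n)
        + 2 * \<bar>kernel_double_mean kxy\<bar> * \<tau> / sqrt (real n)"
      unfolding Q_def[abs_def] using integrable_remainder_bound by (simp add: prob_space)
    also have "\<dots> \<le> sqrt (real n) * ((D - 2 * \<bar>kernel_double_mean kxy\<bar> * \<tau>) / real n)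
        + 2 * \<bar>kernel_double_mean kxy\<bar> * \<tau> / sqrt (real n)"
      using expectation_remainder_bound_le[OF n w_bound w_mean[OF n]]
      by (intro add_right_mono mult_left_mono) (auto simp: D_def)
    also have "\<dots> = D / sqrt (real n)"
      using n sqrt_n[of n] by (simp add: field_simps)
    finally show ?thesis .
  qed
  have close: "\<bar>N n \<omega> - L n \<omega>\<bar> \<le> Q n \<omega>" if n: "0 < n" for n \<omega>
  proof -
    let ?s = "\<Sum>i=1..n. (1 - w i n) * kernel_mean kxy (Z i \<omega>)"
    let ?t = "\<Sum>i=1..n. 1 - w i n"
    let ?R = "K_hat K (\<lambda>i. w i n) n (\<lambda>i. fst (Z i \<omega>)) (\<lambda>i. snd (Z i \<omega>)) - 2 / real n * ?s"
    have "L n \<omega> = (\<Sum>i=1..n. 2 / sqrt (real n) *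
        ((1 - w i n) * kernel_mean kxy (Z i \<omega>) - kernel_double_mean kxy * (1 - w i n)))"
      unfolding L_def a_def projection_def
      by (intro sum.cong refl) (simp add: algebra_simps add_divide_distrib diff_divide_distrib)
    also have "\<dots> = 2 / sqrt (real n) * (?s - kernel_double_mean kxy * ?t)"
      unfolding sum_distrib_left[symmetric] sum_subtractf ..
    finally have "L n \<omega> = 2 / sqrt (real n) * (?s - kernel_double_mean kxy * ?t)" .
    moreover have "sqrt (real n) * (2 / real n * ?s) = 2 / sqrt (real n) * ?s"
      using n sqrt_n[of n] by (simp add: field_simps)
    ultimately have "N n \<omega> - L n \<omega> = sqrt (real n) * ?R + 2 * kernel_double_mean kxy * ?t / sqrt (real n)"
      unfolding N_def right_diff_distrib by simp
    then have "\<bar>N n \<omega> - L n \<omega>\<bar> \<le> \<bar>sqrt (real n) * ?R\<bar> + \<bar>2 * kernel_double_mean kxy * ?t / sqrt (real n)\<bar>"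
      by (simp only: abs_triangle_ineq)
    also have "\<bar>sqrt (real n) * ?R\<bar> = sqrt (real n) * \<bar>?R\<bar>"
      by (simp add: abs_mult)
    also have "\<dots> \<le> sqrt (real n) * remainder_bound (\<lambda>i. w i n) n \<omega>"
      by (intro mult_left_mono K_hat_approximation[OF n]) simp
    also have "\<bar>2 * kernel_double_mean kxy * ?t / sqrt (real n)\<bar> = 2 * \<bar>kernel_double_mean kxy\<bar> * \<bar>?t\<bar> / sqrt (real n)"
      by (simp add: abs_mult)
    also have "\<dots> \<le> 2 * \<bar>kernel_double_mean kxy\<bar> * \<tau> / sqrt (real n)"
      using w_mean[OF n] by (intro divide_right_mono mult_left_mono) (auto simp: sum_subtractf)
    finally show ?thesis unfolding Q_def by simp
  qed
  have a_square: "(a n i)\<^sup>2 = 4 * (1 - w i n)\<^sup>2 / real n" for n i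
    unfolding a_def power_divide power_mult_distrib by simp
  have a_bound: "\<bar>a n i\<bar> \<le> 2 * (1 + C) / sqrt (real n)" if "i \<in> {1..n}" for n i
  proof -
    have "\<bar>1 - w i n\<bar> \<le> 1 + C"
      using w_bound[OF that] by linarith
    then have "2 * \<bar>1 - w i n\<bar> / sqrt (real n) \<le> 2 * (1 + C) / sqrt (real n)"
      by (intro divide_right_mono) auto
    moreover have "\<bar>a n i\<bar> = 2 * \<bar>1 - w i n\<bar> / sqrt (real n)"
      unfolding a_def abs_divide abs_mult by simp
    ultimately show ?thesis
      by (simp only:)
  qed
  have inv_sqrt: "(\<lambda>n. x / sqrt (real n)) \<longlonglongrightarrow> 0" for x :: real
    by (intro tendsto_divide_0[OF tendsto_const] filterlim_at_top_imp_at_infinity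
        filterlim_compose[OF sqrt_at_top] filterlim_real_sequentially)
  have a_sum: "(\<lambda>n. \<Sum>i=1..n. (a n i)\<^sup>2) \<longlonglongrightarrow> 4 * (w2 - 1)"
  proof -
    have dev: "(\<lambda>n. ((\<Sum>i=1..n. w i n) - real n) / real n) \<longlonglongrightarrow> 0"
    proof (rule Lim_null_comparison[where g = "\<lambda>n. \<tau> / real n"])
      show "\<forall>\<^sub>F n in sequentially. norm (((\<Sum>i=1..n. w i n) - real n) / real n) \<le> \<tau> / real n"
        using eventually_gt_at_top[of 0] by eventually_elim (use w_mean in \<open>auto simp: divide_right_mono\<close>)
      show "(\<lambda>n. \<tau> / real n) \<longlonglongrightarrow> 0"
        by (intro tendsto_divide_0[OF tendsto_const] filterlim_at_top_imp_at_infinity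
          filterlim_real_sequentially)
    qed
    have "(\<lambda>n. 4 * (1 / real n * (\<Sum>i=1..n. (w i n)\<^sup>2) - 2 * (((\<Sum>i=1..n. w i n) - real n) / real n) - 1))
        \<longlonglongrightarrow> 4 * (w2 - 2 * 0 - 1)"
      by (intro tendsto_intros w_square dev)
    moreover have "\<forall>\<^sub>F n in sequentially.
        4 * (1 / real n * (\<Sum>i=1..n. (w i n)\<^sup>2) - 2 * (((\<Sum>i=1..n. w i n) - real n) / real n) - 1)
        = (\<Sum>i=1..n. (a n i)\<^sup>2)"
      using eventually_gt_at_top[of 0]
    proof eventually_elim
      case (elim n)
      have "(\<Sum>i=1..n. (1 - w i n)\<^sup>2) = real n - 2 * (\<Sum>i=1..n. w i n) + (\<Sum>i=1..n. (w i n)\<^sup>2)"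
        by (simp add: power2_diff sum.distrib sum_subtractf sum_distrib_left)
      moreover have "(\<Sum>i=1..n. (a n i)\<^sup>2) = 4 / real n * (\<Sum>i=1..n. (1 - w i n)\<^sup>2)"
        unfolding a_square by (simp add: sum_distrib_left)
      ultimately show ?case
        using elim by (simp add: field_simps)
    qed
    ultimately show ?thesis
      by (simp add: tendsto_cong)
  qed
  have S_lim: "tendsto_prob S c"
  proof -
    have "tendsto_prob (\<lambda>n \<omega>. sqrt (4 * (w2 - 1)) * sqrt (alpha_hat_sq K n (\<lambda>i. fst (Z i \<omega>)) (\<lambda>i. snd (Z i \<omega>)))) c"
      unfolding c_def
      by (rule tendsto_prob_continuous[OF alpha_hat_consistent, of "\<lambda>x. sqrt (4 * (w2 - 1)) * x"])
        (auto intro!: continuous_intros)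
    then show ?thesis unfolding S_eq[abs_def] .
  qed
  have inv_S: "tendsto_prob (\<lambda>n \<omega>. 1 / S n \<omega> - 1 / c) 0"
    using tendsto_prob_continuous[OF S_lim, of "\<lambda>x. 1 / x - 1 / c"] c
    by (simp add: continuous_intros)
  have diff: "tendsto_prob (\<lambda>n \<omega>. N n \<omega> - L n \<omega>) 0"
  proof (rule tendsto_prob_of_expectation)
    show "random_variable borel (\<lambda>\<omega>. N n \<omega> - L n \<omega>)" for n
      by (intro borel_measurable_diff N_meas L_meas)
    show "integrable M (Q n)" for n by (rule Q_int)
    show "\<bar>N n \<omega> - L n \<omega> - 0\<bar> \<le> Q n \<omega>" if "0 < n" for n \<omega>
      using close[OF that] by simp
    show "expectation (Q n) \<le> D / sqrt (real n)" if "0 < n" for n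
      by (rule Q_E[OF that])
    show "(\<lambda>n. D / sqrt (real n)) \<longlonglongrightarrow> 0"
      by (rule inv_sqrt)
  qed
  have L2_int: "integrable M (\<lambda>\<omega>. (L n \<omega>)\<^sup>2)" for n
    unfolding L_def by (rule integrable_square_weighted_sum[OF projection_measurable projection_square projection_mean])
  have L2_E: "expectation (\<lambda>\<omega>. (L n \<omega>)\<^sup>2) = projection_var * (\<Sum>i=1..n. (a n i)\<^sup>2)" for n
    unfolding L_def projection_var_def
    by (rule expectation_square_weighted_sum[OF projection_measurable projection_square projection_mean])
  have scaled: "tendsto_prob (\<lambda>n \<omega>. (1 / S n \<omega> - 1 / c) * N n \<omega>) 0"
  proof (rule tendsto_prob_mult_bounded[OF inv_S N_meas])
    show "integrable M (\<lambda>\<omega>. Q n \<omega> + (1 + (L n \<omega>)\<^sup>2))" for n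
      by (intro Bochner_Integration.integrable_add Q_int L2_int) auto
    show "\<bar>N n \<omega>\<bar> \<le> Q n \<omega> + (1 + (L n \<omega>)\<^sup>2)" if "0 < n" for n \<omega>
      using close[OF that, of \<omega>] abs_le_square_over[of 1 "L n \<omega>"] by linarith
    show "expectation (\<lambda>\<omega>. Q n \<omega> + (1 + (L n \<omega>)\<^sup>2)) \<le> D + (1 + projection_var * (4 * (1 + C)\<^sup>2))" if n: "0 < n" for n
    proof -
      have "expectation (\<lambda>\<omega>. Q n \<omega> + (1 + (L n \<omega>)\<^sup>2)) = expectation (Q n) + (1 + projection_var * (\<Sum>i=1..n. (a n i)\<^sup>2))"
        using Q_int L2_int L2_E[of n] by (simp add: prob_space)
      moreover have "expectation (Q n) \<le> D"
      proof -
        have "D / sqrt (real n) \<le> D / 1"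
          using n D by (intro divide_left_mono) auto
        then show ?thesis using Q_E[OF n] by simp
      qed
      moreover have "(\<Sum>i=1..n. (a n i)\<^sup>2) \<le> 4 * (1 + C)\<^sup>2"
      proof -
        have "(\<Sum>i=1..n. (a n i)\<^sup>2) \<le> (\<Sum>i=1..n. 4 * (1 + C)\<^sup>2 / real n)"
        proof (rule sum_mono)
          fix i assume "i \<in> {1..n}"
          then have "\<bar>a n i\<bar>\<^sup>2 \<le> (2 * (1 + C) / sqrt (real n))\<^sup>2"
            by (intro power_mono a_bound) auto
          then show "(a n i)\<^sup>2 \<le> 4 * (1 + C)\<^sup>2 / real n"
            unfolding power_divide power_mult_distrib by simp
        qed
        also have "\<dots> = 4 * (1 + C)\<^sup>2"
          using n by simp
        finally show ?thesis .
      qed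
      ultimately show ?thesis
        using mult_left_mono[of "\<Sum>i=1..n. (a n i)\<^sup>2" "4 * (1 + C)\<^sup>2" projection_var] nondegenerate by linarith
    qed
  qed
  have "isCont (\<lambda>x. x / c) 0"
    using c by (intro continuous_intros) auto
  then have diff_c: "tendsto_prob (\<lambda>n \<omega>. (N n \<omega> - L n \<omega>) / c) 0"
    using tendsto_prob_continuous[OF diff, of "\<lambda>x. x / c"] by simp
  have total: "tendsto_prob (\<lambda>n \<omega>. sqrt (real n) * (K_hat K (\<lambda>i. w i n) n (\<lambda>i. fst (Z i \<omega>)) (\<lambda>i. snd (Z i \<omega>)) / S n \<omega>)
      - (\<Sum>i=1..n. a n i / c * projection (Z i \<omega>))) 0"
  proof -
    have "(1 / S n \<omega> - 1 / c) * N n \<omega> + (N n \<omega> - L n \<omega>) / c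
        = sqrt (real n) * (K_hat K (\<lambda>i. w i n) n (\<lambda>i. fst (Z i \<omega>)) (\<lambda>i. snd (Z i \<omega>)) / S n \<omega>)
          - (\<Sum>i=1..n. a n i / c * projection (Z i \<omega>))" for n \<omega>
    proof -
      have "(1 / S n \<omega> - 1 / c) * N n \<omega> + (N n \<omega> - L n \<omega>) / c = N n \<omega> / S n \<omega> - L n \<omega> / c"
        by (simp add: left_diff_distrib diff_divide_distrib)
      also have "L n \<omega> / c = (\<Sum>i=1..n. a n i / c * projection (Z i \<omega>))"
        unfolding L_def sum_divide_distrib by simp
      finally show ?thesis by (simp add: N_def)
    qed
    then show ?thesis
      using tendsto_prob_add[OF scaled diff_c] by simp
  qed
  show ?thesis
    unfolding S_def[symmetric]
  proof (rule weak_conv_perturb[OF _ _ _ _ total])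
    show "(\<lambda>n. char (distr M borel (\<lambda>\<omega>. \<Sum>i=1..n. a n i / c * projection (Z i \<omega>))) t)
        \<longlonglongrightarrow> char std_normal_distribution t" for t
    proof (rule weighted_central_limit[OF projection_measurable projection_square projection_mean])
      show "\<bar>a n i / c\<bar> \<le> (2 * (1 + C) / c) / sqrt (real n)" if "i \<in> {1..n}" for n i
        using divide_right_mono[OF a_bound[OF that], of c] c by (simp add: mult.commute)
      show "(\<lambda>n. (2 * (1 + C) / c) / sqrt (real n)) \<longlonglongrightarrow> 0"
        by (rule inv_sqrt)
      have "(\<lambda>n. projection_var / c\<^sup>2 * (\<Sum>i=1..n. (a n i)\<^sup>2)) \<longlonglongrightarrow> projection_var / c\<^sup>2 * (4 * (w2 - 1))"
        by (intro tendsto_intros a_sum)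
      moreover have "projection_var / c\<^sup>2 * (4 * (w2 - 1)) = 1"
        unfolding c2 using w2 nondegenerate by simp
      moreover have "projection_var / c\<^sup>2 * (\<Sum>i=1..n. (a n i)\<^sup>2) = projection_var * (\<Sum>i=1..n. (a n i / c)\<^sup>2)" for n
        by (simp add: power_divide sum_divide_distrib[symmetric])
      ultimately show "(\<lambda>n. (\<integral>z. (projection z)\<^sup>2 \<partial>\<nu>) * (\<Sum>i=1..n. (a n i / c)\<^sup>2)) \<longlonglongrightarrow> 1"
        by (simp only: projection_var_def)
    qed
    show "real_distribution std_normal_distribution"
      by (rule real_dist_normal_dist)
    show "random_variable borel (\<lambda>\<omega>. \<Sum>i=1..n. a n i / c * projection (Z i \<omega>))" for n
      by (rule sum_Z_measurable) measurable
    show "random_variable borel (\<lambda>\<omega>. sqrt (real n) * (K_hat K (\<lambda>i. w i n) n (\<lambda>i. fst (Z i \<omega>)) (\<lambda>i. snd (Z i \<omega>)) / S n \<omega>))" for n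
      by (intro borel_measurable_times borel_measurable_const borel_measurable_divide K_hat_measurable S_meas)
  qed
qed

end

section \<open>The test statistic under mean independence\<close>

text \<open>
  Real-valued conditional expectations suffice: the inner product of a version of \<open>E (Y | X)\<close> with
  \<open>y\<close> is a version of \<open>E (\<langle>y, Y\<rangle> | X)\<close>, and bounded functions of \<open>X\<close> can be taken out.
\<close>

lemma cond_exp_constant_product:
  fixes Y :: "'w \<Rightarrow> 'y::{real_inner, banach, second_countable_topology}"
  assumes "prob_space M" and X: "X \<in> borel_measurable M"
    and ce: "is_cond_exp M (vimage_algebra (space M) X borel) Y EYX"
    and const: "AE \<omega> in M. EYX \<omega> = integral\<^sup>L M Y"
    and f: "f \<in> borel_measurable borel" "bounded (range f)"
  shows "(\<integral>\<omega>. f (X \<omega>) * (y \<bullet> Y \<omega>) \<partial>M) = (\<integral>\<omega>. f (X \<omega>) \<partial>M) * (y \<bullet> integral\<^sup>L M Y)"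
proof -
  interpret prob_space M by fact
  let ?F = "vimage_algebra (space M) X borel"
  have sub: "subalgebra M ?F" and Y: "integrable M Y" and E: "integrable M EYX"
    and EF: "EYX \<in> borel_measurable ?F"
    and set_eq: "\<And>A. A \<in> sets ?F \<Longrightarrow> set_lebesgue_integral M A EYX = set_lebesgue_integral M A Y"
    using ce unfolding is_cond_exp_def by auto
  interpret finite_measure_subalgebra M ?F
    by unfold_locales (rule sub)
  have yY: "integrable M (\<lambda>\<omega>. y \<bullet> Y \<omega>)" and yE: "integrable M (\<lambda>\<omega>. y \<bullet> EYX \<omega>)"
    using Y E by simp_all
  have inner_set: "(\<integral>\<omega>\<in>A. (y \<bullet> g \<omega>) \<partial>M) = y \<bullet> (\<integral>\<omega>\<in>A. g \<omega> \<partial>M)"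
    if "integrable M g" "A \<in> sets ?F" for g :: "'w \<Rightarrow> 'y" and A
  proof -
    have "A \<in> sets M"
      using sub that(2) unfolding subalgebra_def by blast
    then have "integrable M (\<lambda>\<omega>. indicator A \<omega> *\<^sub>R g \<omega>)"
      by (rule integrable_mult_indicator[OF _ that(1)])
    then have "(\<integral>\<omega>. y \<bullet> (indicator A \<omega> *\<^sub>R g \<omega>) \<partial>M) = y \<bullet> (\<integral>\<omega>. indicator A \<omega> *\<^sub>R g \<omega> \<partial>M)"
      by (intro integral_inner_right)
    then show ?thesis
      by (simp add: set_lebesgue_integral_def)
  qed
  have rce: "AE \<omega> in M. real_cond_exp M ?F (\<lambda>\<omega>. y \<bullet> Y \<omega>) \<omega> = y \<bullet> EYX \<omega>"
  proof (rule real_cond_exp_charact[OF _ yY yE])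
    show "(\<lambda>\<omega>. y \<bullet> EYX \<omega>) \<in> borel_measurable ?F"
      using EF by (intro borel_measurable_inner) auto
    show "(\<integral>\<omega>\<in>A. (y \<bullet> Y \<omega>) \<partial>M) = (\<integral>\<omega>\<in>A. (y \<bullet> EYX \<omega>) \<partial>M)" if "A \<in> sets ?F" for A
      using inner_set[OF Y that] inner_set[OF E that] set_eq[OF that] by simp
  qed
  obtain B where B: "\<And>x. \<bar>f x\<bar> \<le> B"
    using f(2) by (auto simp: bounded_iff)
  have fX: "(\<lambda>\<omega>. f (X \<omega>)) \<in> borel_measurable M"
    by (rule measurable_compose[OF X f(1)])
  have fXF: "(\<lambda>\<omega>. f (X \<omega>)) \<in> borel_measurable ?F"
    by (rule measurable_compose[OF measurable_vimage_algebra1 f(1)]) auto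
  have int: "integrable M (\<lambda>\<omega>. f (X \<omega>) * (y \<bullet> Y \<omega>))"
  proof (rule Bochner_Integration.integrable_bound)
    show "integrable M (\<lambda>\<omega>. B * (y \<bullet> Y \<omega>))"
      using yY by simp
    show "(\<lambda>\<omega>. f (X \<omega>) * (y \<bullet> Y \<omega>)) \<in> borel_measurable M"
      using fX yY by (intro borel_measurable_times) auto
    have "\<bar>f (X \<omega>)\<bar> * \<bar>y \<bullet> Y \<omega>\<bar> \<le> \<bar>B\<bar> * \<bar>y \<bullet> Y \<omega>\<bar>" for \<omega>
      using B[of "X \<omega>"] by (intro mult_right_mono) auto
    then show "AE \<omega> in M. norm (f (X \<omega>) * (y \<bullet> Y \<omega>)) \<le> norm (B * (y \<bullet> Y \<omega>))"
      by (simp add: abs_mult)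
  qed
  have "(\<integral>\<omega>. f (X \<omega>) * (y \<bullet> Y \<omega>) \<partial>M)
      = (\<integral>\<omega>. f (X \<omega>) * real_cond_exp M ?F (\<lambda>\<omega>. y \<bullet> Y \<omega>) \<omega> \<partial>M)"
    using real_cond_exp_intg(2)[OF int fXF] yY by simp
  also have "\<dots> = (\<integral>\<omega>. f (X \<omega>) * (y \<bullet> integral\<^sup>L M Y) \<partial>M)"
  proof (rule integral_cong_AE)
    show "(\<lambda>\<omega>. f (X \<omega>) * real_cond_exp M ?F (\<lambda>\<omega>. y \<bullet> Y \<omega>) \<omega>) \<in> borel_measurable M"
      by (intro borel_measurable_times fX borel_measurable_cond_exp2)
    show "(\<lambda>\<omega>. f (X \<omega>) * (y \<bullet> integral\<^sup>L M Y)) \<in> borel_measurable M"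
      by (intro borel_measurable_times fX) simp
    show "AE \<omega> in M. f (X \<omega>) * real_cond_exp M ?F (\<lambda>\<omega>. y \<bullet> Y \<omega>) \<omega> = f (X \<omega>) * (y \<bullet> integral\<^sup>L M Y)"
      using rce const by eventually_elim simp
  qed
  finally show ?thesis by simp
qed

theorem theorem2:
  fixes M :: "'w measure"
    and X :: "'w \<Rightarrow> 'x::{real_inner, banach, second_countable_topology}"
    and Y :: "'w \<Rightarrow> 'y::{real_inner, banach, second_countable_topology}"
    and Xs :: "nat \<Rightarrow> 'w \<Rightarrow> 'x"
    and Ys :: "nat \<Rightarrow> 'w \<Rightarrow> 'y"
    and H :: "('x \<Rightarrow> real) set"
    and ip :: "('x \<Rightarrow> real) \<Rightarrow> ('x \<Rightarrow> real) \<Rightarrow> real"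
    and K :: "'x \<Rightarrow> 'x \<Rightarrow> real"
    and w :: "nat \<Rightarrow> nat \<Rightarrow> real \<Rightarrow> real"
    and w_lim :: "real \<Rightarrow> real"
    and \<gamma> :: real
    and EYX :: "'w \<Rightarrow> 'y"
  assumes prob: "prob_space M"
    and kernel: "rkhs H ip K"
    and kernel_measurable: "(\<lambda>(x, x'). K x x') \<in> borel_measurable (borel \<Otimes>\<^sub>M borel)"
    and X_rv: "X \<in> borel_measurable M"
    and Y_rv: "Y \<in> borel_measurable M"
    and Y_square_integrable: "integrable M (\<lambda>\<omega>. (norm (Y \<omega>))\<^sup>2)"
    and sample_indep:
      "prob_space.indep_vars M (\<lambda>_. borel \<Otimes>\<^sub>M borel) (\<lambda>i \<omega>. (Xs i \<omega>, Ys i \<omega>)) {1..}"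
    and sample_distr:
      "\<And>i. 1 \<le> i \<Longrightarrow>
        distr M (borel \<Otimes>\<^sub>M borel) (\<lambda>\<omega>. (Xs i \<omega>, Ys i \<omega>)) =
        distr M (borel \<Otimes>\<^sub>M borel) (\<lambda>\<omega>. (X \<omega>, Y \<omega>))"
    and gamma: "\<gamma> \<in> {0<..<1}"
    and w_pos: "\<forall>\<gamma>'\<in>{0<..<1}. \<forall>n. \<forall>i\<in>{1..n}. 0 < w i n \<gamma>'"
    and A1: "bdd_above (range (\<lambda>(x, x'). K x x'))"
    and A2: "\<exists>\<tau>>0. \<exists>n0::nat. \<forall>n>n0. real n * \<bar>1 / real n * (\<Sum>i=1..n. w i n \<gamma>) - 1\<bar> \<le> \<tau>"
    and A3: "\<exists>C>0. \<forall>n\<ge>1. \<forall>\<gamma>'\<in>{0<..<1}. (MAX i\<in>{1..n}. w i n \<gamma>') < C"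
    and A4: "\<forall>\<gamma>'\<in>{0<..<1}.
        (\<lambda>n. 1 / real n * (\<Sum>i=1..n. (w i n \<gamma>')\<^sup>2)) \<longlonglongrightarrow> (w_lim \<gamma>')\<^sup>2 \<and> (w_lim \<gamma>')\<^sup>2 > 1"
    and EYX: "is_cond_exp M (vimage_algebra (space M) X borel) Y EYX"
    and H0: "AE \<omega> in M. EYX \<omega> = integral\<^sup>L M Y"
    and nondegenerate: "0 < alpha_sq M K X Y"
  shows "weak_conv_m
      (\<lambda>n. distr M borel (\<lambda>\<omega>.
         sqrt (real n)
         * (K_hat K (\<lambda>i. w i n \<gamma>) n (\<lambda>i. Xs i \<omega>) (\<lambda>i. Ys i \<omega>)
            / sigma_hat K ((w_lim \<gamma>)\<^sup>2) n (\<lambda>i. Xs i \<omega>) (\<lambda>i. Ys i \<omega>))))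
      std_normal_distribution"
proof -
  interpret prob_space M by (rule prob)
  define N where "N = (borel :: 'x measure) \<Otimes>\<^sub>M (borel :: 'y measure)"
  define \<nu> where "\<nu> = distr M N (\<lambda>\<omega>. (X \<omega>, Y \<omega>))"
  define Z where "Z i \<omega> = (Xs i \<omega>, Ys i \<omega>)" for i \<omega>
  define m where "m = integral\<^sup>L M Y"
  have XY: "(\<lambda>\<omega>. (X \<omega>, Y \<omega>)) \<in> M \<rightarrow>\<^sub>M N"
    unfolding N_def using X_rv Y_rv by (rule measurable_Pair)
  have sets_\<nu>: "sets \<nu> = sets N"
    by (simp add: \<nu>_def)
  obtain \<kappa> where \<kappa>: "\<And>x x'. K x x' \<le> \<kappa>"
    using A1 unfolding bdd_above_def by auto
  have integral_\<nu>: "(\<integral>z. g z \<partial>\<nu>) = (\<integral>\<omega>. g (X \<omega>, Y \<omega>) \<partial>M)" if "g \<in> borel_measurable N" for g :: "'x \<times> 'y \<Rightarrow> real"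
    unfolding \<nu>_def by (rule integral_distr[OF XY that])
  have fst_N: "fst \<in> N \<rightarrow>\<^sub>M borel" and snd_N: "snd \<in> N \<rightarrow>\<^sub>M borel"
    unfolding N_def by simp_all
  interpret kernel_sample H ip K M \<nu> Z \<kappa> m
  proof (intro kernel_sample.intro kernel kernel_sample_axioms.intro iid_sample.intro
      iid_sample_axioms.intro prob)
    show "indep_vars (\<lambda>_. \<nu>) Z {1..}"
      using sample_indep unfolding indep_vars_def Z_def[abs_def] \<nu>_def N_def by simp
    show "distr M \<nu> (Z i) = \<nu>" if "1 \<le> i" for i
    proof -
      have "distr M \<nu> (Z i) = distr M N (\<lambda>\<omega>. (Xs i \<omega>, Ys i \<omega>))"
        by (rule distr_cong) (simp_all add: sets_\<nu> Z_def)
      then show ?thesis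
        using sample_distr[OF that] by (simp add: \<nu>_def N_def)
    qed
    show "sets \<nu> = sets (borel \<Otimes>\<^sub>M borel)"
      by (simp add: sets_\<nu> N_def)
    show "(\<lambda>(x, x'). K x x') \<in> borel_measurable (borel \<Otimes>\<^sub>M borel)"
      by (rule kernel_measurable)
    show "K x x' \<le> \<kappa>" for x x'
      by (rule \<kappa>)
    have norm_N: "(\<lambda>z. (norm (snd z))\<^sup>2) \<in> borel_measurable N"
      by (intro borel_measurable_power measurable_compose[OF snd_N borel_measurable_norm])
    show "integrable \<nu> (\<lambda>z. (norm (snd z))\<^sup>2)"
      unfolding \<nu>_def integrable_distr_eq[OF XY norm_N] using Y_square_integrable by simp
    fix f :: "'x \<Rightarrow> real" and y :: 'y
    assume f: "f \<in> borel_measurable borel" "bounded (range f)"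
    have ff: "(\<lambda>z. f (fst z)) \<in> borel_measurable N"
      by (rule measurable_compose[OF fst_N f(1)])
    have fy: "(\<lambda>z. f (fst z) * (y \<bullet> snd z)) \<in> borel_measurable N"
      by (intro borel_measurable_times ff borel_measurable_inner snd_N) simp
    show "(\<integral>z. f (fst z) * (y \<bullet> snd z) \<partial>\<nu>) = (\<integral>z. f (fst z) \<partial>\<nu>) * (y \<bullet> m)"
      unfolding integral_\<nu>[OF ff] integral_\<nu>[OF fy] m_def
      using cond_exp_constant_product[OF prob X_rv EYX H0 f] by simp
  qed
  have var: "projection_var = alpha_sq M K X Y"
  proof -
    let ?k = "kernel_mean kxy"
    have k_meas: "?k \<in> borel_measurable N"
      using kernel_mean_measurable[OF dominated_kxy] by (simp add: measurable_cong_sets[OF sets_\<nu> refl])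
    have k_eq: "?k z = (\<integral>\<omega>. (snd z \<bullet> Y \<omega>) * K (fst z) (X \<omega>) \<partial>M)" for z
    proof -
      have "kxy z \<in> borel_measurable N"
        unfolding kxy_def[abs_def]
        by (intro borel_measurable_times borel_measurable_inner borel_measurable_const
            K_compose_measurable fst_N snd_N)
      then show ?thesis
        unfolding kernel_mean_def by (subst integral_\<nu>) (simp_all add: kxy_def)
    qed
    have "(\<lambda>z. (projection z)\<^sup>2) \<in> borel_measurable N"
      unfolding projection_def by (intro borel_measurable_power borel_measurable_diff k_meas borel_measurable_const)
    then have "projection_var = (\<integral>\<omega>. (?k (X \<omega>, Y \<omega>) - (\<integral>\<omega>'. ?k (X \<omega>', Y \<omega>') \<partial>M))\<^sup>2 \<partial>M)"
      unfolding projection_var_def by (subst integral_\<nu>) (simp_all add: projection_def kernel_double_mean_def integral_\<nu>[OF k_meas])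
    then show ?thesis
      unfolding alpha_sq_def Let_def k_eq by simp
  qed
  obtain C where C: "\<And>n. 1 \<le> n \<Longrightarrow> (MAX i\<in>{1..n}. w i n \<gamma>) < C"
    using A3 gamma by blast
  have w_bound: "\<bar>w i n \<gamma>\<bar> \<le> C" if i: "i \<in> {1..n}" for i n
  proof -
    have "w i n \<gamma> \<le> (MAX i\<in>{1..n}. w i n \<gamma>)"
      using i by (intro Max_ge) auto
    moreover have "0 < w i n \<gamma>"
      using w_pos gamma i by blast
    moreover have "(MAX i\<in>{1..n}. w i n \<gamma>) < C"
      by (rule C) (use i in simp)
    ultimately show ?thesis
      by linarith
  qed
  obtain \<tau> n0 where \<tau>: "\<And>n. n0 < n \<Longrightarrow> real n * \<bar>1 / real n * (\<Sum>i=1..n. w i n \<gamma>) - 1\<bar> \<le> \<tau>"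
    using A2 by blast
  \<comment> \<open>the finitely many sample sizes up to n0 are covered by the bound on the weights\<close>
  have w_mean: "\<bar>(\<Sum>i=1..n. w i n \<gamma>) - real n\<bar> \<le> max \<tau> (real n0 * (C + 1))" if n: "0 < n" for n
  proof (cases "n0 < n")
    case True
    have "real n * \<bar>1 / real n * (\<Sum>i=1..n. w i n \<gamma>) - 1\<bar>
        = \<bar>real n * (1 / real n * (\<Sum>i=1..n. w i n \<gamma>) - 1)\<bar>"
      by (simp add: abs_mult)
    also have "real n * (1 / real n * (\<Sum>i=1..n. w i n \<gamma>) - 1) = (\<Sum>i=1..n. w i n \<gamma>) - real n"
      using n by (simp add: field_simps)
    finally show ?thesis
      using \<tau>[OF True] by simp
  next
    case False
    have "\<bar>(\<Sum>i=1..n. w i n \<gamma>) - real n\<bar> \<le> \<bar>\<Sum>i=1..n. w i n \<gamma>\<bar> + real n"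
      by simp
    also have "\<bar>\<Sum>i=1..n. w i n \<gamma>\<bar> \<le> (\<Sum>i=1..n. C)"
      by (rule order_trans[OF sum_abs sum_mono]) (rule w_bound)
    also have "(\<Sum>i=1..n. C) + real n = real n * (C + 1)"
      by (simp add: algebra_simps)
    also have "\<dots> \<le> real n0 * (C + 1)"
      using False w_bound[of 1 1] by (intro mult_right_mono) auto
    finally show ?thesis by simp
  qed
  have "weak_conv_m
      (\<lambda>n. distr M borel (\<lambda>\<omega>.
         sqrt (real n) * (K_hat K (\<lambda>i. w i n \<gamma>) n (\<lambda>i. fst (Z i \<omega>)) (\<lambda>i. snd (Z i \<omega>))
           / sigma_hat K ((w_lim \<gamma>)\<^sup>2) n (\<lambda>i. fst (Z i \<omega>)) (\<lambda>i. snd (Z i \<omega>)))))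
      std_normal_distribution"
    using A4 gamma nondegenerate var w_bound w_mean by (intro studentized_K_hat_normal) auto
  then show ?thesis
    by (simp add: Z_def)
qed

end
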